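(* Let $\Omega\subseteq\mathbb{R}^n$ ($n\geq3$) be an open bounded set, with smooth boundary, let $\alpha,\beta\in L^{\frac{2n}{n+2}}(\Omega)$, and let $a,b,c,s,q$ be five real numbers, with $b,c>0$, $0<s<1$ and $1<q<\frac{n+2}{n-2}$. Let $f:\mathbb{R}\to\mathbb{R}$ be the function defined by $$f(\xi)=\begin{cases}\xi^{\frac{n+2}{n-2}} & \text{if }\xi\geq0\\ 0 & \text{if }\xi<0.\end{cases}$$ Then there exists $\lambda^*>0$ such that, for each $\lambda\in\,]0,\lambda^*[$, the problem $$\begin{cases}-\Delta u=a|u|^{s-1}u+\alpha(x)+\lambda\left(b|u|^{q-1}u-cf(u)+\beta(x)\right) & \text{in }\Omega\\ u_{|\partial\Omega}=0\end{cases}$$ has at least one weak solution in $W^{1,2}_0(\Omega)$.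
   Context: $]0,\lambda^*[$ denotes the open interval. The expression $|u|^{s-1}u$ is understood to be $0$ where $u=0$. A weak solution of the problem is a function $u\in W^{1,2}_0(\Omega)$ such that, for all $v\in W^{1,2}_0(\Omega)$, $$\int_\Omega\nabla u\cdot\nabla v\,dx=\int_\Omega\left[a|u|^{s-1}u+\alpha(x)+\lambda\left(b|u|^{q-1}u-cf(u)+\beta(x)\right)\right]v\,dx.$$ *)

theory Defs
  imports "HOL-Analysis.Analysis"
begin

primrec times_cont_diff :: "nat \<Rightarrow> ('a::real_normed_vector \<Rightarrow> real) \<Rightarrow> bool" where
  "times_cont_diff 0 f \<longleftrightarrow> continuous_on UNIV f"
| "times_cont_diff (Suc k) f \<longleftrightarrow>
     (\<forall>x. f differentiable (at x)) \<and>
     (\<forall>v. times_cont_diff k (\<lambda>x. frechet_derivative f (at x) v))"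

definition smooth :: "('a::real_normed_vector \<Rightarrow> real) \<Rightarrow> bool" where
  "smooth f \<longleftrightarrow> (\<forall>k. times_cont_diff k f)"

definition partial_deriv :: "'n \<Rightarrow> (real^'n \<Rightarrow> real) \<Rightarrow> real^'n \<Rightarrow> real" where
  "partial_deriv i f x = frechet_derivative f (at x) (axis i 1)"

text \<open>
  Near each boundary point the set is, up to relabelling and reorienting the axes, the region
  strictly above the graph of a smooth function of the remaining \<open>n - 1\<close> coordinates. Such a
  function is represented by a smooth \<open>\<gamma>\<close> on the whole space that does not depend on the
  coordinate \<open>i\<close>; \<open>\<sigma>\<close> is the orientation of the \<open>i\<close>-th axis.
\<close>
definition smooth_boundary :: "(real^'n) set \<Rightarrow> bool" where
  "smooth_boundary \<Omega> \<longleftrightarrow>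
     (\<forall>x0 \<in> frontier \<Omega>. \<exists>r > 0. \<exists>i. \<exists>\<sigma> \<in> {-1, 1}. \<exists>\<gamma> :: real^'n \<Rightarrow> real.
        smooth \<gamma> \<and> (\<forall>x t. \<gamma> (x + t *\<^sub>R axis i 1) = \<gamma> x) \<and>
        \<Omega> \<inter> ball x0 r = {x \<in> ball x0 r. \<sigma> * (x $ i) > \<gamma> x})"

text \<open>
  Functions on \<open>\<Omega>\<close> are represented by total functions, of which only the values on \<open>\<Omega>\<close> matter.
\<close>
definition Lp_on :: "(real^'n) set \<Rightarrow> real \<Rightarrow> (real^'n \<Rightarrow> real) set" where
  "Lp_on \<Omega> p = {u \<in> borel_measurable (lebesgue_on \<Omega>).
                  integrable (lebesgue_on \<Omega>) (\<lambda>x. \<bar>u x\<bar> powr p)}"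

definition test_functions :: "(real^'n) set \<Rightarrow> (real^'n \<Rightarrow> real) set" where
  "test_functions \<Omega> = {\<phi>. smooth \<phi> \<and> compact (closure {x. \<phi> x \<noteq> 0}) \<and>
                           closure {x. \<phi> x \<noteq> 0} \<subseteq> \<Omega>}"

definition weak_gradient_L2 ::
  "(real^'n) set \<Rightarrow> (real^'n \<Rightarrow> real) \<Rightarrow> (real^'n \<Rightarrow> real^'n) \<Rightarrow> bool" where
  "weak_gradient_L2 \<Omega> u g \<longleftrightarrow>
     (\<forall>i. (\<lambda>x. g x $ i) \<in> Lp_on \<Omega> 2) \<and>
     (\<forall>\<phi> \<in> test_functions \<Omega>. \<forall>i.
        (LINT x|lebesgue_on \<Omega>. u x * partial_deriv i \<phi> x) =
        - (LINT x|lebesgue_on \<Omega>. g x $ i * \<phi> x))"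

definition W12 :: "(real^'n) set \<Rightarrow> (real^'n \<Rightarrow> real) set" where
  "W12 \<Omega> = {u \<in> Lp_on \<Omega> 2. \<exists>g. weak_gradient_L2 \<Omega> u g}"

text \<open>
  On an open set the weak gradient is unique up to a null set, so the choice made here affects
  none of the integrals below.
\<close>
definition wgrad :: "(real^'n) set \<Rightarrow> (real^'n \<Rightarrow> real) \<Rightarrow> real^'n \<Rightarrow> real^'n" where
  "wgrad \<Omega> u = (SOME g. weak_gradient_L2 \<Omega> u g)"

definition W12_norm :: "(real^'n) set \<Rightarrow> (real^'n \<Rightarrow> real) \<Rightarrow> real" where
  "W12_norm \<Omega> u = sqrt ((LINT x|lebesgue_on \<Omega>. (u x)\<^sup>2) +
                        (LINT x|lebesgue_on \<Omega>. (norm (wgrad \<Omega> u x))\<^sup>2))"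

definition W12_0 :: "(real^'n) set \<Rightarrow> (real^'n \<Rightarrow> real) set" where
  "W12_0 \<Omega> = {u \<in> W12 \<Omega>. \<forall>\<epsilon> > 0. \<exists>\<phi> \<in> test_functions \<Omega>. W12_norm \<Omega> (\<lambda>x. u x - \<phi> x) < \<epsilon>}"

text \<open>
  Weak solutions of \<open>-\<Delta>u = h(x, u)\<close> in \<open>\<Omega>\<close>, \<open>u = 0\<close> on the boundary. Integrability is required
  explicitly because the Bochner integral of a non-integrable function is \<open>0\<close> by convention.
\<close>
definition weak_solution ::
  "(real^'n) set \<Rightarrow> (real^'n \<Rightarrow> real \<Rightarrow> real) \<Rightarrow> (real^'n \<Rightarrow> real) \<Rightarrow> bool" where
  "weak_solution \<Omega> h u \<longleftrightarrow> u \<in> W12_0 \<Omega> \<and>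
     (\<forall>v \<in> W12_0 \<Omega>.
        integrable (lebesgue_on \<Omega>) (\<lambda>x. wgrad \<Omega> u x \<bullet> wgrad \<Omega> v x) \<and>
        integrable (lebesgue_on \<Omega>) (\<lambda>x. h x (u x) * v x) \<and>
        (LINT x|lebesgue_on \<Omega>. wgrad \<Omega> u x \<bullet> wgrad \<Omega> v x) =
        (LINT x|lebesgue_on \<Omega>. h x (u x) * v x))"

end

theory Submission
  imports Defs "HOL-Complex_Analysis.Great_Picard" "HOL-Computational_Algebra.Polynomial"
begin

text \<open>
  Write \<open>n\<close> for the dimension and \<open>P = 2 n / (n - 2)\<close> for the critical Sobolev exponent; the exponents
  of \<open>f\<close> and of the data are \<open>P - 1\<close> and the conjugate exponent \<open>P' = P / (P - 1)\<close>. A weak solution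
  is a critical point of
  \<open>E u = 1/2 \<integral> |\<nabla>u|^2 + \<integral> F(u) - \<integral> k(u) - \<integral> h u\<close>,
  where \<open>F\<close> is \<open>lam c / P\<close> times the \<open>P\<close>-th power of the positive part, \<open>k\<close> is the primitive of
  \<open>a |t|^(s-1) t + lam b |t|^(q-1) t\<close>, and \<open>h = \<alpha> + lam \<beta>\<close>. The critical term has the good sign, so \<open>F\<close> is
  convex, while \<open>k\<close> grows more slowly than \<open>|t|^P\<close>. On negative functions the critical term vanishes
  and the term with \<open>b\<close> makes \<open>E\<close> unbounded below, so \<open>E\<close> is minimised over a ball of the gradient norm.
  Without the terms that carry \<open>lam\<close> the energy is coercive, because \<open>s + 1 < 2\<close>. Hence there is a radius
  beyond which it is positive, and for small \<open>lam\<close> it stays positive on a shell of unit width. As the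
  energy vanishes at \<open>0\<close>, minimising sequences stay away from the shell, and a minimiser over the ball
  is a free critical point (\<open>critical_problem_solvable\<close>).

  Existence of the minimiser uses strong rather than weak convergence. A minimising sequence of test
  functions has a subsequence that is Cauchy in mean square (\<open>Rellich\<close>), and for two of its members
  the parallelogram identity, the convexity of \<open>F\<close> and the lower bound of \<open>E\<close> at their midpoint
  bound the distance of their gradients by the excess of their energies plus the deviation of \<open>\<integral> k\<close> from
  being affine (\<open>dirichlet_diff_le\<close>). That deviation is small because \<open>k\<close> is subcritical
  (\<open>subcritical_modulus\<close>). So the gradients are Cauchy too, and the limit exists by completeness of
  the space of square-integrable functions (\<open>L2_complete\<close>).

  The critical norm is controlled by the gradient through Sobolev's inequality
  (\<open>Sobolev_inequality\<close>), which is derived from the inequality of Gagliardo by integrating out one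
  coordinate at a time. Sobolev's inequality is used only for test functions; together with Fatou's
  lemma it yields, for any sequence of test functions converging with its gradients, a subsequence with
  an integrable majorant in the critical norm (\<open>W_limit_dominated\<close>). All passages to the limit, in the energy,
  in its derivative and in the weak equation, are then dominated convergence.

  Since \<open>wgrad\<close> selects an arbitrary weak gradient, its uniqueness up to null sets is required; it follows
  from the fundamental lemma of the calculus of variations with explicit smooth bump functions on boxes.
\<close>

section \<open>Smooth functions and bump functions\<close>

lemma times_cont_diff_SucD: "times_cont_diff (Suc k) f \<Longrightarrow> times_cont_diff k f"
proof (induction k arbitrary: f)
  case 0
  then show ?case
    by (auto simp: continuous_on_eq_continuous_within intro!: differentiable_imp_continuous_within)
next
  case (Suc k)
  show ?case
    unfolding times_cont_diff.simps
    using Suc.prems Suc.IH unfolding times_cont_diff.simps(2) by blast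
qed

lemma times_cont_diff_const: "times_cont_diff k (\<lambda>x. c)"
  by (induction k arbitrary: c) auto

lemma times_cont_diff_add:
  "times_cont_diff k f \<Longrightarrow> times_cont_diff k g \<Longrightarrow> times_cont_diff k (\<lambda>x. f x + g x)"
proof (induction k arbitrary: f g)
  case 0
  then show ?case by (auto intro: continuous_on_add)
next
  case (Suc k)
  have d: "f differentiable (at x)" "g differentiable (at x)" for x
    using Suc.prems by auto
  have eq: "(\<lambda>x. frechet_derivative (\<lambda>x. f x + g x) (at x) v) =
        (\<lambda>x. frechet_derivative f (at x) v + frechet_derivative g (at x) v)" for v
    by (rule ext, subst frechet_derivative_at[symmetric,
          OF has_derivative_add[OF d(1)[unfolded frechet_derivative_works] d(2)[unfolded frechet_derivative_works]]]) simp
  show ?case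
    unfolding times_cont_diff.simps eq using d Suc by (auto intro: differentiable_add)
qed

lemma times_cont_diff_mult:
  "times_cont_diff k f \<Longrightarrow> times_cont_diff k g \<Longrightarrow> times_cont_diff k (\<lambda>x. f x * g x)"
proof (induction k arbitrary: f g)
  case 0
  then show ?case by (auto intro: continuous_on_mult)
next
  case (Suc k)
  have d: "f differentiable (at x)" "g differentiable (at x)" for x
    using Suc.prems by auto
  have eq: "(\<lambda>x. frechet_derivative (\<lambda>x. f x * g x) (at x) v) =
        (\<lambda>x. f x * frechet_derivative g (at x) v + frechet_derivative f (at x) v * g x)" for v
    by (rule ext, subst frechet_derivative_at[symmetric,
          OF has_derivative_mult[OF d(1)[unfolded frechet_derivative_works] d(2)[unfolded frechet_derivative_works]]]) simp
  have "times_cont_diff k f" "times_cont_diff k g"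
    using Suc.prems times_cont_diff_SucD by blast+
  then show ?case
    unfolding times_cont_diff.simps eq using d Suc
    by (auto intro!: differentiable_mult times_cont_diff_add)
qed

lemma smooth_const: "smooth (\<lambda>x. c)"
  and smooth_add: "smooth f \<Longrightarrow> smooth g \<Longrightarrow> smooth (\<lambda>x. f x + g x)"
  and smooth_mult: "smooth f \<Longrightarrow> smooth g \<Longrightarrow> smooth (\<lambda>x. f x * g x)"
  unfolding smooth_def by (auto intro: times_cont_diff_const times_cont_diff_add times_cont_diff_mult)

lemma smooth_prod: "finite I \<Longrightarrow> (\<And>i. i \<in> I \<Longrightarrow> smooth (f i)) \<Longrightarrow> smooth (\<lambda>x. \<Prod>i\<in>I. f i x)"
  by (induction I rule: finite_induct) (auto intro: smooth_const smooth_mult)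

text \<open>The functions \<open>p(1/t) exp(-1/t)\<close> with \<open>p\<close> a polynomial, extended by \<open>0\<close> to the left half-line, are
  flat at \<open>0\<close>. Taking all polynomials at once makes the family closed under differentiation, so that
  one induction proves smoothness of every member.\<close>
definition exp_flat :: "real poly \<Rightarrow> real \<Rightarrow> real" where
  "exp_flat P t = (if t > 0 then poly P (1 / t) * exp (- (1 / t)) else 0)"

lemma poly_times_exp_neg_tendsto_0: "((\<lambda>y. poly P y * exp (- y)) \<longlongrightarrow> (0::real)) at_top"
proof -
  have "((\<lambda>y. \<Sum>i\<le>degree P. coeff P i * (y ^ i / exp y)) \<longlongrightarrow> (\<Sum>i\<le>degree P. coeff P i * 0)) at_top"
    by (intro tendsto_sum tendsto_mult tendsto_const tendsto_power_div_exp_0)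
  moreover have "(\<lambda>y. \<Sum>i\<le>degree P. coeff P i * (y ^ i / exp y)) = (\<lambda>y. poly P y * exp (- y))"
    by (simp add: fun_eq_iff poly_altdef sum_distrib_right exp_minus divide_inverse mult.assoc)
  ultimately show ?thesis by simp
qed

lemma exp_flat_tendsto_0: "((\<lambda>t. exp_flat P t) \<longlongrightarrow> 0) (at 0)"
proof -
  have "((\<lambda>t. poly P (1 / t) * exp (- (1 / t))) \<longlongrightarrow> 0) (at_right 0)"
    by (rule filterlim_compose[OF poly_times_exp_neg_tendsto_0])
      (simp add: filterlim_inverse_at_top_right flip: inverse_eq_divide)
  then have r: "((\<lambda>t. exp_flat P t) \<longlongrightarrow> 0) (at_right 0)"
    by (rule Lim_transform_eventually)
      (auto simp: exp_flat_def eventually_at_filter)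
  have "((\<lambda>t. exp_flat P t) \<longlongrightarrow> 0) (at_left 0)"
    by (rule Lim_transform_eventually[OF tendsto_const])
      (auto simp: exp_flat_def eventually_at_filter)
  with r show ?thesis by (simp add: filterlim_at_split)
qed

lemma exp_flat_has_derivative:
  "(exp_flat P has_field_derivative exp_flat ([:0,0,1:] * (P - pderiv P)) t) (at t)"
proof -
  consider "t > 0" | "t < 0" | "t = 0" by linarith
  then show ?thesis
  proof cases
    case 1
    have "((\<lambda>t. poly P (1 / t) * exp (- (1 / t))) has_field_derivative
        exp_flat ([:0,0,1:] * (P - pderiv P)) t) (at t)"
      using 1 by (auto intro!: derivative_eq_intros simp: exp_flat_def field_simps power2_eq_square)
    then show ?thesis
      by (rule has_field_derivative_transform_within_open[where S = "{0<..}"]) (use 1 in \<open>auto simp: exp_flat_def\<close>)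
  next
    case 2
    have "((\<lambda>t. 0) has_field_derivative exp_flat ([:0,0,1:] * (P - pderiv P)) t) (at t)"
      using 2 by (auto simp: exp_flat_def)
    then show ?thesis
      by (rule has_field_derivative_transform_within_open[where S = "{..<0}"]) (use 2 in \<open>auto simp: exp_flat_def\<close>)
  next
    case 3
    have "((\<lambda>h. exp_flat ([:0,1:] * P) h) \<longlongrightarrow> 0) (at 0)"
      by (rule exp_flat_tendsto_0)
    moreover have "(\<lambda>h. exp_flat ([:0,1:] * P) h) = (\<lambda>h. (exp_flat P (0 + h) - exp_flat P 0) / h)"
      by (auto simp: exp_flat_def fun_eq_iff)
    ultimately show ?thesis
      using 3 unfolding DERIV_def by (simp add: exp_flat_def)
  qed
qed

lemma smooth_exp_flat_affine:
  fixes L :: "'a::real_normed_vector \<Rightarrow> real"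
  assumes L: "bounded_linear L"
  shows "smooth (\<lambda>x. exp_flat P (L x + c))"
proof -
  have D: "((\<lambda>x. exp_flat P (L x + c)) has_derivative
      (\<lambda>v. exp_flat ([:0,0,1:] * (P - pderiv P)) (L x + c) * L v)) (at x)" for P x
  proof -
    have "((\<lambda>x. L x + c) has_derivative L) (at x)"
      using L by (auto intro!: derivative_eq_intros bounded_linear_imp_has_derivative)
    from has_derivative_compose[OF this exp_flat_has_derivative[unfolded has_field_derivative_def]]
    show ?thesis by simp
  qed
  have "times_cont_diff k (\<lambda>x. exp_flat P (L x + c))" for k
  proof (induction k arbitrary: P)
    case 0
    show ?case
      using D[of P] by (auto simp: continuous_on_eq_continuous_within
          intro!: has_derivative_continuous)
  next
    case (Suc k)
    have eq: "(\<lambda>x. frechet_derivative (\<lambda>x. exp_flat P (L x + c)) (at x) v) =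
       (\<lambda>x. exp_flat ([:0,0,1:] * (P - pderiv P)) (L x + c) * L v)" for v
      using frechet_derivative_at[OF D] by (metis)
    show ?case
      unfolding times_cont_diff.simps eq
    proof (intro conjI allI)
      show "(\<lambda>x. exp_flat P (L x + c)) differentiable (at x)" for x
        using D[of P x] by (rule differentiableI)
      show "times_cont_diff k (\<lambda>x. exp_flat ([:0,0,1:] * (P - pderiv P)) (L x + c) * L v)" for v
        by (rule times_cont_diff_mult[OF Suc.IH times_cont_diff_const])
    qed
  qed
  then show ?thesis by (simp add: smooth_def)
qed

lemma test_functions_add: "\<phi> \<in> test_functions \<Omega> \<Longrightarrow> \<psi> \<in> test_functions \<Omega> \<Longrightarrow> (\<lambda>x. \<phi> x + \<psi> x) \<in> test_functions \<Omega>"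
proof -
  assume A: "\<phi> \<in> test_functions \<Omega>" "\<psi> \<in> test_functions \<Omega>"
  have "{x. \<phi> x + \<psi> x \<noteq> 0} \<subseteq> closure {x. \<phi> x \<noteq> 0} \<union> closure {x. \<psi> x \<noteq> 0}"
    using subsetD[OF closure_subset[of "{x. \<phi> x \<noteq> 0}"]] subsetD[OF closure_subset[of "{x. \<psi> x \<noteq> 0}"]]
    by (smt (verit) UnCI mem_Collect_eq subsetI)
  then have s: "closure {x. \<phi> x + \<psi> x \<noteq> 0} \<subseteq> closure {x. \<phi> x \<noteq> 0} \<union> closure {x. \<psi> x \<noteq> 0}"
    by (rule closure_minimal) auto
  with A show ?thesis
    unfolding test_functions_def
    by (auto intro: smooth_add simp: compact_eq_bounded_closed intro: bounded_subset[OF _ s])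
qed

lemma test_functions_cmult: "\<phi> \<in> test_functions \<Omega> \<Longrightarrow> (\<lambda>x. r * \<phi> x) \<in> test_functions \<Omega>"
proof -
  assume A: "\<phi> \<in> test_functions \<Omega>"
  have s: "closure {x. r * \<phi> x \<noteq> 0} \<subseteq> closure {x. \<phi> x \<noteq> 0}"
    by (rule closure_mono) auto
  with A show ?thesis
    unfolding test_functions_def
    by (intro CollectI conjI smooth_mult smooth_const) (auto simp: compact_eq_bounded_closed intro: bounded_subset[OF _ s[simplified]])
qed

lemma test_functions_0: "(\<lambda>x. 0) \<in> test_functions \<Omega>"
  by (auto simp: test_functions_def smooth_const)

text \<open>For \<open>t > 0\<close> the values \<open>exp (- 1 / (j t))\<close> increase to \<open>1\<close>. A product of such factors over the
  \<open>2 n\<close> faces of a box is a bump function, and with growing \<open>j\<close> it fills the box.\<close>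

lemma test_functions_approximate_box:
  fixes \<Omega> :: "(real^'n) set"
  assumes "cbox a b \<subseteq> \<Omega>"
  obtains \<phi> where "\<And>j. \<phi> j \<in> test_functions \<Omega>" "\<And>j x. \<bar>\<phi> j x\<bar> \<le> 1"
    "\<And>x. (\<lambda>j. \<phi> j x) \<longlonglongrightarrow> indicator (box a b) x"
proof -
  define e where "e j t = exp_flat 1 (real (Suc j) * t)" for j t
  have e0: "e j t = 0 \<longleftrightarrow> t \<le> 0" for j t
    by (auto simp: e_def exp_flat_def zero_less_mult_iff not_less)
  have e01: "0 \<le> e j t" "e j t \<le> 1" for j t
    by (auto simp: e_def exp_flat_def)
  have elim: "(\<lambda>j. e j t) \<longlonglongrightarrow> (if t > 0 then 1 else 0)" for t
  proof (cases "t > 0")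
    case True
    have "(\<lambda>j. exp (- (1 / t) * inverse (real (Suc j)))) \<longlonglongrightarrow> exp (- (1 / t) * 0)"
      by (intro tendsto_intros LIMSEQ_inverse_real_of_nat)
    then show ?thesis
      using True by (simp add: e_def exp_flat_def zero_less_mult_iff divide_inverse mult.commute del: of_nat_Suc)
  qed (auto simp: e_def exp_flat_def zero_less_mult_iff)
  define \<phi> where "\<phi> j x = (\<Prod>i\<in>UNIV. e j (x $ i - a $ i) * e j (b $ i - x $ i))" for j and x :: "real^'n"
  have bl: "bounded_linear (\<lambda>x::real^'n. r * (x $ i))" for r i
    using bounded_linear_mult_right bounded_linear_vec_nth bounded_linear_compose by blast
  have sm: "smooth (\<phi> j)" for j
  proof -
    have "smooth (\<lambda>x::real^'n. e j (x $ i - a $ i))" for i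
      using smooth_exp_flat_affine[OF bl[of "real (Suc j)" i], of 1 "- real (Suc j) * a $ i"]
      by (simp add: e_def algebra_simps)
    moreover have "smooth (\<lambda>x::real^'n. e j (b $ i - x $ i))" for i
      using smooth_exp_flat_affine[OF bl[of "- real (Suc j)" i], of 1 "real (Suc j) * b $ i"]
      by (simp add: e_def algebra_simps)
    ultimately show ?thesis
      unfolding \<phi>_def by (intro smooth_prod smooth_mult) auto
  qed
  have supp: "{x. \<phi> j x \<noteq> 0} = box a b" for j
    by (auto simp: \<phi>_def e0 mem_box_cart not_le)
  have clos: "closure {x. \<phi> j x \<noteq> 0} \<subseteq> cbox a b" for j
    unfolding supp by (rule closure_minimal) (auto simp: box_subset_cbox closed_cbox)
  have "\<phi> j \<in> test_functions \<Omega>" for j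
    using sm clos[of j] assms
    by (auto simp: test_functions_def compact_eq_bounded_closed intro: bounded_subset[OF bounded_cbox[of a b]])
  moreover have "\<bar>\<phi> j x\<bar> \<le> 1" for j x
    unfolding \<phi>_def abs_prod
    by (intro prod_le_1) (auto simp: abs_mult e01 mult_le_one)
  moreover have "(\<lambda>j. \<phi> j x) \<longlonglongrightarrow> indicator (box a b) x" for x
  proof -
    have "(\<lambda>j. \<phi> j x) \<longlonglongrightarrow> (\<Prod>i\<in>UNIV. (if x $ i - a $ i > 0 then 1 else 0) * (if b $ i - x $ i > 0 then 1 else 0))"
      unfolding \<phi>_def by (intro tendsto_prod tendsto_mult elim)
    moreover have "(\<Prod>i\<in>UNIV. (if x $ i - a $ i > 0 then 1 else 0) * (if b $ i - x $ i > 0 then 1 else 0))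
        = (indicator (box a b) x :: real)"
    proof (cases "x \<in> box a b")
      case True
      then show ?thesis by (auto simp: mem_box_cart intro!: prod.neutral)
    next
      case False
      then obtain i where "\<not> (a $ i < x $ i \<and> x $ i < b $ i)" by (auto simp: mem_box_cart)
      then show ?thesis using False by (auto simp: prod_zero_iff)
    qed
    ultimately show ?thesis by simp
  qed
  ultimately show ?thesis using that by blast
qed

text \<open>The measures with densities \<open>max g 0\<close> and \<open>max (- g) 0\<close> agree on the boxes, which form an
  intersection-stable generator of the Borel sets, so the densities agree almost everywhere.\<close>

lemma AE_zero_if_box_integrals_zero:
  fixes g :: "'a::euclidean_space \<Rightarrow> real"
  assumes g: "integrable lborel g"
    and zero: "\<And>a b. (LINT x|lborel. indicator (box a b) x * g x) = 0"
  shows "AE x in lborel. g x = 0"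
proof -
  have [measurable]: "g \<in> borel_measurable borel" using g by auto
  define P where "P = density lborel (\<lambda>x. ennreal (g x))"
  define N where "N = density lborel (\<lambda>x. ennreal (- g x))"
  have ib: "integrable lborel (\<lambda>x. indicator (box a b) x * g x)" for a b
    using integrable_mult_indicator[OF _ g, of "box a b"] by simp
  have PN: "emeasure P (box a b) = emeasure N (box a b)" "emeasure P (box a b) \<noteq> \<infinity>" for a b
  proof -
    have p: "emeasure P (box a b) = (\<integral>\<^sup>+x. ennreal (indicator (box a b) x * g x) \<partial>lborel)"
      unfolding P_def by (subst emeasure_density) (auto intro!: nn_integral_cong simp: indicator_def)
    have n: "emeasure N (box a b) = (\<integral>\<^sup>+x. ennreal (- (indicator (box a b) x * g x)) \<partial>lborel)"
      unfolding N_def by (subst emeasure_density) (auto intro!: nn_integral_cong simp: indicator_def)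
    have fin: "emeasure P (box a b) \<noteq> \<infinity>" "emeasure N (box a b) \<noteq> \<infinity>"
      using ib[of a b] unfolding p n real_integrable_def by auto
    have "enn2real (emeasure P (box a b)) - enn2real (emeasure N (box a b)) = 0"
      using zero[of a b] unfolding real_lebesgue_integral_def[OF ib] p n .
    then show "emeasure P (box a b) = emeasure N (box a b)" "emeasure P (box a b) \<noteq> \<infinity>"
      using fin by (metis diff_eq_diff_eq diff_self ennreal_enn2real_if infinity_ennreal_def, auto)
  qed
  have "P = N"
  proof (rule measure_eqI_generator_eq)
    let ?E = "range (\<lambda>(a, b). box a b::'a set)"
    show "Int_stable ?E"
      by (auto simp: Int_stable_def box_Int_box)
    show "?E \<subseteq> Pow UNIV" "sets P = sigma_sets UNIV ?E" "sets N = sigma_sets UNIV ?E"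
      by (simp_all add: borel_eq_box P_def N_def)
    let ?A = "\<lambda>n::nat. box (- (real n *\<^sub>R One)) (real n *\<^sub>R One) :: 'a set"
    show "range ?A \<subseteq> ?E" "(\<Union>i. ?A i) = UNIV"
      unfolding UN_box_eq_UNIV by auto
    show "emeasure P (?A i) \<noteq> \<infinity>" for i using PN by simp
    show "emeasure P X = emeasure N X" if "X \<in> ?E" for X
      using that PN(1) by auto
  qed
  then have "AE x in lborel. ennreal (g x) = ennreal (- g x)"
    unfolding P_def N_def by (intro sigma_finite_measure.density_unique[OF sigma_finite_lborel]) auto
  then show ?thesis
  proof eventually_elim
    case (elim x)
    then show ?case by (cases "g x \<ge> 0") (auto simp: ennreal_neg ennreal_eq_0_iff)
  qed
qed

lemma borel_measurable_test_function:
  assumes "\<phi> \<in> test_functions \<Omega>"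
  shows "\<phi> \<in> borel_measurable borel"
proof -
  have "times_cont_diff 0 \<phi>" using assms by (auto simp: test_functions_def smooth_def)
  then show ?thesis by (simp add: borel_measurable_continuous_onI)
qed

text \<open>Bump functions that fill a box transfer the hypothesis to the integral of \<open>g\<close> over every box compactly
  inside \<open>\<Omega>\<close>, and countably many such boxes cover \<open>\<Omega>\<close>.\<close>

lemma fundamental_lemma_calculus_of_variations:
  fixes \<Omega> :: "(real^'n) set"
  assumes \<Omega>: "open \<Omega>" and g: "integrable (lebesgue_on \<Omega>) g"
    and zero: "\<And>\<phi>. \<phi> \<in> test_functions \<Omega> \<Longrightarrow> (LINT x|lebesgue_on \<Omega>. g x * \<phi> x) = 0"
  shows "AE x in lebesgue_on \<Omega>. g x = 0"
proof -
  have \<Omega>s: "\<Omega> \<in> sets lebesgue" using \<Omega> by auto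
  have gi: "integrable lebesgue (\<lambda>x. indicator \<Omega> x * g x)"
    using g \<Omega>s by (subst (asm) integrable_restrict_space) (auto simp: set_integrable_def)
  then obtain g' where g': "g' \<in> borel_measurable lborel"
      "AE x in lborel. indicator \<Omega> x * g x = g' x"
    using completion_ex_borel_measurable_real[OF borel_measurable_integrable[OF gi]] by blast
  have g'm [measurable]: "g' \<in> borel_measurable borel" using g' by simp
  have AEl: "AE x in lebesgue. indicator \<Omega> x * g x = g' x"
    using g'(2) by (rule AE_completion)
  have g'i: "integrable lborel g'"
  proof -
    have "integrable lebesgue g'"
      by (rule integrable_cong_AE_imp[OF gi]) (use AEl g'm in \<open>auto intro: measurable_completion\<close>)
    then show ?thesis by (simp add: integrable_completion)
  qed
  have box0: "(LINT x|lborel. indicator (box a b) x * g' x) = 0" if sub: "cbox a b \<subseteq> \<Omega>" for a b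
  proof -
    obtain \<phi> where \<phi>: "\<And>j. \<phi> j \<in> test_functions \<Omega>" "\<And>j x. \<bar>\<phi> j x\<bar> \<le> 1"
      "\<And>x. (\<lambda>j. \<phi> j x) \<longlonglongrightarrow> indicator (box a b) x"
      using test_functions_approximate_box[OF sub] by blast
    have [measurable]: "\<phi> j \<in> borel_measurable borel" for j
      using \<phi>(1) borel_measurable_test_function by blast
    have z: "(LINT x|lborel. \<phi> j x * g' x) = 0" for j
    proof -
      have "(LINT x|lborel. \<phi> j x * g' x) = (LINT x|lebesgue. \<phi> j x * g' x)"
        by (subst integral_completion) auto
      also have "\<dots> = (LINT x|lebesgue. indicator \<Omega> x *\<^sub>R (g x * \<phi> j x))"
      proof (rule integral_cong_AE)
        show "AE x in lebesgue. \<phi> j x * g' x = indicator \<Omega> x *\<^sub>R (g x * \<phi> j x)"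
          using AEl by eventually_elim (auto simp: algebra_simps)
        show "(\<lambda>x. \<phi> j x * g' x) \<in> borel_measurable lebesgue"
          by (rule measurable_completion) measurable
        have "\<phi> j \<in> borel_measurable lebesgue"
          by (rule measurable_completion) measurable
        from borel_measurable_times[OF this borel_measurable_integrable[OF gi]]
        show "(\<lambda>x. indicator \<Omega> x *\<^sub>R (g x * \<phi> j x)) \<in> borel_measurable lebesgue"
          by (simp add: algebra_simps)
      qed
      also have "\<dots> = (LINT x|lebesgue_on \<Omega>. g x * \<phi> j x)"
        using \<Omega>s by (subst integral_restrict_space) auto
      finally show ?thesis using zero[OF \<phi>(1)] by simp
    qed
    have "(\<lambda>j. LINT x|lborel. \<phi> j x * g' x) \<longlonglongrightarrow> (LINT x|lborel. indicator (box a b) x * g' x)"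
    proof (rule integral_dominated_convergence[where w = "\<lambda>x. \<bar>g' x\<bar>"])
      show "AE x in lborel. norm (\<phi> j x * g' x) \<le> \<bar>g' x\<bar>" for j
        using mult_right_mono[OF \<phi>(2)[of j]] by (auto simp: abs_mult)
    qed (use g'i in \<open>auto intro!: tendsto_mult \<phi>(3)\<close>)
    then show ?thesis by (simp add: z LIMSEQ_const_iff)
  qed
  have AEbox: "AE x in lborel. x \<in> box c d \<longrightarrow> g' x = 0" if cd: "cbox c d \<subseteq> \<Omega>" for c d
  proof -
    have "AE x in lborel. indicator (box c d) x * g' x = 0"
    proof (rule AE_zero_if_box_integrals_zero)
      show "integrable lborel (\<lambda>x. indicator (box c d) x * g' x)"
        using integrable_mult_indicator[OF _ g'i, of "box c d"] by simp
      fix a b :: "real^'n"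
      obtain a' b' where ab: "box a b \<inter> box c d = box a' b'" using that box_Int_box by blast
      have "(LINT x|lborel. indicator (box a' b') x * g' x) = 0"
      proof (cases "box a' b' = {}")
        case False
        have "cbox a' b' = closure (box a' b')" using False by (simp add: closure_box)
        also have "\<dots> \<subseteq> cbox c d" unfolding ab[symmetric]
          by (rule closure_minimal) (use box_subset_cbox in \<open>auto simp: closed_cbox\<close>)
        finally show ?thesis using box0 cd by blast
      qed simp
      then show "(LINT x|lborel. indicator (box a b) x * (indicator (box c d) x * g' x)) = 0"
        unfolding ab[symmetric] by (simp add: indicator_inter_arith mult.assoc)
    qed
    then show ?thesis by eventually_elim auto
  qed
  define F where "F = {box c d | c d :: real^'n. cbox c d \<subseteq> \<Omega>}"
  \<comment> \<open>null sets only add up over a countable subfamily\<close>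
  obtain F' where F': "F' \<subseteq> F" "countable F'" "\<Union>F' = \<Union>F"
    using Lindelof[of F] by (auto simp: F_def open_box)
  have cover: "\<Omega> \<subseteq> \<Union>F"
  proof
    fix x assume "x \<in> \<Omega>"
    then obtain c d where "cbox c d \<subseteq> \<Omega>" "x \<in> box c d"
      using \<Omega> open_contains_cbox by metis
    then show "x \<in> \<Union>F" unfolding F_def by blast
  qed
  have "AE x in lborel. \<forall>B\<in>F'. x \<in> B \<longrightarrow> g' x = 0"
    using F'(1,2) AEbox by (subst AE_ball_countable) (auto simp: F_def)
  then have "AE x in lebesgue. \<forall>B\<in>F'. x \<in> B \<longrightarrow> g' x = 0" by (rule AE_completion)
  with AEl have "AE x in lebesgue. x \<in> \<Omega> \<longrightarrow> g x = 0"
    by eventually_elim (use cover F'(3) in fastforce)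
  then show ?thesis using \<Omega>s by (subst AE_restrict_space_iff) auto
qed

section \<open>Subsequences of mean-convergent sequences\<close>

lemma filterlim_inverse_Suc_at_0: "filterlim (\<lambda>n. inverse (real (Suc n))) (at 0) sequentially"
  using LIMSEQ_inverse_real_of_nat
  by (auto simp: filterlim_at intro!: always_eventually)

lemma fast_subsequence:
  fixes c :: "nat \<Rightarrow> nat \<Rightarrow> real"
  assumes "\<And>\<epsilon>. \<epsilon> > 0 \<Longrightarrow> \<exists>N. \<forall>m\<ge>N. \<forall>n\<ge>N. c m n < \<epsilon>" and pos: "\<And>k. \<epsilon> k > 0"
  obtains r :: "nat \<Rightarrow> nat" where "strict_mono r" "\<And>k m n. m \<ge> r k \<Longrightarrow> n \<ge> r k \<Longrightarrow> c m n < \<epsilon> k"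
proof -
  obtain N where N: "\<And>k m n. m \<ge> N k \<Longrightarrow> n \<ge> N k \<Longrightarrow> c m n < \<epsilon> k"
  proof -
    have "\<forall>k. \<exists>N. \<forall>m\<ge>N. \<forall>n\<ge>N. c m n < \<epsilon> k" using assms by blast
    then obtain N where "\<forall>k. \<forall>m\<ge>N k. \<forall>n\<ge>N k. c m n < \<epsilon> k" by (rule choice[THEN exE])
    then show ?thesis using that by blast
  qed
  define r where "r k = (\<Sum>i\<le>k. Suc (N i))" for k
  have "strict_mono r" by (auto simp: strict_mono_Suc_iff r_def)
  moreover have "r k \<ge> N k" for k
    unfolding r_def by (induction k) auto
  ultimately show ?thesis using that N by (meson order_trans)
qed

text \<open>The sum of the \<open>d k\<close> has a finite integral by monotone convergence, hence is finite almost
  everywhere, and serves as the majorant of each of them.\<close>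

lemma summable_integrals_AE:
  fixes d :: "nat \<Rightarrow> 'x \<Rightarrow> real"
  assumes i: "\<And>k. integrable M (d k)" and nn: "\<And>k x. 0 \<le> d k x" and le: "\<And>k. (LINT x|M. d k x) \<le> (1/2) ^ k"
  obtains S where "integrable M S" "AE x in M. summable (\<lambda>k. d k x) \<and> (\<forall>k. d k x \<le> S x)"
proof -
  have [measurable]: "d k \<in> borel_measurable M" for k using i by auto
  define T where "T x = (\<Sum>k. ennreal (d k x))" for x
  have [measurable]: "T \<in> borel_measurable M" unfolding T_def by measurable
  have "(\<integral>\<^sup>+x. T x \<partial>M) = (\<Sum>k. \<integral>\<^sup>+x. ennreal (d k x) \<partial>M)"
    unfolding T_def by (rule nn_integral_suminf) measurable
  also have "\<dots> = (\<Sum>k. ennreal (LINT x|M. d k x))"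
    using i nn by (simp add: nn_integral_eq_integral)
  also have "\<dots> \<le> (\<Sum>k. ennreal ((1/2) ^ k))"
    using le by (intro suminf_le ennreal_leI) auto
  also have "\<dots> = ennreal (\<Sum>k. (1/2) ^ k)" by (rule suminf_ennreal2) (auto simp: summable_geometric)
  finally have fin: "(\<integral>\<^sup>+x. T x \<partial>M) \<noteq> \<infinity>" by (auto simp: top_unique)
  then have ae: "AE x in M. T x \<noteq> \<infinity>" by (intro nn_integral_noteq_infinite) auto
  define S where "S x = enn2real (T x)" for x
  have [measurable]: "S \<in> borel_measurable M" unfolding S_def[abs_def] by measurable
  have "integrable M S"
  proof (rule integrableI_nn_integral_finite[where x = "enn2real (\<integral>\<^sup>+x. T x \<partial>M)"])
    have "(\<integral>\<^sup>+x. ennreal (S x) \<partial>M) = (\<integral>\<^sup>+x. T x \<partial>M)"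
      by (rule nn_integral_cong_AE) (use ae in \<open>eventually_elim, auto simp: S_def less_top\<close>)
    then show "(\<integral>\<^sup>+x. ennreal (S x) \<partial>M) = ennreal (enn2real (\<integral>\<^sup>+x. T x \<partial>M))" using fin by (simp add: less_top)
  qed (auto simp: S_def)
  moreover have "AE x in M. summable (\<lambda>k. d k x) \<and> (\<forall>k. d k x \<le> S x)"
    using ae
  proof eventually_elim
    case (elim x)
    then have s: "summable (\<lambda>k. d k x)" unfolding T_def using nn by (intro summable_suminf_not_top) auto
    then have "S x = (\<Sum>k. d k x)" unfolding S_def T_def using nn
      by (subst suminf_ennreal2) (auto simp: suminf_nonneg)
    moreover have "d k x \<le> (\<Sum>k. d k x)" for k
      using sum_le_suminf[OF s, of "{k}"] nn by auto
    ultimately show ?case using s by simp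
  qed
  ultimately show ?thesis using that by blast
qed

lemma L1_null_dominated_subsequence:
  fixes d :: "nat \<Rightarrow> 'x \<Rightarrow> real"
  assumes i: "\<And>k. integrable M (d k)" and nn: "\<And>k x. 0 \<le> d k x" and lim: "(\<lambda>k. LINT x|M. d k x) \<longlonglongrightarrow> 0"
  obtains r S where "strict_mono (r :: nat \<Rightarrow> nat)" "integrable M S"
    "AE x in M. (\<lambda>k. d (r k) x) \<longlonglongrightarrow> 0" "AE x in M. \<forall>k. d (r k) x \<le> S x"
proof -
  have "\<exists>N. \<forall>m\<ge>N. \<forall>n\<ge>N. (LINT x|M. d m x) < \<epsilon>" if "\<epsilon> > 0" for \<epsilon>
    using order_tendstoD(2)[OF lim that] by (auto simp: eventually_sequentially)
  then obtain r :: "nat \<Rightarrow> nat" where r: "strict_mono r" "\<And>k m n. m \<ge> r k \<Longrightarrow> n \<ge> r k \<Longrightarrow> (LINT x|M. d m x) < (1/2) ^ k"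
    using fast_subsequence[of "\<lambda>m n. LINT x|M. d m x" "\<lambda>k. (1/2) ^ k"] by auto
  have le: "(LINT x|M. d (r k) x) \<le> (1/2) ^ k" for k using r(2)[of k "r k" "r k"] by simp
  obtain S where "integrable M S" and S: "AE x in M. summable (\<lambda>k. d (r k) x) \<and> (\<forall>k. d (r k) x \<le> S x)"
    using summable_integrals_AE[of M "\<lambda>k. d (r k)", OF i nn le] by blast
  moreover have "AE x in M. (\<lambda>k. d (r k) x) \<longlonglongrightarrow> 0" using S by eventually_elim (auto intro: summable_LIMSEQ_zero)
  moreover have "AE x in M. \<forall>k. d (r k) x \<le> S x" using S by eventually_elim auto
  ultimately show ?thesis using that r(1) by blast
qed

text \<open>In the applications \<open>d k\<close> is a power of the distance of a fixed function to the \<open>k\<close>-th member of a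
  sequence, so that a bound on mutual distances is passed on to the distance from the limit.\<close>

lemma Fatou_mean_limit:
  fixes d :: "nat \<Rightarrow> 'x \<Rightarrow> real"
  assumes [measurable]: "\<And>k. d k \<in> borel_measurable M" "D \<in> borel_measurable M"
    and nn: "\<And>k x. 0 \<le> d k x" "\<And>x. 0 \<le> D x" and lim: "AE x in M. (\<lambda>k. d k x) \<longlonglongrightarrow> D x"
    and i: "\<And>k. integrable M (d k)" and le: "\<forall>\<^sub>F k in sequentially. (LINT x|M. d k x) \<le> B"
  shows "integrable M D" "(LINT x|M. D x) \<le> B"
proof -
  have B: "B \<ge> 0"
  proof -
    obtain k where "(LINT x|M. d k x) \<le> B" using le by (auto simp: eventually_sequentially)
    moreover have "0 \<le> (LINT x|M. d k x)" using nn by simp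
    ultimately show ?thesis by linarith
  qed
  have "(\<integral>\<^sup>+x. ennreal (D x) \<partial>M) = (\<integral>\<^sup>+x. liminf (\<lambda>k. ennreal (d k x)) \<partial>M)"
  proof (rule nn_integral_cong_AE)
    show "AE x in M. ennreal (D x) = liminf (\<lambda>k. ennreal (d k x))"
      using lim
    proof eventually_elim
      case (elim x)
      then have "(\<lambda>k. ennreal (d k x)) \<longlonglongrightarrow> ennreal (D x)" by (rule tendsto_ennrealI)
      then show ?case by (simp add: lim_imp_Liminf)
    qed
  qed
  also have "\<dots> \<le> liminf (\<lambda>k. \<integral>\<^sup>+x. ennreal (d k x) \<partial>M)" by (rule nn_integral_liminf) measurable
  also have "\<dots> \<le> liminf (\<lambda>k. ennreal B)"
  proof (rule Liminf_mono)
    show "\<forall>\<^sub>F k in sequentially. (\<integral>\<^sup>+x. ennreal (d k x) \<partial>M) \<le> ennreal B"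
      using le by eventually_elim (simp add: nn_integral_eq_integral i nn ennreal_leI)
  qed
  also have "\<dots> = ennreal B" by (simp add: Liminf_const)
  finally have f: "(\<integral>\<^sup>+x. ennreal (D x) \<partial>M) \<le> ennreal B" .
  show iD: "integrable M D"
  proof (rule integrableI_bounded)
    have "(\<integral>\<^sup>+x. ennreal (norm (D x)) \<partial>M) = (\<integral>\<^sup>+x. ennreal (D x) \<partial>M)" using nn by simp
    then show "(\<integral>\<^sup>+x. ennreal (norm (D x)) \<partial>M) < \<infinity>" using f by (simp add: le_less_trans)
  qed simp
  show "(LINT x|M. D x) \<le> B"
    using f B nn by (simp add: nn_integral_eq_integral[OF iD])
qed

lemma norm_diff_square_le:
  fixes x y :: "'b::real_normed_vector"
  shows "(norm (x - y))\<^sup>2 \<le> 2 * (norm (x - z))\<^sup>2 + 2 * (norm (y - z))\<^sup>2"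
proof -
  have "norm (x - y) \<le> norm (x - z) + norm (y - z)" using norm_triangle_ineq4[of "x - z" "y - z"] by simp
  then have "(norm (x - y))\<^sup>2 \<le> (norm (x - z) + norm (y - z))\<^sup>2" by (intro power_mono) auto
  then show ?thesis
    using zero_le_power2[of "norm (x - z) - norm (y - z)"] by (simp add: power2_eq_square algebra_simps)
qed

lemma norm_square_le:
  fixes x y :: "'b::real_normed_vector"
  shows "(norm x)\<^sup>2 \<le> 2 * (norm (x - y))\<^sup>2 + 2 * (norm y)\<^sup>2"
  using norm_diff_square_le[of x 0 y] by simp

lemma integrable_norm_square_diff:
  fixes u v :: "'x \<Rightarrow> 'b::{banach, second_countable_topology}"
  assumes [measurable]: "u \<in> borel_measurable M" "v \<in> borel_measurable M"
    and "integrable M (\<lambda>x. (norm (u x))\<^sup>2)" "integrable M (\<lambda>x. (norm (v x))\<^sup>2)"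
  shows "integrable M (\<lambda>x. (norm (u x - v x))\<^sup>2)"
proof (rule Bochner_Integration.integrable_bound)
  show "integrable M (\<lambda>x. 2 * (norm (u x))\<^sup>2 + 2 * (norm (v x))\<^sup>2)" using assms by simp
  show "AE x in M. norm ((norm (u x - v x))\<^sup>2) \<le> norm (2 * (norm (u x))\<^sup>2 + 2 * (norm (v x))\<^sup>2)"
    using norm_diff_square_le[of "u _" "v _" 0] by (intro AE_I2) simp
qed measurable

text \<open>Riesz-Fischer. Along a subsequence whose increments have squared norms below \<open>4^-k\<close>, the
  functions \<open>2^k\<close> times the squared increment are summable almost everywhere, and then so are the
  increments. Fatou's lemma identifies the pointwise limit as the limit in mean square.\<close>

lemma L2_complete:
  fixes w :: "nat \<Rightarrow> 'x \<Rightarrow> 'b::{banach, second_countable_topology}"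
  assumes w [measurable]: "\<And>k. w k \<in> borel_measurable M" and i: "\<And>k. integrable M (\<lambda>x. (norm (w k x))\<^sup>2)"
    and C: "\<And>\<epsilon>. \<epsilon> > 0 \<Longrightarrow> \<exists>N. \<forall>m\<ge>N. \<forall>n\<ge>N. (LINT x|M. (norm (w m x - w n x))\<^sup>2) < \<epsilon>"
  obtains u where "u \<in> borel_measurable M" "integrable M (\<lambda>x. (norm (u x))\<^sup>2)"
    "(\<lambda>k. LINT x|M. (norm (w k x - u x))\<^sup>2) \<longlonglongrightarrow> 0"
proof -
  obtain r :: "nat \<Rightarrow> nat" where r: "strict_mono r"
    "\<And>k m n. m \<ge> r k \<Longrightarrow> n \<ge> r k \<Longrightarrow> (LINT x|M. (norm (w m x - w n x))\<^sup>2) < (1/4) ^ k"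
    using fast_subsequence[of "\<lambda>m n. LINT x|M. (norm (w m x - w n x))\<^sup>2" "\<lambda>k. (1/4) ^ k", OF C] by auto
  have iw: "integrable M (\<lambda>x. (norm (w m x - w n x))\<^sup>2)" for m n
    by (intro integrable_norm_square_diff w i)
  define d where "d k x = 2 ^ k * (norm (w (r (Suc k)) x - w (r k) x))\<^sup>2" for k x
  have rs: "r k \<le> r (Suc k)" for k using r(1) by (simp add: strict_mono_leD)
  have dle: "(LINT x|M. d k x) \<le> (1/2) ^ k" for k
  proof -
    have "(LINT x|M. d k x) \<le> 2 ^ k * (1/4) ^ k"
      unfolding d_def using r(2)[of k "r (Suc k)" "r k"] rs[of k] by simp
    then show ?thesis by (simp add: power_mult_distrib[symmetric])
  qed
  have "integrable M (d k)" "0 \<le> d k x" for k x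
    using iw unfolding d_def by auto
  then obtain S where S: "AE x in M. summable (\<lambda>k. d k x) \<and> (\<forall>k. d k x \<le> S x)"
    using summable_integrals_AE[of M d, OF _ _ dle] by blast
  have conv: "AE x in M. convergent (\<lambda>k. w (r k) x)"
    using S
  proof eventually_elim
    case (elim x)
    have "summable (\<lambda>k. (1/2) ^ k + d k x)" using elim by (intro summable_add) (auto simp: summable_geometric)
    then have "summable (\<lambda>k. norm (w (r (Suc k)) x - w (r k) x))"
    proof (rule summable_comparison_test')
      fix k
      let ?t = "norm (w (r (Suc k)) x - w (r k) x)"
      \<comment> \<open>Young's inequality \<open>2 t \<le> 2^-k + 2^k t^2\<close>\<close>
      have "0 \<le> ((1/2) ^ k) * (2 ^ k * ?t - 1)\<^sup>2" by simp
      also have "\<dots> = (1/2) ^ k * (2 ^ k * 2 ^ k) * ?t\<^sup>2 - 2 * ((1/2) ^ k * 2 ^ k) * ?t + (1/2) ^ k"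
        by (simp add: power2_eq_square algebra_simps)
      also have "\<dots> = d k x - 2 * ?t + (1/2) ^ k"
        by (simp add: d_def power_mult_distrib[symmetric] mult.assoc[symmetric])
      finally have "2 * ?t \<le> (1/2) ^ k + d k x" by simp
      moreover have "0 \<le> ?t" by simp
      ultimately have "?t \<le> (1/2) ^ k + d k x" by linarith
      then show "norm ?t \<le> (1/2) ^ k + d k x" by simp
    qed
    then have "summable (\<lambda>k. w (r (Suc k)) x - w (r k) x)" by (rule summable_norm_cancel)
    then have "convergent (\<lambda>n. \<Sum>k<n. w (r (Suc k)) x - w (r k) x)" by (simp add: summable_iff_convergent)
    then have "convergent (\<lambda>n. w (r n) x - w (r 0) x)"
      by (simp only: sum_lessThan_telescope[of "\<lambda>k. w (r k) x"])
    then have "convergent (\<lambda>n. w (r 0) x + (w (r n) x - w (r 0) x))" by (intro convergent_add convergent_const)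
    then show ?case by simp
  qed
  define u where "u x = lim (\<lambda>k. w (r k) x)" for x
  have um [measurable]: "u \<in> borel_measurable M" unfolding u_def by measurable
  have ulim: "AE x in M. (\<lambda>k. w (r k) x) \<longlonglongrightarrow> u x"
    using conv by eventually_elim (auto simp: u_def convergent_LIMSEQ_iff)
  have fat: "integrable M (\<lambda>x. (norm (w m x - u x))\<^sup>2)" "(LINT x|M. (norm (w m x - u x))\<^sup>2) \<le> (1/4) ^ k"
    if "m \<ge> r k" for m k
  proof -
    have "\<forall>\<^sub>F j in sequentially. (LINT x|M. (norm (w m x - w (r j) x))\<^sup>2) \<le> (1/4) ^ k"
    proof (rule eventually_sequentiallyI[of k])
      fix j assume "k \<le> j"
      then have "r k \<le> r j" using r(1) by (simp add: strict_mono_leD)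
      then show "(LINT x|M. (norm (w m x - w (r j) x))\<^sup>2) \<le> (1/4) ^ k" using r(2)[OF that, of "r j"] by simp
    qed
    moreover have "AE x in M. (\<lambda>j. (norm (w m x - w (r j) x))\<^sup>2) \<longlonglongrightarrow> (norm (w m x - u x))\<^sup>2"
      using ulim by eventually_elim (auto intro!: tendsto_intros)
    ultimately show "integrable M (\<lambda>x. (norm (w m x - u x))\<^sup>2)" "(LINT x|M. (norm (w m x - u x))\<^sup>2) \<le> (1/4) ^ k"
      using Fatou_mean_limit[of "\<lambda>j x. (norm (w m x - w (r j) x))\<^sup>2" M "\<lambda>x. (norm (w m x - u x))\<^sup>2" "(1/4) ^ k"] iw
      by auto
  qed
  have "integrable M (\<lambda>x. (norm (u x))\<^sup>2)"
  proof (rule Bochner_Integration.integrable_bound)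
    show "integrable M (\<lambda>x. 2 * (norm (w (r 0) x - u x))\<^sup>2 + 2 * (norm (w (r 0) x))\<^sup>2)"
      using fat(1)[of 0 "r 0"] i[of "r 0"] by simp
    show "AE x in M. norm ((norm (u x))\<^sup>2) \<le> norm (2 * (norm (w (r 0) x - u x))\<^sup>2 + 2 * (norm (w (r 0) x))\<^sup>2)"
      using norm_square_le[of "u _" "w (r 0) _"] by (intro AE_I2) (simp add: norm_minus_commute)
  qed measurable
  moreover have "(\<lambda>k. LINT x|M. (norm (w k x - u x))\<^sup>2) \<longlonglongrightarrow> 0"
  proof (rule LIMSEQ_I)
    fix \<epsilon> :: real assume "\<epsilon> > 0"
    then obtain k where k: "(1/4) ^ k < \<epsilon>" using real_arch_pow_inv[of \<epsilon> "1/4"] by auto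
    show "\<exists>N. \<forall>n\<ge>N. norm ((LINT x|M. (norm (w n x - u x))\<^sup>2) - 0) < \<epsilon>"
      using fat(2)[of k] k by (intro exI[of _ "r k"]) (auto intro: le_less_trans)
  qed
  ultimately show ?thesis using that um by blast
qed

section \<open>Square-integrable functions\<close>

lemma integral_Cauchy_Schwarz:
  fixes f g :: "'a \<Rightarrow> real"
  assumes [measurable]: "f \<in> borel_measurable M" "g \<in> borel_measurable M"
    and f: "integrable M (\<lambda>x. (f x)\<^sup>2)" and g: "integrable M (\<lambda>x. (g x)\<^sup>2)"
  shows "integrable M (\<lambda>x. f x * g x)"
    and "(LINT x|M. f x * g x)\<^sup>2 \<le> (LINT x|M. (f x)\<^sup>2) * (LINT x|M. (g x)\<^sup>2)"
proof -
  show fg: "integrable M (\<lambda>x. f x * g x)"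
  proof (rule Bochner_Integration.integrable_bound[OF Bochner_Integration.integrable_add[OF f g]])
    show "AE x in M. norm (f x * g x) \<le> norm ((f x)\<^sup>2 + (g x)\<^sup>2)"
    proof (rule AE_I2)
      fix x
      have "0 \<le> (\<bar>f x\<bar> - \<bar>g x\<bar>)\<^sup>2 + (f x)\<^sup>2 + (g x)\<^sup>2" by simp
      then show "norm (f x * g x) \<le> norm ((f x)\<^sup>2 + (g x)\<^sup>2)"
        by (simp add: power2_eq_square algebra_simps abs_mult)
    qed
  qed simp
  define A B C where "A = (LINT x|M. (f x)\<^sup>2)" and "B = (LINT x|M. f x * g x)" and "C = (LINT x|M. (g x)\<^sup>2)"
  have q: "0 \<le> A - 2 * t * B + t\<^sup>2 * C" for t
  proof -
    have "0 \<le> (LINT x|M. (f x - t * g x)\<^sup>2)" by simp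
    also have "\<dots> = (LINT x|M. (f x)\<^sup>2 - 2 * t * (f x * g x) + t\<^sup>2 * (g x)\<^sup>2)"
      by (simp add: power2_eq_square algebra_simps)
    also have "\<dots> = A - 2 * t * B + t\<^sup>2 * C"
      unfolding A_def B_def C_def using f g fg by simp
    finally show ?thesis .
  qed
  have "B\<^sup>2 \<le> A * C"
  proof (cases "C = 0")
    case True
    have "B = 0"
    proof (rule ccontr)
      assume "B \<noteq> 0"
      then show False using q[of "(A + 1) / (2 * B)"] True by simp
    qed
    then show ?thesis using True by simp
  next
    case False
    then have C: "C > 0" unfolding C_def by (simp add: less_le)
    have "0 \<le> C * (A - 2 * (B / C) * B + (B / C)\<^sup>2 * C)"
      using q[of "B / C"] C by simp
    also have "\<dots> = A * C - B\<^sup>2"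
      using C by (simp add: power2_eq_square field_simps)
    finally show ?thesis by simp
  qed
  then show "(LINT x|M. f x * g x)\<^sup>2 \<le> (LINT x|M. (f x)\<^sup>2) * (LINT x|M. (g x)\<^sup>2)"
    unfolding A_def B_def C_def .
qed

lemma abs_inner_le_sum_squares:
  fixes p q :: "'b::real_inner"
  shows "\<bar>p \<bullet> q\<bar> \<le> (norm p)\<^sup>2 + (norm q)\<^sup>2"
proof -
  have "\<bar>p \<bullet> q\<bar> \<le> norm p * norm q" by (rule Cauchy_Schwarz_ineq2)
  moreover have "2 * norm p * norm q \<le> (norm p)\<^sup>2 + (norm q)\<^sup>2" by (rule sum_squares_bound)
  moreover have "0 \<le> norm p * norm q" by simp
  ultimately show ?thesis by linarith
qed

lemma integrable_inner_L2:
  fixes p q :: "'x \<Rightarrow> 'b::euclidean_space"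
  assumes [measurable]: "p \<in> borel_measurable M" "q \<in> borel_measurable M"
    and "integrable M (\<lambda>x. (norm (p x))\<^sup>2)" "integrable M (\<lambda>x. (norm (q x))\<^sup>2)"
  shows "integrable M (\<lambda>x. p x \<bullet> q x)"
  by (rule Bochner_Integration.integrable_bound[OF Bochner_Integration.integrable_add[OF assms(3,4)]])
    (use abs_inner_le_sum_squares in \<open>auto intro!: AE_I2\<close>)

section \<open>Compactly supported continuously differentiable functions\<close>

text \<open>The gradient is an argument, so that sums, multiples and products come with their gradients, and
  the theory applies to any Euclidean space.\<close>
definition compact_C1 :: "('a::euclidean_space \<Rightarrow> real) \<Rightarrow> ('a \<Rightarrow> 'a) \<Rightarrow> bool" where
  "compact_C1 \<phi> g \<longleftrightarrow> (\<forall>x. (\<phi> has_derivative (\<lambda>h. g x \<bullet> h)) (at x)) \<and> continuous_on UNIV g \<and>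
     (\<exists>r. \<forall>x. norm x > r \<longrightarrow> \<phi> x = 0)"

lemma compact_C1_continuous: "compact_C1 \<phi> g \<Longrightarrow> continuous_on UNIV \<phi>"
  by (auto simp: compact_C1_def continuous_on_eq_continuous_within intro!: has_derivative_continuous)

lemma compact_C1_borel: "compact_C1 \<phi> g \<Longrightarrow> \<phi> \<in> borel_measurable borel"
  "compact_C1 \<phi> g \<Longrightarrow> g \<in> borel_measurable borel"
  using compact_C1_continuous[of \<phi> g]
  by (auto intro!: borel_measurable_continuous_onI simp: compact_C1_def)

lemma compact_C1_gradient_zero_on_open:
  assumes c: "compact_C1 \<phi> g" and S: "open S" "x \<in> S" "\<And>y. y \<in> S \<Longrightarrow> \<phi> y = 0"
  shows "g x = 0"
proof -
  have d: "(\<phi> has_derivative (\<lambda>h. g x \<bullet> h)) (at x)" using c by (auto simp: compact_C1_def)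
  have "((\<lambda>x. 0) has_derivative (\<lambda>h. g x \<bullet> h)) (at x)"
    by (rule has_derivative_transform_within_open[OF d S(1,2)]) (use S(3) in auto)
  then have "(\<lambda>h. g x \<bullet> h) = (\<lambda>h. 0)"
    using has_derivative_unique has_derivative_const by blast
  then have "g x \<bullet> g x = 0" by meson
  then show ?thesis by simp
qed

lemma compact_C1_gradient_zero:
  assumes "compact_C1 \<phi> g" "\<And>x. norm x > r \<Longrightarrow> \<phi> x = 0" "norm x > r"
  shows "g x = 0"
proof (rule compact_C1_gradient_zero_on_open[OF assms(1)])
  show "open {x::'a. norm x > r}" by (intro open_Collect_less continuous_intros)
qed (use assms in auto)

lemma compact_C1_bounded:
  assumes c: "compact_C1 \<phi> g"
  obtains B where "B > 0" "\<And>x. \<bar>\<phi> x\<bar> \<le> B" "\<And>x. norm (g x) \<le> B"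
proof -
  obtain r where r: "\<And>x. norm x > r \<Longrightarrow> \<phi> x = 0" using c by (auto simp: compact_C1_def)
  have "continuous_on (cball 0 r) \<phi>" "continuous_on (cball 0 r) g"
    using compact_C1_continuous[OF c] c by (auto simp: compact_C1_def intro: continuous_on_subset)
  then have "bounded (\<phi> ` cball 0 r)" "bounded (g ` cball 0 r)"
    by (auto intro!: compact_imp_bounded compact_continuous_image)
  then obtain B1 B2 where B: "\<And>x. x \<in> cball 0 r \<Longrightarrow> norm (\<phi> x) \<le> B1" "\<And>x. x \<in> cball 0 r \<Longrightarrow> norm (g x) \<le> B2"
    unfolding bounded_iff by (metis imageI)
  have "\<bar>\<phi> x\<bar> \<le> \<bar>B1\<bar> + \<bar>B2\<bar> + 1 \<and> norm (g x) \<le> \<bar>B1\<bar> + \<bar>B2\<bar> + 1" for x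
  proof (cases "norm x > r")
    case True
    then show ?thesis using r compact_C1_gradient_zero[OF c r True] by auto
  next
    case False
    then show ?thesis using B[of x] by auto
  qed
  then show ?thesis using that[of "\<bar>B1\<bar> + \<bar>B2\<bar> + 1"] by auto
qed

lemma compact_C1_line_derivative:
  assumes "compact_C1 \<phi> g"
  shows "((\<lambda>s. \<phi> (x + s *\<^sub>R e)) has_real_derivative (g (x + t *\<^sub>R e) \<bullet> e)) (at t)"
proof -
  have "((\<lambda>s. x + s *\<^sub>R e) has_derivative (\<lambda>s. s *\<^sub>R e)) (at t)"
    by (auto intro!: derivative_eq_intros)
  moreover have "(\<phi> has_derivative (\<lambda>h. g (x + t *\<^sub>R e) \<bullet> h)) (at (x + t *\<^sub>R e))"
    using assms by (simp add: compact_C1_def)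
  ultimately have "((\<lambda>s. \<phi> (x + s *\<^sub>R e)) has_derivative (\<lambda>s. g (x + t *\<^sub>R e) \<bullet> (s *\<^sub>R e))) (at t)"
    by (rule has_derivative_compose)
  then show ?thesis unfolding has_field_derivative_def by (simp add: mult_commute_abs)
qed

lemma compact_C1_add:
  assumes "compact_C1 \<phi> g" "compact_C1 \<psi> k"
  shows "compact_C1 (\<lambda>x. \<phi> x + \<psi> x) (\<lambda>x. g x + k x)"
proof -
  obtain r r' where r: "\<And>x. norm x > r \<Longrightarrow> \<phi> x = 0" "\<And>x. norm x > r' \<Longrightarrow> \<psi> x = 0"
    using assms by (auto simp: compact_C1_def)
  have "\<forall>x. norm x > max r r' \<longrightarrow> \<phi> x + \<psi> x = 0" using r by auto
  then show ?thesis using assms unfolding compact_C1_def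
    by (intro conjI exI[of _ "max r r'"]) (auto intro!: derivative_eq_intros continuous_on_add simp: inner_add_left)
qed

lemma compact_C1_cmult:
  assumes "compact_C1 \<phi> g"
  shows "compact_C1 (\<lambda>x. c * \<phi> x) (\<lambda>x. c *\<^sub>R g x)"
  using assms unfolding compact_C1_def
  by (auto intro!: derivative_eq_intros continuous_intros)

lemma compact_C1_diff:
  assumes "compact_C1 \<phi> g" "compact_C1 \<psi> k"
  shows "compact_C1 (\<lambda>x. \<phi> x - \<psi> x) (\<lambda>x. g x - k x)"
  using compact_C1_add[OF assms(1) compact_C1_cmult[OF assms(2), of "-1"]] by simp

lemma compact_C1_mult:
  assumes "compact_C1 \<phi> g" "compact_C1 \<psi> k"
  shows "compact_C1 (\<lambda>x. \<phi> x * \<psi> x) (\<lambda>x. \<phi> x *\<^sub>R k x + \<psi> x *\<^sub>R g x)"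
proof -
  have "continuous_on UNIV \<phi>" "continuous_on UNIV \<psi>" using assms compact_C1_continuous by auto
  then show ?thesis using assms unfolding compact_C1_def
    by (fastforce intro!: derivative_eq_intros continuous_intros simp: inner_add_left)
qed

lemma integrable_bounded_support:
  fixes f :: "'a::euclidean_space \<Rightarrow> 'b::{banach, second_countable_topology}"
  assumes "f \<in> borel_measurable borel" "\<And>x. norm (f x) \<le> B" "\<And>x. norm x > r \<Longrightarrow> f x = 0"
  shows "integrable lborel f"
proof (rule integrableI_bounded_set[where A = "cball 0 r" and B = B])
  show "emeasure lborel (cball 0 r :: 'a set) < \<infinity>"
    using emeasure_bounded_finite[OF bounded_cball] by simp
qed (use assms in auto)

text \<open>The difference quotients of \<open>\<phi>\<close> have integral zero by translation invariance.\<close>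

lemma compact_C1_integral_gradient:
  fixes \<phi> :: "'a::euclidean_space \<Rightarrow> real"
  assumes c: "compact_C1 \<phi> g"
  shows "(LINT x|lborel. g x \<bullet> e) = 0"
proof -
  obtain r where r: "\<And>x. norm x > r \<Longrightarrow> \<phi> x = 0" using c by (auto simp: compact_C1_def)
  obtain B where B: "B > 0" "\<And>x. \<bar>\<phi> x\<bar> \<le> B" "\<And>x. norm (g x) \<le> B" using compact_C1_bounded[OF c] by blast
  have [measurable]: "\<phi> \<in> borel_measurable borel" "g \<in> borel_measurable borel" using compact_C1_borel[OF c] by auto
  have D: "(\<phi> has_derivative (\<lambda>h. g x \<bullet> h)) (at x)" for x using c by (auto simp: compact_C1_def)
  define t where "t n = inverse (real (Suc n))" for n
  have t: "t n > 0" "t n \<le> 1" for n by (auto simp: t_def field_simps)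
  define d where "d n x = (\<phi> (x + t n *\<^sub>R e) - \<phi> x) / t n" for n x
  have dm [measurable]: "d n \<in> borel_measurable borel" for n unfolding d_def by measurable
  have \<phi>i: "integrable lborel \<phi>" using B r by (intro integrable_bounded_support) auto
  have d0: "(LINT x|lborel. d n x) = 0" for n
  proof -
    have i1: "integrable lborel (\<lambda>x. \<phi> (x + t n *\<^sub>R e))"
    proof (rule integrable_bounded_support[where r = "r + norm (t n *\<^sub>R e)"])
      fix x :: 'a assume "norm x > r + norm (t n *\<^sub>R e)"
      then have "norm (x + t n *\<^sub>R e) > r" using norm_diff_ineq[of x "t n *\<^sub>R e"] by linarith
      then show "\<phi> (x + t n *\<^sub>R e) = 0" by (rule r)
    qed (use B in auto)
    have "(LINT x|lborel. \<phi> (x + t n *\<^sub>R e)) = (LINT x|distr lborel borel ((+) (t n *\<^sub>R e)). \<phi> x)"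
      by (subst integral_distr) (auto simp: add.commute)
    then have "(LINT x|lborel. \<phi> (x + t n *\<^sub>R e)) = (LINT x|lborel. \<phi> x)"
      by (simp add: lborel_distr_plus)
    then show ?thesis unfolding d_def using i1 \<phi>i by simp
  qed
  have bd: "norm (d n x) \<le> B * norm e" for n x
  proof -
    have "norm (\<phi> (x + t n *\<^sub>R e) - \<phi> x) \<le> B * norm (x + t n *\<^sub>R e - x)"
    proof (rule differentiable_bound[of UNIV \<phi> "\<lambda>x h. g x \<bullet> h"])
      show "onorm (\<lambda>h. g x \<bullet> h) \<le> B" for x
      proof (rule onorm_le)
        show "norm (g x \<bullet> h) \<le> B * norm h" for h
          using Cauchy_Schwarz_ineq2[of "g x" h] mult_right_mono[OF B(3)[of x] norm_ge_zero[of h]] by simp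
      qed
    qed (use D in auto)
    then show ?thesis using t[of n] unfolding d_def
      by (simp add: divide_simps mult_ac)
  qed
  \<comment> \<open>the mean value bound \<open>bd\<close> and the bounded support give an integrable majorant\<close>
  have "(\<lambda>n. LINT x|lborel. d n x) \<longlonglongrightarrow> (LINT x|lborel. g x \<bullet> e)"
  proof (rule integral_dominated_convergence[where w = "\<lambda>x. indicator (cball 0 (r + norm e)) x * (B * norm e)"])
    show "integrable lborel (\<lambda>x::'a. indicator (cball 0 (r + norm e)) x * (B * norm e))"
      using emeasure_bounded_finite[OF bounded_cball] by (intro integrable_mult_left integrable_real_indicator) auto
    show "AE x in lborel. norm (d n x) \<le> indicator (cball 0 (r + norm e)) x * (B * norm e)" for n
    proof (rule AE_I2)
      fix x
      show "norm (d n x) \<le> indicator (cball 0 (r + norm e)) x * (B * norm e)"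
      proof (cases "x \<in> cball 0 (r + norm e)")
        case False
        then have x: "norm x > r + norm e" by simp
        have "norm (t n *\<^sub>R e) \<le> norm e" using t[of n] by (simp add: mult_left_le_one_le)
        then have "norm (x + t n *\<^sub>R e) > r" using norm_diff_ineq[of x "t n *\<^sub>R e"] x by linarith
        moreover have "norm x > r" using x norm_ge_zero[of e] by linarith
        ultimately have "d n x = 0" using r by (simp add: d_def)
        then show ?thesis using False by simp
      qed (use bd in auto)
    qed
    show "AE x in lborel. (\<lambda>n. d n x) \<longlonglongrightarrow> g x \<bullet> e"
    proof (rule AE_I2)
      fix x
      have "((\<lambda>s. \<phi> (x + s *\<^sub>R e)) has_real_derivative (g x \<bullet> e)) (at 0)"
        using compact_C1_line_derivative[OF c, of x e 0] by simp
      then have "((\<lambda>s. (\<phi> (x + s *\<^sub>R e) - \<phi> x) / s) \<longlongrightarrow> g x \<bullet> e) (at 0)"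
        unfolding DERIV_def by simp
      moreover have "filterlim t (at 0) sequentially"
        unfolding t_def[abs_def] by (rule filterlim_inverse_Suc_at_0)
      ultimately show "(\<lambda>n. d n x) \<longlonglongrightarrow> g x \<bullet> e" unfolding d_def by (rule filterlim_compose)
    qed
  qed auto
  then show ?thesis by (simp add: d0 LIMSEQ_const_iff)
qed

lemma compact_C1_integrable_products:
  assumes c: "compact_C1 \<phi> g"
  shows "integrable lborel \<phi>" "integrable lborel (\<lambda>x. g x \<bullet> e)" "integrable lborel (\<lambda>x. (\<phi> x)\<^sup>2)"
    "integrable lborel (\<lambda>x. (norm (g x))\<^sup>2)" "integrable lborel (\<lambda>x. norm (g x))"
    "continuous_on UNIV h \<Longrightarrow> integrable lborel (\<lambda>x. h x * \<phi> x)"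
    "continuous_on UNIV h \<Longrightarrow> integrable lborel (\<lambda>x. h x * (g x \<bullet> e))"
proof -
  obtain r where r: "\<And>x. norm x > r \<Longrightarrow> \<phi> x = 0" using c by (auto simp: compact_C1_def)
  have g0: "g x = 0" if "norm x > r" for x using compact_C1_gradient_zero[OF c r that] by auto
  have key: "integrable lborel F" if F: "continuous_on UNIV F" "\<And>x. norm x > r \<Longrightarrow> F x = 0" for F :: "'a \<Rightarrow> real"
  proof -
    have "bounded (F ` cball 0 r)"
      using F(1) by (intro compact_imp_bounded compact_continuous_image) (auto intro: continuous_on_subset)
    then obtain B where B: "\<And>x. x \<in> cball 0 r \<Longrightarrow> norm (F x) \<le> B"
      unfolding bounded_iff by (metis imageI)
    show ?thesis
    proof (rule integrable_bounded_support[where B = "\<bar>B\<bar>" and r = r])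
      show "norm (F x) \<le> \<bar>B\<bar>" for x
        using B[of x] F(2)[of x] by (cases "norm x > r") auto
    qed (use F in \<open>auto intro: borel_measurable_continuous_onI\<close>)
  qed
  have C: "continuous_on UNIV \<phi>" "continuous_on UNIV g"
    using compact_C1_continuous[OF c] c by (auto simp: compact_C1_def)
  show "integrable lborel \<phi>" "integrable lborel (\<lambda>x. g x \<bullet> e)" "integrable lborel (\<lambda>x. (\<phi> x)\<^sup>2)"
    "integrable lborel (\<lambda>x. (norm (g x))\<^sup>2)" "integrable lborel (\<lambda>x. norm (g x))"
    "continuous_on UNIV h \<Longrightarrow> integrable lborel (\<lambda>x. h x * \<phi> x)"
    "continuous_on UNIV h \<Longrightarrow> integrable lborel (\<lambda>x. h x * (g x \<bullet> e))"
    by (rule key; use C r g0 in \<open>auto intro!: continuous_intros\<close>)+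
qed

lemma compact_C1_integration_by_parts:
  assumes c: "compact_C1 \<phi> g" "compact_C1 \<psi> k"
  shows "(LINT x|lborel. \<phi> x * (k x \<bullet> e)) = - (LINT x|lborel. (g x \<bullet> e) * \<psi> x)"
proof -
  have "0 = (LINT x|lborel. (\<phi> x *\<^sub>R k x + \<psi> x *\<^sub>R g x) \<bullet> e)"
    using compact_C1_integral_gradient[OF compact_C1_mult[OF c]] by simp
  also have "\<dots> = (LINT x|lborel. \<phi> x * (k x \<bullet> e) + \<psi> x * (g x \<bullet> e))"
    by (simp add: inner_add_left)
  also have "\<dots> = (LINT x|lborel. \<phi> x * (k x \<bullet> e)) + (LINT x|lborel. \<psi> x * (g x \<bullet> e))"
    using compact_C1_integrable_products(7)[OF c(1) compact_C1_continuous[OF c(2)], of e]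
      compact_C1_integrable_products(7)[OF c(2) compact_C1_continuous[OF c(1)], of e]
    by simp
  finally show ?thesis by (simp add: mult.commute)
qed

text \<open>The derivative is integrated along the segment from \<open>x\<close> to \<open>x + h\<close>. A further integration over
  \<open>x\<close> yields the translation estimate, on which Poincare's and Rellich's theorems rest.\<close>

lemma compact_C1_increment_square_le:
  assumes cC1: "compact_C1 \<phi> g"
  shows "ennreal ((\<phi> (x + h) - \<phi> x)\<^sup>2) \<le> (\<integral>\<^sup>+t. indicator {0..1} t * ennreal ((g (x + t *\<^sub>R h) \<bullet> h)\<^sup>2) \<partial>lborel)"
proof -
  have gc: "continuous_on UNIV g" using cC1 by (auto simp: compact_C1_def)
  define f where "f t = g (x + t *\<^sub>R h) \<bullet> h" for t
  define c where "c = \<phi> (x + h) - \<phi> x"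
  have fc: "continuous_on UNIV f" unfolding f_def
    by (intro continuous_intros continuous_on_compose2[OF gc]) auto
  have [measurable]: "f \<in> borel_measurable borel" using fc by (rule borel_measurable_continuous_onI)
  have der: "((\<lambda>t. \<phi> (x + t *\<^sub>R h)) has_real_derivative f t) (at t)" for t
    unfolding f_def by (rule compact_C1_line_derivative[OF cC1])
  have ftc: "has_bochner_integral lborel (\<lambda>t. f t * indicator {0..1} t) c"
    using has_bochner_integral_FTC_Icc_real[of 0 1 "\<lambda>t. \<phi> (x + t *\<^sub>R h)" f] der fc
    by (simp add: c_def continuous_on_eq_continuous_at)
  have f2: "integrable lborel (\<lambda>t. indicator {0..1} t *\<^sub>R (f t)\<^sup>2)"
    by (rule borel_integrable_compact) (auto intro!: continuous_intros continuous_on_subset[OF fc])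
  have i1: "integrable lborel (\<lambda>t::real. indicator {0..1} t :: real)" by simp
  have i2: "integrable lborel (\<lambda>t. f t * indicator {0..1} t)" and i3: "(LINT t|lborel. f t * indicator {0..1} t) = c"
    using ftc by (auto simp: has_bochner_integral_iff)
  have "0 \<le> (LINT t|lborel. indicator {0..1} t * (f t - c)\<^sup>2)" by simp
  also have "\<dots> = (LINT t|lborel. indicator {0..1} t *\<^sub>R (f t)\<^sup>2 - 2 * c * (f t * indicator {0..1} t) + c\<^sup>2 * indicator {0..1} t)"
    by (rule Bochner_Integration.integral_cong) (auto simp: indicator_def power2_eq_square algebra_simps)
  also have "\<dots> = (LINT t|lborel. indicator {0..1} t *\<^sub>R (f t)\<^sup>2) - 2 * c * c + c\<^sup>2"
    using f2 i1 i2 i3 by simp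
  finally have "c\<^sup>2 \<le> (LINT t|lborel. indicator {0..1} t *\<^sub>R (f t)\<^sup>2)"
    by (simp add: power2_eq_square)
  then have "ennreal (c\<^sup>2) \<le> ennreal (LINT t|lborel. indicator {0..1} t *\<^sub>R (f t)\<^sup>2)" by (rule ennreal_leI)
  also have "\<dots> = (\<integral>\<^sup>+t. ennreal (indicator {0..1} t *\<^sub>R (f t)\<^sup>2) \<partial>lborel)"
    by (rule nn_integral_eq_integral[symmetric, OF f2]) auto
  also have "\<dots> = (\<integral>\<^sup>+t. indicator {0..1} t * ennreal ((f t)\<^sup>2) \<partial>lborel)"
    by (auto intro!: nn_integral_cong simp: indicator_def)
  finally show ?thesis unfolding c_def f_def .
qed

lemma nn_integral_lborel_shift:
  fixes h :: "'a::euclidean_space"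
  assumes [measurable]: "F \<in> borel_measurable borel"
  shows "(\<integral>\<^sup>+x. F (x + h) \<partial>lborel) = (\<integral>\<^sup>+x. F x \<partial>lborel)"
proof -
  have "(\<integral>\<^sup>+x. F (x + h) \<partial>lborel) = (\<integral>\<^sup>+x. F x \<partial>distr lborel borel ((+) h))"
    by (subst nn_integral_distr) (auto simp: add.commute)
  then show ?thesis by (simp add: lborel_distr_plus)
qed

lemma nn_integral_lborel_Fubini:
  fixes F :: "'a::euclidean_space \<Rightarrow> 'b::euclidean_space \<Rightarrow> ennreal"
  assumes "(\<lambda>(x, y). F x y) \<in> borel_measurable (borel \<Otimes>\<^sub>M borel)"
  shows "(\<integral>\<^sup>+x. \<integral>\<^sup>+y. F x y \<partial>lborel \<partial>lborel) = (\<integral>\<^sup>+y. \<integral>\<^sup>+x. F x y \<partial>lborel \<partial>lborel)"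
proof -
  have "(\<lambda>(x, y). F x y) \<in> borel_measurable (lborel \<Otimes>\<^sub>M lborel)"
    using assms by (simp cong: measurable_cong_sets)
  from lborel_pair.Fubini'[OF this] show ?thesis by simp
qed

lemma compact_C1_translation:
  assumes c: "compact_C1 \<phi> g"
  shows "(\<integral>\<^sup>+x. ennreal ((\<phi> (x + h) - \<phi> x)\<^sup>2) \<partial>lborel) \<le> ennreal ((norm h)\<^sup>2 * (LINT x|lborel. (norm (g x))\<^sup>2))"
proof -
  have [measurable]: "\<phi> \<in> borel_measurable borel" "g \<in> borel_measurable borel" using compact_C1_borel[OF c] by auto
  have "(\<integral>\<^sup>+x. ennreal ((\<phi> (x + h) - \<phi> x)\<^sup>2) \<partial>lborel)
      \<le> (\<integral>\<^sup>+x. \<integral>\<^sup>+t. indicator {0..1::real} t * ennreal ((g (x + t *\<^sub>R h) \<bullet> h)\<^sup>2) \<partial>lborel \<partial>lborel)"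
    by (intro nn_integral_mono compact_C1_increment_square_le[OF c])
  also have "\<dots> = (\<integral>\<^sup>+t. \<integral>\<^sup>+x. indicator {0..1::real} t * ennreal ((g (x + t *\<^sub>R h) \<bullet> h)\<^sup>2) \<partial>lborel \<partial>lborel)"
    by (rule nn_integral_lborel_Fubini) measurable
  also have "\<dots> = (\<integral>\<^sup>+t. indicator {0..1::real} t * (\<integral>\<^sup>+x. ennreal ((g (x + t *\<^sub>R h) \<bullet> h)\<^sup>2) \<partial>lborel) \<partial>lborel)"
    by (intro nn_integral_cong nn_integral_cmult) measurable
  also have "\<dots> = (\<integral>\<^sup>+t. indicator {0..1::real} t * (\<integral>\<^sup>+x. ennreal ((g x \<bullet> h)\<^sup>2) \<partial>lborel) \<partial>lborel)"
    by (intro nn_integral_cong arg_cong2[where f = "(*)"] refl nn_integral_lborel_shift[of "\<lambda>x. ennreal ((g x \<bullet> h)\<^sup>2)"]) measurable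
  also have "\<dots> = (\<integral>\<^sup>+x. ennreal ((g x \<bullet> h)\<^sup>2) \<partial>lborel)"
    by (subst nn_integral_multc) auto
  also have "\<dots> \<le> (\<integral>\<^sup>+x. ennreal ((norm h)\<^sup>2 * (norm (g x))\<^sup>2) \<partial>lborel)"
  proof (intro nn_integral_mono ennreal_leI)
    fix x
    have "\<bar>g x \<bullet> h\<bar>\<^sup>2 \<le> (norm (g x) * norm h)\<^sup>2"
      by (intro power_mono Cauchy_Schwarz_ineq2) auto
    then show "(g x \<bullet> h)\<^sup>2 \<le> (norm h)\<^sup>2 * (norm (g x))\<^sup>2" by (simp add: power_mult_distrib mult.commute)
  qed
  also have "\<dots> = ennreal (LINT x|lborel. (norm h)\<^sup>2 * (norm (g x))\<^sup>2)"
    by (rule nn_integral_eq_integral) (use compact_C1_integrable_products(4)[OF c] in auto)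
  finally show ?thesis by simp
qed

text \<open>Poincare's inequality is the translation estimate for a shift that separates the support of
  \<open>\<phi>\<close> from its translate.\<close>

lemma compact_C1_Poincare:
  fixes \<phi> :: "'a::euclidean_space \<Rightarrow> real"
  assumes c: "compact_C1 \<phi> g" and r: "\<And>x. norm x > r \<Longrightarrow> \<phi> x = 0" and r0: "r \<ge> 0"
  shows "(LINT x|lborel. (\<phi> x)\<^sup>2) \<le> (2 * r + 1)\<^sup>2 * (LINT x|lborel. (norm (g x))\<^sup>2)"
proof -
  have [measurable]: "\<phi> \<in> borel_measurable borel" using compact_C1_borel[OF c] by auto
  \<comment> \<open>a shift longer than the diameter of the ball that contains the support\<close>
  define h :: 'a where "h = (2 * r + 1) *\<^sub>R (SOME i. i \<in> Basis)"
  have h: "norm h = 2 * r + 1" using r0 by (simp add: h_def SOME_Basis)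
  have "(\<integral>\<^sup>+x. ennreal ((\<phi> x)\<^sup>2) \<partial>lborel) = (\<integral>\<^sup>+x. ennreal ((\<phi> (x + h))\<^sup>2) \<partial>lborel)"
    by (rule nn_integral_lborel_shift[of "\<lambda>x. ennreal ((\<phi> x)\<^sup>2)", symmetric]) measurable
  also have "\<dots> \<le> (\<integral>\<^sup>+x. ennreal ((\<phi> (x + h) - \<phi> x)\<^sup>2) \<partial>lborel)"
  proof (intro nn_integral_mono ennreal_leI)
    fix x
    show "(\<phi> (x + h))\<^sup>2 \<le> (\<phi> (x + h) - \<phi> x)\<^sup>2"
    proof (cases "norm x > r")
      case False
      then have "norm (x + h) > r" using norm_diff_ineq[of h x] h by (simp add: add.commute)
      then show ?thesis using r by simp
    qed (use r in simp)
  qed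
  also have "\<dots> \<le> ennreal ((norm h)\<^sup>2 * (LINT x|lborel. (norm (g x))\<^sup>2))"
    by (rule compact_C1_translation[OF c])
  also have "(\<integral>\<^sup>+x. ennreal ((\<phi> x)\<^sup>2) \<partial>lborel) = ennreal (LINT x|lborel. (\<phi> x)\<^sup>2)"
    by (rule nn_integral_eq_integral) (use compact_C1_integrable_products(3)[OF c] in auto)
  finally show ?thesis unfolding h by (subst (asm) ennreal_le_iff) auto
qed

section \<open>Rellich's compactness theorem\<close>

text \<open>Ball integrals are not normalised: in this form they are Lipschitz in the centre and bounded
  uniformly in radii up to \<open>1\<close>, as the extraction of convergent subsequences requires.\<close>
definition ball_integral :: "real \<Rightarrow> ('a::euclidean_space \<Rightarrow> real) \<Rightarrow> 'a \<Rightarrow> real" where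
  "ball_integral d w x = (LINT z|lborel. indicator (ball 0 d) z * w (x + z))"

lemma integrable_ball_continuous:
  fixes F :: "'a::euclidean_space \<Rightarrow> real"
  assumes "continuous_on UNIV F"
  shows "integrable lborel (\<lambda>z. indicator (ball 0 d) z * F z)"
proof -
  have "integrable lborel (\<lambda>z. indicator (ball 0 d) z *\<^sub>R (indicator (cball 0 d) z *\<^sub>R F z))"
    by (intro integrable_mult_indicator borel_integrable_compact) (auto intro: continuous_on_subset[OF assms])
  moreover have "(\<lambda>z. indicator (ball 0 d) z *\<^sub>R (indicator (cball 0 d) z *\<^sub>R F z)) = (\<lambda>z. indicator (ball 0 d) z * F z)"
    by (auto simp: indicator_def fun_eq_iff)
  ultimately show ?thesis by simp
qed

lemma ball_integral_square_le:
  fixes F :: "'a::euclidean_space \<Rightarrow> real"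
  assumes F: "continuous_on UNIV F"
  shows "(LINT z|lborel. indicator (ball 0 d) z * F z)\<^sup>2
    \<le> measure lborel (ball 0 d :: 'a set) * (LINT z|lborel. indicator (ball 0 d) z * (F z)\<^sup>2)"
proof -
  have [measurable]: "F \<in> borel_measurable borel" using F by (rule borel_measurable_continuous_onI)
  have [measurable]: "(ball 0 d :: 'a set) \<in> sets borel" by simp
  have sq: "(indicator (ball 0 d) z :: real)\<^sup>2 = indicator (ball 0 d) z" for z :: 'a
    by (simp add: indicator_def)
  have fin: "emeasure lborel (ball 0 d :: 'a set) < \<infinity>"
    by (rule emeasure_bounded_finite) simp
  have "(LINT z|lborel. indicator (ball 0 d) z * (indicator (ball 0 d) z * F z))\<^sup>2
    \<le> (LINT z|lborel. (indicator (ball 0 d :: 'a set) z)\<^sup>2) * (LINT z|lborel. (indicator (ball 0 d) z * F z)\<^sup>2)"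
  proof (rule integral_Cauchy_Schwarz(2))
    show "integrable lborel (\<lambda>z::'a. (indicator (ball 0 d) z :: real)\<^sup>2)" using fin by (simp add: sq)
    show "integrable lborel (\<lambda>z. (indicator (ball 0 d) z * F z)\<^sup>2)"
      using integrable_ball_continuous[OF continuous_on_power[OF F], of d 2] by (simp add: power_mult_distrib sq)
  qed measurable
  then show ?thesis
    by (simp add: sq power_mult_distrib flip: mult.assoc power2_eq_square)
qed

text \<open>Moving the centre amounts to translating \<open>w\<close>, so the Cauchy-Schwarz inequality reduces the claim to
  the translation estimate.\<close>

lemma ball_integral_lipschitz:
  fixes x y :: "'a::euclidean_space"
  assumes c: "compact_C1 w g" and K: "(LINT x|lborel. (norm (g x))\<^sup>2) \<le> K"
  shows "(ball_integral d w x - ball_integral d w y)\<^sup>2 \<le> measure lborel (ball 0 d :: 'a set) * ((norm (x - y))\<^sup>2 * K)"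
proof -
  have wc: "continuous_on UNIV w" using compact_C1_continuous[OF c] .
  have [measurable]: "w \<in> borel_measurable borel" using compact_C1_borel[OF c] by auto
  have sc: "continuous_on UNIV (\<lambda>z. w (x + z))" for x
    by (intro continuous_on_compose2[OF wc] continuous_intros) auto
  define F where "F z = w (x + z) - w (y + z)" for z
  have Fc: "continuous_on UNIV F" unfolding F_def by (intro continuous_intros sc)
  have [measurable]: "F \<in> borel_measurable borel" using Fc by (rule borel_measurable_continuous_onI)
  have "ball_integral d w x - ball_integral d w y = (LINT z|lborel. indicator (ball 0 d) z * F z)"
    unfolding ball_integral_def F_def right_diff_distrib
    by (subst Bochner_Integration.integral_diff) (auto intro: integrable_ball_continuous sc)
  then have "(ball_integral d w x - ball_integral d w y)\<^sup>2
    \<le> measure lborel (ball 0 d :: 'a set) * (LINT z|lborel. indicator (ball 0 d) z * (F z)\<^sup>2)"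
    using ball_integral_square_le[OF Fc, of d] by simp
  also have "\<dots> \<le> measure lborel (ball 0 d :: 'a set) * ((norm (x - y))\<^sup>2 * K)"
  proof (rule mult_left_mono)
    have "ennreal (LINT z|lborel. indicator (ball 0 d) z * (F z)\<^sup>2) = (\<integral>\<^sup>+z. ennreal (indicator (ball 0 d) z * (F z)\<^sup>2) \<partial>lborel)"
      by (rule nn_integral_eq_integral[symmetric])
        (auto intro!: integrable_ball_continuous continuous_intros Fc)
    also have "\<dots> \<le> (\<integral>\<^sup>+z. ennreal ((w ((z + y) + (x - y)) - w (z + y))\<^sup>2) \<partial>lborel)"
      by (intro nn_integral_mono ennreal_leI) (auto simp: F_def indicator_def algebra_simps)
    also have "\<dots> = (\<integral>\<^sup>+z. ennreal ((w (z + (x - y)) - w z)\<^sup>2) \<partial>lborel)"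
      by (rule nn_integral_lborel_shift[of "\<lambda>z. ennreal ((w (z + (x - y)) - w z)\<^sup>2)" y]) measurable
    also have "\<dots> \<le> ennreal ((norm (x - y))\<^sup>2 * (LINT x|lborel. (norm (g x))\<^sup>2))"
      by (rule compact_C1_translation[OF c])
    also have "\<dots> \<le> ennreal ((norm (x - y))\<^sup>2 * K)"
      by (intro ennreal_leI mult_left_mono K) auto
    finally show "(LINT z|lborel. indicator (ball 0 d) z * (F z)\<^sup>2) \<le> (norm (x - y))\<^sup>2 * K"
      using K by (subst (asm) ennreal_le_iff) (auto intro!: mult_nonneg_nonneg intro: order_trans[rotated])
  qed simp
  finally show ?thesis .
qed

text \<open>The mean of \<open>w\<close> over the ball of radius \<open>d\<close> about \<open>x\<close> differs from \<open>w x\<close> in mean square by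
  at most \<open>d\<close> times the norm of the gradient. So \<open>w\<close> is small in mean square as soon as all its
  ball means are.\<close>

lemma compact_C1_L2_le_ball_integrals:
  fixes w :: "'a::euclidean_space \<Rightarrow> real" and d r s K
  defines "V \<equiv> measure lborel (ball 0 d :: 'a set)"
  assumes c: "compact_C1 w g" and r: "\<And>x. norm x > r \<Longrightarrow> w x = 0"
    and K: "(LINT x|lborel. (norm (g x))\<^sup>2) \<le> K" and d: "d > 0"
    and s: "\<And>x. norm x \<le> r \<Longrightarrow> \<bar>ball_integral d w x\<bar> \<le> s"
  shows "(LINT x|lborel. (w x)\<^sup>2) \<le> 2 * d\<^sup>2 * K + 2 * s\<^sup>2 / V\<^sup>2 * measure lborel (cball 0 r :: 'a set)"
proof -
  have V: "V > 0" unfolding V_def using content_ball_pos[OF d] by simp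
  have K0: "K \<ge> 0" using K by (rule order_trans[rotated]) simp
  have wc: "continuous_on UNIV w" using compact_C1_continuous[OF c] .
  have [measurable]: "w \<in> borel_measurable borel" using compact_C1_borel[OF c] by auto
  have fin: "emeasure lborel (ball 0 d :: 'a set) < \<infinity>"
    by (rule emeasure_bounded_finite) simp
  \<comment> \<open>\<open>w x\<close> is its mean over the ball plus the mean of its deviations, whose square is estimated by
    Cauchy-Schwarz\<close>
  have pt: "V * (w x)\<^sup>2 \<le> 2 * (LINT z|lborel. indicator (ball 0 d) z * (w (x + z) - w x)\<^sup>2) + 2 * (ball_integral d w x)\<^sup>2 / V" for x
  proof -
    have sc: "continuous_on UNIV (\<lambda>z. w (x + z))"
      by (intro continuous_on_compose2[OF wc] continuous_intros) auto
    define I where "I = ball_integral d w x"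
    have "(LINT z|lborel. indicator (ball 0 d) z * (w (x + z) - w x)\<^sup>2) =
      (LINT z|lborel. indicator (ball 0 d) z * (w (x + z))\<^sup>2 - 2 * w x * (indicator (ball 0 d) z * w (x + z)) + (w x)\<^sup>2 * indicator (ball 0 d) z)"
      by (rule Bochner_Integration.integral_cong) (auto simp: power2_eq_square algebra_simps)
    also have "\<dots> = (LINT z|lborel. indicator (ball 0 d) z * (w (x + z))\<^sup>2) - 2 * w x * I + (w x)\<^sup>2 * V"
      unfolding I_def ball_integral_def V_def
      using integrable_ball_continuous[OF sc, of d] integrable_ball_continuous[OF continuous_on_power[OF sc], of d 2] fin
      by simp
    finally have 1: "(LINT z|lborel. indicator (ball 0 d) z * (w (x + z) - w x)\<^sup>2) =
      (LINT z|lborel. indicator (ball 0 d) z * (w (x + z))\<^sup>2) - 2 * w x * I + (w x)\<^sup>2 * V" .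
    have 2: "I\<^sup>2 / V \<le> (LINT z|lborel. indicator (ball 0 d) z * (w (x + z))\<^sup>2)"
      using ball_integral_square_le[OF sc, of d] V unfolding I_def ball_integral_def V_def[symmetric]
      by (simp add: divide_simps mult.commute)
    have "0 \<le> (V * w x - 2 * I)\<^sup>2 / V" using V by simp
    also have "\<dots> = V * (w x)\<^sup>2 - 4 * w x * I + 4 * I\<^sup>2 / V"
      using V by (simp add: power2_eq_square field_simps)
    finally have 3: "0 \<le> V * (w x)\<^sup>2 - 4 * w x * I + 4 * (I\<^sup>2 / V)" by simp
    show ?thesis unfolding 1 I_def[symmetric] using 2 3 by (simp add: algebra_simps)
  qed
  have [measurable]: "(ball 0 d :: 'a set) \<in> sets borel" "(cball 0 r :: 'a set) \<in> sets borel" by simp_all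
  have ms: "(\<lambda>x. \<integral>\<^sup>+z. indicator (ball 0 d) z * ennreal ((w (x + z) - w x)\<^sup>2) \<partial>lborel) \<in> borel_measurable lborel"
      "(\<lambda>x. 2 * (\<integral>\<^sup>+z. indicator (ball 0 d) z * ennreal ((w (x + z) - w x)\<^sup>2) \<partial>lborel)) \<in> borel_measurable lborel"
      "(\<lambda>x::'a. ennreal (2 * s\<^sup>2 / V) * indicator (cball 0 r) x) \<in> borel_measurable lborel"
    by measurable
  have "ennreal (V * (LINT x|lborel. (w x)\<^sup>2)) = (\<integral>\<^sup>+x. ennreal (V * (w x)\<^sup>2) \<partial>lborel)"
    using V compact_C1_integrable_products(3)[OF c] by (subst nn_integral_eq_integral) auto
  also have "\<dots> \<le> (\<integral>\<^sup>+x. 2 * (\<integral>\<^sup>+z. indicator (ball 0 d) z * ennreal ((w (x + z) - w x)\<^sup>2) \<partial>lborel)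
      + ennreal (2 * s\<^sup>2 / V) * indicator (cball 0 r) x \<partial>lborel)"
  proof (rule nn_integral_mono)
    fix x
    show "ennreal (V * (w x)\<^sup>2) \<le> 2 * (\<integral>\<^sup>+z. indicator (ball 0 d) z * ennreal ((w (x + z) - w x)\<^sup>2) \<partial>lborel)
      + ennreal (2 * s\<^sup>2 / V) * indicator (cball 0 r) x"
    proof (cases "norm x \<le> r")
      case True
      have "(ball_integral d w x)\<^sup>2 \<le> s\<^sup>2" using s[OF True] by (rule abs_le_square_iff[THEN iffD1, OF order_trans]) simp
      then have "2 * (ball_integral d w x)\<^sup>2 / V \<le> 2 * s\<^sup>2 / V" using V by (simp add: divide_right_mono)
      with pt[of x] have "V * (w x)\<^sup>2 \<le> 2 * (LINT z|lborel. indicator (ball 0 d) z * (w (x + z) - w x)\<^sup>2) + 2 * s\<^sup>2 / V"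
        by linarith
      then have "ennreal (V * (w x)\<^sup>2) \<le> ennreal (2 * (LINT z|lborel. indicator (ball 0 d) z * (w (x + z) - w x)\<^sup>2) + 2 * s\<^sup>2 / V)"
        by (rule ennreal_leI)
      also have "\<dots> = 2 * ennreal (LINT z|lborel. indicator (ball 0 d) z * (w (x + z) - w x)\<^sup>2) + ennreal (2 * s\<^sup>2 / V)"
        using V by (subst ennreal_plus) (auto simp: ennreal_mult)
      also have "ennreal (LINT z|lborel. indicator (ball 0 d) z * (w (x + z) - w x)\<^sup>2) =
          (\<integral>\<^sup>+z. ennreal (indicator (ball 0 d) z * (w (x + z) - w x)\<^sup>2) \<partial>lborel)"
        by (rule nn_integral_eq_integral[symmetric])
          (auto intro!: integrable_ball_continuous continuous_intros continuous_on_compose2[OF wc])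
      also have "\<dots> = (\<integral>\<^sup>+z. indicator (ball 0 d) z * ennreal ((w (x + z) - w x)\<^sup>2) \<partial>lborel)"
        by (auto intro!: nn_integral_cong simp: indicator_def)
      finally show ?thesis using True by simp
    qed (use r in simp)
  qed
  also have "\<dots> = 2 * (\<integral>\<^sup>+x. (\<integral>\<^sup>+z. indicator (ball 0 d) z * ennreal ((w (x + z) - w x)\<^sup>2) \<partial>lborel) \<partial>lborel)
      + (\<integral>\<^sup>+x. ennreal (2 * s\<^sup>2 / V) * indicator (cball 0 r :: 'a set) x \<partial>lborel)"
    using nn_integral_add[of "\<lambda>x. 2 * (\<integral>\<^sup>+z. indicator (ball 0 d) z * ennreal ((w (x + z) - w x)\<^sup>2) \<partial>lborel)" lborel
        "\<lambda>x. ennreal (2 * s\<^sup>2 / V) * indicator (cball 0 r) x"]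
      nn_integral_cmult[of "\<lambda>x. \<integral>\<^sup>+z. indicator (ball 0 d) z * ennreal ((w (x + z) - w x)\<^sup>2) \<partial>lborel" lborel 2] ms
    by simp
  finally have main: "ennreal (V * (LINT x|lborel. (w x)\<^sup>2)) \<le>
      2 * (\<integral>\<^sup>+x. (\<integral>\<^sup>+z. indicator (ball 0 d) z * ennreal ((w (x + z) - w x)\<^sup>2) \<partial>lborel) \<partial>lborel)
      + (\<integral>\<^sup>+x. ennreal (2 * s\<^sup>2 / V) * indicator (cball 0 r :: 'a set) x \<partial>lborel)" .
  have "(\<integral>\<^sup>+x. (\<integral>\<^sup>+z. indicator (ball 0 d) z * ennreal ((w (x + z) - w x)\<^sup>2) \<partial>lborel) \<partial>lborel)
      = (\<integral>\<^sup>+z. (\<integral>\<^sup>+x. indicator (ball 0 d) z * ennreal ((w (x + z) - w x)\<^sup>2) \<partial>lborel) \<partial>lborel)"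
    by (rule nn_integral_lborel_Fubini) measurable
  also have "\<dots> = (\<integral>\<^sup>+z. indicator (ball 0 d) z * (\<integral>\<^sup>+x. ennreal ((w (x + z) - w x)\<^sup>2) \<partial>lborel) \<partial>lborel)"
    by (intro nn_integral_cong nn_integral_cmult) measurable
  also have "\<dots> \<le> (\<integral>\<^sup>+z. ennreal (d\<^sup>2 * K) * indicator (ball 0 d :: 'a set) z \<partial>lborel)"
  proof (rule nn_integral_mono)
    fix z :: 'a
    show "indicator (ball 0 d) z * (\<integral>\<^sup>+x. ennreal ((w (x + z) - w x)\<^sup>2) \<partial>lborel) \<le> ennreal (d\<^sup>2 * K) * indicator (ball 0 d) z"
    proof (cases "z \<in> ball 0 d")
      case True
      have "(\<integral>\<^sup>+x. ennreal ((w (x + z) - w x)\<^sup>2) \<partial>lborel) \<le> ennreal ((norm z)\<^sup>2 * (LINT x|lborel. (norm (g x))\<^sup>2))"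
        by (rule compact_C1_translation[OF c])
      also have "\<dots> \<le> ennreal (d\<^sup>2 * K)"
        using True K by (intro ennreal_leI mult_mono power_mono) auto
      finally show ?thesis using True by simp
    qed simp
  qed
  also have "\<dots> = ennreal (d\<^sup>2 * K * V)"
    using fin K0 by (simp add: nn_integral_cmult_indicator emeasure_eq_ennreal_measure less_top[symmetric] ennreal_mult' V_def)
  finally have inner: "(\<integral>\<^sup>+x. (\<integral>\<^sup>+z. indicator (ball 0 d) z * ennreal ((w (x + z) - w x)\<^sup>2) \<partial>lborel) \<partial>lborel)
      \<le> ennreal (d\<^sup>2 * K * V)" .
  have outer: "(\<integral>\<^sup>+x. ennreal (2 * s\<^sup>2 / V) * indicator (cball 0 r :: 'a set) x \<partial>lborel) = ennreal (2 * s\<^sup>2 / V * measure lborel (cball 0 r :: 'a set))"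
  proof -
    have "emeasure lborel (cball 0 r :: 'a set) < \<infinity>" by (rule emeasure_bounded_finite) simp
    then have "emeasure lborel (cball 0 r :: 'a set) = ennreal (measure lborel (cball 0 r :: 'a set))"
      by (intro emeasure_eq_ennreal_measure) simp
    then show ?thesis
      using ennreal_mult''[of "measure lborel (cball 0 r :: 'a set)" "2 * s\<^sup>2 / V"]
      by (subst nn_integral_cmult_indicator) (simp_all del: times_divide_eq_left)
  qed
  note main
  also have "2 * (\<integral>\<^sup>+x. (\<integral>\<^sup>+z. indicator (ball 0 d) z * ennreal ((w (x + z) - w x)\<^sup>2) \<partial>lborel) \<partial>lborel)
      + (\<integral>\<^sup>+x. ennreal (2 * s\<^sup>2 / V) * indicator (cball 0 r :: 'a set) x \<partial>lborel)
      \<le> 2 * ennreal (d\<^sup>2 * K * V) + ennreal (2 * s\<^sup>2 / V * measure lborel (cball 0 r :: 'a set))"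
    unfolding outer by (intro add_right_mono mult_left_mono inner) simp
  also have "2 * ennreal (d\<^sup>2 * K * V) + ennreal (2 * s\<^sup>2 / V * measure lborel (cball 0 r :: 'a set))
      = ennreal (2 * (d\<^sup>2 * K * V) + 2 * s\<^sup>2 / V * measure lborel (cball 0 r :: 'a set))"
    using V K0 by (subst ennreal_plus) (auto simp: ennreal_mult)
  finally have "V * (LINT x|lborel. (w x)\<^sup>2) \<le> 2 * (d\<^sup>2 * K * V) + 2 * s\<^sup>2 / V * measure lborel (cball 0 r :: 'a set)"
    using V K0 by (subst (asm) ennreal_le_iff) auto
  then have "(LINT x|lborel. (w x)\<^sup>2) \<le> (2 * (d\<^sup>2 * K * V) + 2 * s\<^sup>2 / V * measure lborel (cball 0 r :: 'a set)) / V"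
    using V by (simp add: pos_le_divide_eq mult.commute)
  also have "\<dots> = 2 * d\<^sup>2 * K + 2 * s\<^sup>2 / V\<^sup>2 * measure lborel (cball 0 r :: 'a set)"
    using V by (simp add: field_simps power2_eq_square)
  finally show ?thesis .
qed

lemma ball_integral_diff:
  assumes "compact_C1 w g" "compact_C1 v k"
  shows "ball_integral d (\<lambda>x. w x - v x) x = ball_integral d w x - ball_integral d v x"
proof -
  have "continuous_on UNIV (\<lambda>z. w (x + z))" "continuous_on UNIV (\<lambda>z. v (x + z))"
    by (intro continuous_on_compose2[OF compact_C1_continuous[OF assms(1)]]
        continuous_on_compose2[OF compact_C1_continuous[OF assms(2)]] continuous_intros; simp)+
  then show ?thesis unfolding ball_integral_def right_diff_distrib
    by (subst Bochner_Integration.integral_diff) (auto intro: integrable_ball_continuous)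
qed

text \<open>A diagonal subsequence makes the ball integrals converge for all radii \<open>1/j\<close> and all centres in a
  countable dense set. By their Lipschitz bound they converge uniformly on the ball that carries the supports,
  finitely many centres being enough for each accuracy. The estimate \<open>compact_C1_L2_le_ball_integrals\<close>, for
  a small radius chosen first, turns this into convergence in mean square.\<close>

lemma Rellich:
  fixes \<phi> :: "nat \<Rightarrow> 'a::euclidean_space \<Rightarrow> real"
  assumes c: "\<And>k. compact_C1 (\<phi> k) (g k)" and r: "\<And>k x. norm x > r \<Longrightarrow> \<phi> k x = 0" and r0: "r \<ge> 0"
    and K: "\<And>k. (LINT x|lborel. (norm (g k x))\<^sup>2) \<le> K"
  obtains \<sigma> :: "nat \<Rightarrow> nat" where "strict_mono \<sigma>"
    "\<And>\<epsilon>. \<epsilon> > 0 \<Longrightarrow> \<exists>N. \<forall>m\<ge>N. \<forall>n\<ge>N. (LINT x|lborel. (\<phi> (\<sigma> m) x - \<phi> (\<sigma> n) x)\<^sup>2) < \<epsilon>"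
proof -
  obtain D :: "'a set" where D: "countable D" "\<And>X. open X \<Longrightarrow> X \<noteq> {} \<Longrightarrow> \<exists>d\<in>D. d \<in> X"
    using countable_dense_exists by blast
  define W where "W = measure lborel (cball 0 r :: 'a set)"
  define \<delta> where "\<delta> j = inverse (real (Suc j))" for j
  define M where "M = sqrt (measure lborel (ball 0 1 :: 'a set) * ((2 * r + 1)\<^sup>2 * K))"
  have K0: "K \<ge> 0" using K[of 0] by (rule order_trans[rotated]) simp
  have bound: "norm (case p of (x, j) \<Rightarrow> ball_integral (\<delta> j) (\<phi> k) x) \<le> M" for k p
  proof (cases p)
    case (Pair x j)
    have wc: "continuous_on UNIV (\<lambda>z. \<phi> k (x + z))"
      by (intro continuous_on_compose2[OF compact_C1_continuous[OF c]] continuous_intros) auto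
    have [measurable]: "\<phi> k \<in> borel_measurable borel" using compact_C1_borel[OF c] by auto
    have "(ball_integral (\<delta> j) (\<phi> k) x)\<^sup>2 \<le> measure lborel (ball 0 (\<delta> j) :: 'a set) * (LINT z|lborel. indicator (ball 0 (\<delta> j)) z * (\<phi> k (x + z))\<^sup>2)"
      unfolding ball_integral_def by (rule ball_integral_square_le[OF wc])
    also have "\<dots> \<le> measure lborel (ball 0 1 :: 'a set) * ((2 * r + 1)\<^sup>2 * K)"
    proof (rule mult_mono)
      show "measure lborel (ball 0 (\<delta> j) :: 'a set) \<le> measure lborel (ball 0 1 :: 'a set)"
      proof (rule measure_mono_fmeasurable)
        have "\<delta> j \<le> 1" by (simp add: \<delta>_def inverse_le_1_iff)
        then show "ball 0 (\<delta> j) \<subseteq> (ball 0 1 :: 'a set)" by auto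
        show "(ball 0 1 :: 'a set) \<in> fmeasurable lborel"
          unfolding fmeasurable_def using emeasure_bounded_finite[of "ball 0 1 :: 'a set"] by simp
      qed simp
      have "ennreal (LINT z|lborel. indicator (ball 0 (\<delta> j)) z * (\<phi> k (x + z))\<^sup>2)
         = (\<integral>\<^sup>+z. ennreal (indicator (ball 0 (\<delta> j)) z * (\<phi> k (x + z))\<^sup>2) \<partial>lborel)"
        by (rule nn_integral_eq_integral[symmetric]) (auto intro!: integrable_ball_continuous continuous_intros wc)
      also have "\<dots> \<le> (\<integral>\<^sup>+z. ennreal ((\<phi> k (z + x))\<^sup>2) \<partial>lborel)"
        by (intro nn_integral_mono ennreal_leI) (auto simp: indicator_def add.commute)
      also have "\<dots> = (\<integral>\<^sup>+z. ennreal ((\<phi> k z)\<^sup>2) \<partial>lborel)"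
        by (rule nn_integral_lborel_shift[of "\<lambda>z. ennreal ((\<phi> k z)\<^sup>2)" x]) measurable
      also have "\<dots> = ennreal (LINT z|lborel. (\<phi> k z)\<^sup>2)"
        by (rule nn_integral_eq_integral) (use compact_C1_integrable_products(3)[OF c] in auto)
      also have "\<dots> \<le> ennreal ((2 * r + 1)\<^sup>2 * K)"
        by (intro ennreal_leI order_trans[OF compact_C1_Poincare[OF c r r0]] mult_left_mono K) auto
      finally show "(LINT z|lborel. indicator (ball 0 (\<delta> j)) z * (\<phi> k (x + z))\<^sup>2) \<le> (2 * r + 1)\<^sup>2 * K"
        using K0 by (subst (asm) ennreal_le_iff) auto
    qed auto
    finally show ?thesis unfolding Pair M_def by (simp add: real_le_rsqrt)
  qed
  obtain \<sigma> where \<sigma>: "strict_mono (\<sigma> :: nat \<Rightarrow> nat)"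
    and conv: "\<And>p. p \<in> D \<times> UNIV \<Longrightarrow> \<exists>l. (\<lambda>k. case p of (x, j) \<Rightarrow> ball_integral (\<delta> j) (\<phi> (\<sigma> k)) x) \<longlonglongrightarrow> l"
    using function_convergent_subsequence[of "D \<times> (UNIV :: nat set)" "\<lambda>k p. case p of (x, j) \<Rightarrow> ball_integral (\<delta> j) (\<phi> k) x" M]
      bound D(1) by auto
  have "\<exists>N. \<forall>m\<ge>N. \<forall>n\<ge>N. (LINT x|lborel. (\<phi> (\<sigma> m) x - \<phi> (\<sigma> n) x)\<^sup>2) < \<epsilon>" if \<epsilon>: "\<epsilon> > 0" for \<epsilon>
  proof -
    have "(\<lambda>j. 2 * (\<delta> j)\<^sup>2 * (4 * K)) \<longlonglongrightarrow> 2 * 0\<^sup>2 * (4 * K)"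
      unfolding \<delta>_def by (intro tendsto_intros LIMSEQ_inverse_real_of_nat)
    then have "\<forall>\<^sub>F j in sequentially. 2 * (\<delta> j)\<^sup>2 * (4 * K) < \<epsilon> / 2"
      by (rule order_tendstoD(2)) (use \<epsilon> in simp)
    then obtain j where j: "2 * (\<delta> j)\<^sup>2 * (4 * K) < \<epsilon> / 2" by (auto simp: eventually_sequentially)
    define d where "d = \<delta> j"
    have d: "d > 0" by (simp add: d_def \<delta>_def)
    define V where "V = measure lborel (ball 0 d :: 'a set)"
    have V: "V > 0" unfolding V_def using content_ball_pos[OF d] by simp
    have W: "W \<ge> 0" unfolding W_def by simp
    \<comment> \<open>\<open>s\<close> is the accuracy needed for the ball integrals; half of it is spent on a finite set of centres,
      half on the distance \<open>\<rho>\<close> to the nearest of them\<close>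
    define s where "s = sqrt (\<epsilon> * V\<^sup>2 / (8 * (W + 1)))"
    have s: "s > 0" using \<epsilon> V W by (auto simp: s_def intro!: divide_pos_pos)
    have s2: "2 * s\<^sup>2 / V\<^sup>2 * W < \<epsilon> / 2"
    proof -
      have "s\<^sup>2 = \<epsilon> * V\<^sup>2 / (8 * (W + 1))" unfolding s_def using \<epsilon> V W by simp
      then have "2 * s\<^sup>2 / V\<^sup>2 * W = \<epsilon> / 4 * (W / (W + 1))" using V W by (simp add: field_simps)
      also have "\<dots> \<le> \<epsilon> / 4 * 1" using \<epsilon> W by (intro mult_left_mono) (auto simp: field_simps)
      also have "\<dots> < \<epsilon> / 2" using \<epsilon> by simp
      finally show ?thesis .
    qed
    define \<rho> where "\<rho> = s / (2 * sqrt (V * (4 * K) + 1))"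
    have sq1: "sqrt (V * (4 * K) + 1) > 0" using V K0 by (simp add: add_nonneg_pos)
    have \<rho>: "\<rho> > 0" using s sq1 unfolding \<rho>_def by simp
    have "compact (cball (0::'a) r)" by simp
    moreover have "cball (0::'a) r \<subseteq> (\<Union>y\<in>D. ball y \<rho>)"
    proof
      fix x :: 'a
      obtain y where "y \<in> D" "y \<in> ball x \<rho>" using D(2)[of "ball x \<rho>"] \<rho> by auto
      then show "x \<in> (\<Union>y\<in>D. ball y \<rho>)" by (auto simp: dist_commute)
    qed
    ultimately obtain F where F: "F \<subseteq> D" "finite F" "cball (0::'a) r \<subseteq> (\<Union>y\<in>F. ball y \<rho>)"
      using compactE_image[of "cball (0::'a) r" D "\<lambda>y. ball y \<rho>"] by auto
    have "\<exists>N. \<forall>m\<ge>N. \<forall>n\<ge>N. \<bar>ball_integral d (\<phi> (\<sigma> m)) y - ball_integral d (\<phi> (\<sigma> n)) y\<bar> < s / 2" if y: "y \<in> F" for y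
    proof -
      obtain l where "(\<lambda>k. ball_integral d (\<phi> (\<sigma> k)) y) \<longlonglongrightarrow> l"
        using conv[of "(y, j)"] y F(1) by (auto simp: d_def)
      then have "Cauchy (\<lambda>k. ball_integral d (\<phi> (\<sigma> k)) y)" by (rule LIMSEQ_imp_Cauchy)
      from CauchyD[OF this, of "s / 2"] s show ?thesis by auto
    qed
    then obtain N where N: "\<And>y m n. y \<in> F \<Longrightarrow> m \<ge> N y \<Longrightarrow> n \<ge> N y \<Longrightarrow> \<bar>ball_integral d (\<phi> (\<sigma> m)) y - ball_integral d (\<phi> (\<sigma> n)) y\<bar> < s / 2"
      by metis
    show ?thesis
    proof (intro exI[of _ "Max (insert 0 (N ` F))"] allI impI)
      fix m n assume m: "Max (insert 0 (N ` F)) \<le> m" and n: "Max (insert 0 (N ` F)) \<le> n"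
      define w where "w x = \<phi> (\<sigma> m) x - \<phi> (\<sigma> n) x" for x
      define k where "k x = g (\<sigma> m) x - g (\<sigma> n) x" for x
      have wk: "compact_C1 w k" unfolding w_def k_def by (intro compact_C1_diff c)
      have k4: "(LINT x|lborel. (norm (k x))\<^sup>2) \<le> 4 * K"
      proof -
        note i = compact_C1_integrable_products(4)
        have "(LINT x|lborel. (norm (k x))\<^sup>2) \<le> (LINT x|lborel. 2 * (norm (g (\<sigma> m) x))\<^sup>2 + 2 * (norm (g (\<sigma> n) x))\<^sup>2)"
        proof (rule integral_mono)
          show "(norm (k x))\<^sup>2 \<le> 2 * (norm (g (\<sigma> m) x))\<^sup>2 + 2 * (norm (g (\<sigma> n) x))\<^sup>2" for x
          proof -
            have "(norm (k x))\<^sup>2 \<le> (norm (g (\<sigma> m) x) + norm (g (\<sigma> n) x))\<^sup>2"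
              unfolding k_def by (intro power_mono norm_triangle_ineq4) auto
            then show ?thesis
              using zero_le_power2[of "norm (g (\<sigma> m) x) - norm (g (\<sigma> n) x)"]
              by (simp add: power2_eq_square algebra_simps)
          qed
        qed (use i[OF wk] i[OF c] in auto)
        also have "\<dots> = 2 * (LINT x|lborel. (norm (g (\<sigma> m) x))\<^sup>2) + 2 * (LINT x|lborel. (norm (g (\<sigma> n) x))\<^sup>2)"
          using i[OF c] by simp
        finally show ?thesis using K[of "\<sigma> m"] K[of "\<sigma> n"] by linarith
      qed
      have sm: "\<bar>ball_integral d w x\<bar> \<le> s" if x: "norm x \<le> r" for x
      proof -
        obtain y where y: "y \<in> F" "norm (x - y) < \<rho>"
          using subsetD[OF F(3), of x] x by (auto simp: dist_norm norm_minus_commute)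
        have "N y \<le> m" "N y \<le> n" using m n y(1) F(2) by (auto simp: Max_ge_iff intro: order_trans[rotated])
        then have 1: "\<bar>ball_integral d w y\<bar> < s / 2"
          using N[OF y(1)] ball_integral_diff[OF c c] unfolding w_def by auto
        have "(ball_integral d w x - ball_integral d w y)\<^sup>2 \<le> V * ((norm (x - y))\<^sup>2 * (4 * K))"
          unfolding V_def by (rule ball_integral_lipschitz[OF wk k4])
        also have "\<dots> \<le> V * (\<rho>\<^sup>2 * (4 * K))"
          using y V K0 by (intro mult_left_mono mult_right_mono power_mono) auto
        also have "\<dots> \<le> \<rho>\<^sup>2 * (V * (4 * K) + 1)" by (simp add: algebra_simps)
        also have "\<dots> = (\<rho> * sqrt (V * (4 * K) + 1))\<^sup>2" using V K0 by (simp add: power_mult_distrib)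
        also have "\<rho> * sqrt (V * (4 * K) + 1) = s / 2" unfolding \<rho>_def using sq1 by simp
        finally have "\<bar>ball_integral d w x - ball_integral d w y\<bar> \<le> s / 2" using s by (simp add: abs_le_square_iff[symmetric])
        with 1 show ?thesis by linarith
      qed
      have "(LINT x|lborel. (w x)\<^sup>2) \<le> 2 * d\<^sup>2 * (4 * K) + 2 * s\<^sup>2 / V\<^sup>2 * W"
        unfolding V_def W_def
        by (rule compact_C1_L2_le_ball_integrals[OF wk _ k4 d sm]) (auto simp: w_def r)
      also have "\<dots> < \<epsilon>" using j s2 unfolding d_def by linarith
      finally show "(LINT x|lborel. (\<phi> (\<sigma> m) x - \<phi> (\<sigma> n) x)\<^sup>2) < \<epsilon>" unfolding w_def .
    qed
  qed
  with \<sigma> show ?thesis using that by blast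
qed

section \<open>Power nonlinearities\<close>

lemma abs_powr_tendsto_0:
  assumes "r > 0"
  shows "((\<lambda>h::real. \<bar>h\<bar> powr r) \<longlongrightarrow> 0) (at 0)"
proof -
  have "((\<lambda>h::real. \<bar>h\<bar> powr r) \<longlongrightarrow> \<bar>0\<bar> powr r) (at 0)"
    using assms by (intro tendsto_powr' tendsto_intros) auto
  then show ?thesis using assms by simp
qed

lemma has_real_derivative_abs_powr:
  assumes r: "r > 0"
  shows "((\<lambda>t::real. \<bar>t\<bar> powr (r + 1)) has_real_derivative (r + 1) * (\<bar>t\<bar> powr (r - 1) * t)) (at t)"
proof -
  consider "t > 0" | "t < 0" | "t = 0" by linarith
  then show ?thesis
  proof cases
    case 1
    have "((\<lambda>t. t powr (r + 1)) has_real_derivative (r + 1) * (\<bar>t\<bar> powr (r - 1) * t)) (at t)"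
      using 1 by (auto intro!: derivative_eq_intros simp: powr_mult_base[symmetric] powr_diff)
    then show ?thesis
      by (rule has_field_derivative_transform_within_open[where S = "{0<..}"]) (use 1 in auto)
  next
    case 2
    have "((\<lambda>t. (- t) powr (r + 1)) has_real_derivative (r + 1) * (\<bar>t\<bar> powr (r - 1) * t)) (at t)"
      using 2 by (auto intro!: derivative_eq_intros simp: powr_diff)
    then show ?thesis
      by (rule has_field_derivative_transform_within_open[where S = "{..<0}"]) (use 2 in auto)
  next
    case 3
    from abs_powr_tendsto_0[OF r] have "((\<lambda>h. (\<bar>0 + h\<bar> powr (r + 1) - \<bar>0\<bar> powr (r + 1)) / h) \<longlongrightarrow> 0) (at 0)"
    proof (rule Lim_null_comparison[rotated])
      show "\<forall>\<^sub>F h in at 0. norm ((\<bar>0 + h\<bar> powr (r + 1) - \<bar>0\<bar> powr (r + 1)) / h) \<le> \<bar>h\<bar> powr r"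
        using r by (auto simp: eventually_at_filter powr_add)
    qed
    then show ?thesis using 3 by (simp add: DERIV_def)
  qed
qed

lemma continuous_abs_powr_times:
  assumes r: "r > 0"
  shows "continuous_on UNIV (\<lambda>t::real. \<bar>t\<bar> powr (r - 1) * t)"
proof -
  have "isCont (\<lambda>t::real. \<bar>t\<bar> powr (r - 1) * t) t" for t
  proof (cases "t = 0")
    case False
    then show ?thesis by (intro continuous_intros) auto
  next
    case True
    from abs_powr_tendsto_0[OF r] have "((\<lambda>h::real. \<bar>h\<bar> powr (r - 1) * h) \<longlongrightarrow> 0) (at 0)"
    proof (rule Lim_null_comparison[rotated])
      show "\<forall>\<^sub>F h::real in at 0. norm (\<bar>h\<bar> powr (r - 1) * h) \<le> \<bar>h\<bar> powr r"
        by (auto simp: eventually_at_filter powr_diff abs_mult)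
    qed
    then show ?thesis using True by (simp add: isCont_def)
  qed
  then show ?thesis by (simp add: continuous_on_eq_continuous_at)
qed

section \<open>Hoelder's inequality for finitely many factors\<close>

text \<open>Real powers of extended nonnegative reals. Exponent \<open>0\<close> gives \<open>1\<close> also at \<open>0\<close> and at \<open>\<infinity>\<close>, so
  that a factor of weight \<open>0\<close> drops out of Hoelder's inequality and the law for sums of nonnegative exponents holds.\<close>
definition epow :: "ennreal \<Rightarrow> real \<Rightarrow> ennreal" where
  "epow x a = (if a = 0 then 1 else if x = \<infinity> then \<infinity> else ennreal (enn2real x powr a))"

lemma epow_0 [simp]: "epow x 0 = 1" by (simp add: epow_def)
lemma epow_zero [simp]: "a \<noteq> 0 \<Longrightarrow> epow 0 a = 0" by (simp add: epow_def)
lemma epow_top [simp]: "a \<noteq> 0 \<Longrightarrow> epow top a = top" by (simp add: epow_def)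

lemma epow_ennreal: "0 \<le> y \<Longrightarrow> a \<noteq> 0 \<Longrightarrow> epow (ennreal y) a = ennreal (y powr a)"
  by (simp add: epow_def)

lemma epow_add: 
  assumes "0 \<le> a" "0 \<le> b" shows "epow x (a + b) = epow x a * epow x b"
proof -
  consider "a = 0" | "b = 0" | "a > 0" "b > 0" using assms by linarith
  then show ?thesis
  proof cases
    case 3
    then show ?thesis
      by (cases "x = \<infinity>") (simp_all add: epow_def powr_add ennreal_mult)
  qed (simp_all add: epow_def)
qed

lemma epow_mono: 
  assumes "0 \<le> a" "x \<le> y" shows "epow x a \<le> epow y a"
proof (cases "a = 0 \<or> y = \<infinity>")
  case False
  then have "x \<noteq> \<infinity>" "enn2real x \<le> enn2real y" using assms by (auto simp: top_unique less_top enn2real_mono)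
  then show ?thesis using False assms by (simp add: epow_def powr_mono2 ennreal_leI)
qed (auto simp: epow_def)

lemma measurable_epow [measurable]:
  "f \<in> borel_measurable M \<Longrightarrow> (\<lambda>x. epow (f x) a) \<in> borel_measurable M"
proof -
  assume f [measurable]: "f \<in> borel_measurable M"
  have [measurable]: "{x \<in> space M. f x = \<infinity>} \<in> sets M"
    using measurable_sets[OF f, of "{\<infinity>}"] by (simp add: vimage_def Int_def conj_commute)
  show ?thesis
  proof (cases "a = 0")
    case False
    then show ?thesis unfolding epow_def by simp
  qed simp
qed

lemma epow_eq_0_iff: "a > 0 \<Longrightarrow> epow x a = 0 \<longleftrightarrow> x = 0"
  by (cases "x = \<infinity>") (simp_all add: epow_def enn2real_eq_0_iff)

lemma weighted_arith_geo_mean: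
  fixes y w :: "'i \<Rightarrow> real"
  assumes I: "finite I" and w: "\<And>i. i \<in> I \<Longrightarrow> 0 < w i" "(\<Sum>i\<in>I. w i) = 1" and y: "\<And>i. i \<in> I \<Longrightarrow> 0 \<le> y i"
  shows "(\<Prod>i\<in>I. y i powr w i) \<le> (\<Sum>i\<in>I. w i * y i)"
proof (cases "\<exists>i\<in>I. y i = 0")
  case True
  then have "(\<Prod>i\<in>I. y i powr w i) = 0" using I by (auto intro: prod_zero)
  then show ?thesis using w(1) y by (auto intro!: sum_nonneg mult_nonneg_nonneg simp: less_imp_le)
next
  case False
  then have y: "y i > 0" if "i \<in> I" for i using y[OF that] that by (auto simp: less_le)
  have "I \<noteq> {}" using w(2) by auto
  have "(\<Prod>i\<in>I. y i powr w i) = exp (\<Sum>i\<in>I. w i *\<^sub>R ln (y i))"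
    using I y by (force simp: exp_sum powr_def intro!: prod.cong)
  also have "\<dots> \<le> (\<Sum>i\<in>I. w i * exp (ln (y i)))"
    by (rule convex_on_sum[OF I \<open>I \<noteq> {}\<close> exp_convex w(2)]) (use w(1) in \<open>auto simp: less_imp_le\<close>)
  also have "\<dots> = (\<Sum>i\<in>I. w i * y i)" using y by (auto intro!: sum.cong)
  finally show ?thesis .
qed

text \<open>After division by the norms, the inequality between weighted geometric and arithmetic means holds pointwise
  and integrates to \<open>1\<close>. The cases of a vanishing or an infinite norm are separate.\<close>

lemma nn_integral_Hoelder_pos:
  fixes F :: "'i \<Rightarrow> 'x \<Rightarrow> ennreal"
  assumes I: "finite I" and w: "\<And>i. i \<in> I \<Longrightarrow> 0 < w i" "(\<Sum>i\<in>I. w i) = 1"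
    and F [measurable]: "\<And>i. i \<in> I \<Longrightarrow> F i \<in> borel_measurable M"
  shows "(\<integral>\<^sup>+x. (\<Prod>i\<in>I. epow (F i x) (w i)) \<partial>M) \<le> (\<Prod>i\<in>I. epow (\<integral>\<^sup>+x. F i x \<partial>M) (w i))"
proof -
  define C where "C i = (\<integral>\<^sup>+x. F i x \<partial>M)" for i
  consider (zero) i where "i \<in> I" "C i = 0" | (top) i where "\<forall>i\<in>I. C i \<noteq> 0" "i \<in> I" "C i = \<infinity>"
    | (fin) "\<forall>i\<in>I. C i \<noteq> 0 \<and> C i \<noteq> \<infinity>" by blast
  then show ?thesis
  proof cases
    case zero
    then have "AE x in M. F i x = 0" using F by (simp add: C_def nn_integral_0_iff_AE)
    then have "AE x in M. (\<Prod>i\<in>I. epow (F i x) (w i)) = 0"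
    proof eventually_elim
      case (elim x)
      have "epow (F i x) (w i) = 0" using elim w(1)[OF zero(1)] by simp
      then show ?case using I zero(1) by (meson prod_zero)
    qed
    then have "(\<integral>\<^sup>+x. (\<Prod>i\<in>I. epow (F i x) (w i)) \<partial>M) = (\<integral>\<^sup>+x. 0 \<partial>M)" by (rule nn_integral_cong_AE)
    then show ?thesis by simp
  next
    case top
    have "(\<Prod>j\<in>I. epow (C j) (w j)) = epow (C i) (w i) * (\<Prod>j\<in>I - {i}. epow (C j) (w j))"
      using I top by (simp add: prod.remove)
    moreover have "(\<Prod>j\<in>I - {i}. epow (C j) (w j)) \<noteq> 0"
      using top(1) w(1) I by (auto simp: epow_eq_0_iff)
    ultimately have "(\<Prod>j\<in>I. epow (C j) (w j)) = \<infinity>"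
      using top w(1)[of i] by (simp add: ennreal_top_mult)
    then show ?thesis by (simp add: C_def)
  next
    case fin
    define c where "c i = enn2real (C i)" for i
    have c: "c i > 0" "C i = ennreal (c i)" if "i \<in> I" for i
      using fin that by (auto simp: c_def less_top enn2real_positive_iff zero_less_iff_neq_zero)
    define P where "P = (\<Prod>i\<in>I. c i powr w i)"
    have P: "P > 0" unfolding P_def using c by (intro prod_pos) force
    have pt: "(\<Prod>i\<in>I. epow (F i x) (w i)) \<le> ennreal P * (\<Sum>i\<in>I. ennreal (w i / c i) * F i x)" for x
    proof (cases "\<exists>i\<in>I. F i x = \<infinity>")
      case True
      then obtain i where i: "i \<in> I" "F i x = \<infinity>" by blast
      have "ennreal (w i / c i) * F i x = \<infinity>" using i w(1)[of i] c(1)[of i] by (simp add: ennreal_mult_top)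
      then have "(\<Sum>i\<in>I. ennreal (w i / c i) * F i x) = \<infinity>"
        using i(1) I by (simp add: sum.remove)
      then show ?thesis using P by (simp add: ennreal_mult_top)
    next
      case False
      define f where "f i = enn2real (F i x)" for i
      have f: "F i x = ennreal (f i)" "0 \<le> f i" if "i \<in> I" for i
        using False that by (auto simp: f_def less_top)
      have "(\<Prod>i\<in>I. epow (F i x) (w i)) = (\<Prod>i\<in>I. ennreal (f i powr w i))"
        using f w(1) by (intro prod.cong refl) (force simp: epow_ennreal)
      also have "\<dots> = ennreal (\<Prod>i\<in>I. f i powr w i)" by (rule prod_ennreal) simp
      also have "(\<Prod>i\<in>I. f i powr w i) = P * (\<Prod>i\<in>I. (f i / c i) powr w i)"
        unfolding P_def prod.distrib[symmetric]
      proof (rule prod.cong[OF refl])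
        fix i assume "i \<in> I"
        then show "f i powr w i = c i powr w i * (f i / c i) powr w i"
          using c(1)[of i] f(2)[of i] by (simp add: powr_mult[symmetric])
      qed
      also have "ennreal \<dots> \<le> ennreal (P * (\<Sum>i\<in>I. w i * (f i / c i)))"
        using P c f w I by (intro ennreal_leI mult_left_mono weighted_arith_geo_mean) (auto simp: less_imp_le)
      also have "\<dots> = ennreal P * (\<Sum>i\<in>I. ennreal (w i * (f i / c i)))"
        using P c f w by (subst ennreal_mult') (auto intro!: sum_nonneg simp: sum_ennreal less_imp_le)
      also have "(\<Sum>i\<in>I. ennreal (w i * (f i / c i))) = (\<Sum>i\<in>I. ennreal (w i / c i) * F i x)"
      proof (rule sum.cong[OF refl])
        fix i assume i: "i \<in> I"
        have "0 \<le> w i / c i" using w(1)[OF i] c(1)[OF i] by simp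
        then show "ennreal (w i * (f i / c i)) = ennreal (w i / c i) * F i x"
          unfolding f(1)[OF i] by (subst ennreal_mult'[symmetric]) auto
      qed
      finally show ?thesis .
    qed
    have "(\<integral>\<^sup>+x. (\<Prod>i\<in>I. epow (F i x) (w i)) \<partial>M) \<le> (\<integral>\<^sup>+x. ennreal P * (\<Sum>i\<in>I. ennreal (w i / c i) * F i x) \<partial>M)"
      by (intro nn_integral_mono pt)
    also have "\<dots> = ennreal P * (\<Sum>i\<in>I. ennreal (w i / c i) * C i)"
      using F by (simp add: nn_integral_cmult nn_integral_sum C_def)
    also have "(\<Sum>i\<in>I. ennreal (w i / c i) * C i) = (\<Sum>i\<in>I. ennreal (w i))"
    proof (rule sum.cong[OF refl])
      fix i assume i: "i \<in> I"
      show "ennreal (w i / c i) * C i = ennreal (w i)"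
        unfolding c(2)[OF i] using w(1)[OF i] c(1)[OF i] by (subst ennreal_mult'[symmetric]) auto
    qed
    also have "\<dots> = 1" using w by (subst sum_ennreal) (auto simp: less_imp_le)
    also have "ennreal P * 1 = (\<Prod>i\<in>I. epow (C i) (w i))"
      unfolding P_def by (subst mult_1_right, subst prod_ennreal[symmetric])
        (use c w(1) in \<open>force simp: epow_ennreal intro!: prod.cong\<close>)+
    finally show ?thesis unfolding C_def .
  qed
qed

lemma nn_integral_Hoelder:
  fixes F :: "'i \<Rightarrow> 'x \<Rightarrow> ennreal"
  assumes I: "finite I" and w: "\<And>i. i \<in> I \<Longrightarrow> 0 \<le> w i" "(\<Sum>i\<in>I. w i) = 1"
    and F: "\<And>i. i \<in> I \<Longrightarrow> F i \<in> borel_measurable M"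
  shows "(\<integral>\<^sup>+x. (\<Prod>i\<in>I. epow (F i x) (w i)) \<partial>M) \<le> (\<Prod>i\<in>I. epow (\<integral>\<^sup>+x. F i x \<partial>M) (w i))"
proof -
  define J where "J = {i\<in>I. w i > 0}"
  have J: "J \<subseteq> I" "finite J" "\<And>i. i \<in> I - J \<Longrightarrow> w i = 0" using I w(1) by (auto simp: J_def less_le)
  have e: "(\<Prod>i\<in>I. epow (G i) (w i)) = (\<Prod>i\<in>J. epow (G i) (w i))" for G
    using J by (intro prod.mono_neutral_right I) auto
  have w1: "(\<Sum>i\<in>J. w i) = 1" using sum.mono_neutral_right[OF I J(1), of w] J(3) w(2) by simp
  have "(\<integral>\<^sup>+x. (\<Prod>i\<in>J. epow (F i x) (w i)) \<partial>M) \<le> (\<Prod>i\<in>J. epow (\<integral>\<^sup>+x. F i x \<partial>M) (w i))"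
    by (rule nn_integral_Hoelder_pos[OF J(2) _ w1]) (use F J(1) in \<open>auto simp: J_def\<close>)
  then show ?thesis by (simp only: e)
qed

section \<open>The Gagliardo-Nirenberg-Sobolev inequality\<close>

text \<open>Integrals over the lines of direction \<open>e\<close>, as functions on the whole space that are constant on these
  lines. Keeping the space fixed makes marginals in different directions commute and compose freely.\<close>
definition marg :: "'a::euclidean_space \<Rightarrow> ('a \<Rightarrow> ennreal) \<Rightarrow> 'a \<Rightarrow> ennreal" where
  "marg e F x = (\<integral>\<^sup>+t. F (x + t *\<^sub>R e) \<partial>lborel)"

primrec margs :: "'a::euclidean_space list \<Rightarrow> ('a \<Rightarrow> ennreal) \<Rightarrow> 'a \<Rightarrow> ennreal" where
  "margs [] F = F"
| "margs (e # es) F = margs es (marg e F)"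

lemma measurable_marg [measurable]:
  assumes F: "F \<in> borel_measurable borel"
  shows "marg e F \<in> borel_measurable borel"
proof -
  have "(\<lambda>p. fst p + snd p *\<^sub>R e) \<in> borel \<Otimes>\<^sub>M (lborel :: real measure) \<rightarrow>\<^sub>M borel"
    by measurable
  from measurable_compose[OF this F]
  have "(\<lambda>(x, t). F (x + t *\<^sub>R e)) \<in> borel_measurable (borel \<Otimes>\<^sub>M lborel)"
    by (simp add: case_prod_unfold)
  then have "(\<lambda>x. \<integral>\<^sup>+t. F (x + t *\<^sub>R e) \<partial>lborel) \<in> borel_measurable borel"
    by (rule lborel.borel_measurable_nn_integral)
  then show ?thesis by (simp add: marg_def[abs_def])
qed

lemma marg_mono: "(\<And>x. F x \<le> G x) \<Longrightarrow> marg e F x \<le> marg e G x"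
  unfolding marg_def by (rule nn_integral_mono)

lemma margs_mono: "(\<And>x. F x \<le> G x) \<Longrightarrow> margs es F x \<le> margs es G x"
proof (induction es arbitrary: F G x)
  case (Cons e es)
  then show ?case unfolding margs.simps by (intro Cons.IH marg_mono)
qed simp

lemma marg_shift:
  assumes [measurable]: "F \<in> borel_measurable borel"
  shows "marg e F (x + s *\<^sub>R e) = marg e F x"
proof -
  have "marg e F (x + s *\<^sub>R e) = (\<integral>\<^sup>+t. F (x + (t + s) *\<^sub>R e) \<partial>lborel)"
    unfolding marg_def scaleR_add_left by (simp add: add_ac)
  also have "\<dots> = marg e F x"
    unfolding marg_def by (rule nn_integral_lborel_shift[of "\<lambda>t. F (x + t *\<^sub>R e)" s]) measurable
  finally show ?thesis .
qed

lemma marg_commute: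
  assumes [measurable]: "F \<in> borel_measurable borel"
  shows "marg e (marg e' F) = marg e' (marg e F)"
proof
  fix x
  have "marg e (marg e' F) x = (\<integral>\<^sup>+t. \<integral>\<^sup>+s. F (x + t *\<^sub>R e + s *\<^sub>R e') \<partial>lborel \<partial>lborel)"
    by (simp add: marg_def)
  also have "\<dots> = (\<integral>\<^sup>+s. \<integral>\<^sup>+t. F (x + t *\<^sub>R e + s *\<^sub>R e') \<partial>lborel \<partial>lborel)"
    by (rule nn_integral_lborel_Fubini) measurable
  also have "\<dots> = marg e' (marg e F) x" by (simp add: marg_def algebra_simps)
  finally show "marg e (marg e' F) x = marg e' (marg e F) x" .
qed

lemma margs_eq_PiM_integral:
  fixes F :: "'a::euclidean_space \<Rightarrow> ennreal"
  assumes "F \<in> borel_measurable borel" "distinct es"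
  shows "margs es F x = (\<integral>\<^sup>+\<omega>. F (x + (\<Sum>b\<in>set es. \<omega> b *\<^sub>R b)) \<partial>PiM (set es) (\<lambda>_. lborel))"
  using assms
proof (induction es arbitrary: F)
  case Nil
  interpret product_sigma_finite "\<lambda>_::'a. lborel :: real measure" ..
  show ?case using nn_integral_empty[of "\<lambda>_. F x"] by simp
next
  case (Cons e s)
  interpret product_sigma_finite "\<lambda>_::'a. lborel :: real measure" ..
  note [measurable] = Cons.prems(1)
  have "(\<integral>\<^sup>+\<omega>. F (x + (\<Sum>b\<in>insert e (set s). \<omega> b *\<^sub>R b)) \<partial>PiM (insert e (set s)) (\<lambda>_. lborel))
    = (\<integral>\<^sup>+\<omega>. (\<integral>\<^sup>+t. F (x + (\<Sum>b\<in>insert e (set s). fun_upd \<omega> e t b *\<^sub>R b)) \<partial>lborel) \<partial>PiM (set s) (\<lambda>_. lborel))"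
    by (rule product_nn_integral_insert) (use Cons.prems in auto)
  also have "\<dots> = (\<integral>\<^sup>+\<omega>. marg e F (x + (\<Sum>b\<in>set s. \<omega> b *\<^sub>R b)) \<partial>PiM (set s) (\<lambda>_. lborel))"
  proof (rule nn_integral_cong)
    fix \<omega> :: "'a \<Rightarrow> real"
    have "(\<Sum>b\<in>insert e (set s). fun_upd \<omega> e t b *\<^sub>R b) = t *\<^sub>R e + (\<Sum>b\<in>set s. \<omega> b *\<^sub>R b)" for t
    proof -
      have "(\<Sum>b\<in>set s. fun_upd \<omega> e t b *\<^sub>R b) = (\<Sum>b\<in>set s. \<omega> b *\<^sub>R b)"
        using Cons.prems by (intro sum.cong) auto
      then show ?thesis using Cons.prems by simp
    qed
    then show "(\<integral>\<^sup>+t. F (x + (\<Sum>b\<in>insert e (set s). fun_upd \<omega> e t b *\<^sub>R b)) \<partial>lborel) = marg e F (x + (\<Sum>b\<in>set s. \<omega> b *\<^sub>R b))"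
      by (simp add: marg_def algebra_simps)
  qed
  also have "\<dots> = margs s (marg e F) x"
    using Cons.IH[of "marg e F"] Cons.prems by simp
  finally show ?case by simp
qed

lemma margs_Basis:
  fixes F :: "'a::euclidean_space \<Rightarrow> ennreal"
  assumes F [measurable]: "F \<in> borel_measurable borel" and "distinct es" "set es = (Basis :: 'a set)"
  shows "margs es F 0 = (\<integral>\<^sup>+x. F x \<partial>lborel)"
proof -
  have "(\<integral>\<^sup>+x. F x \<partial>lborel) =
      (\<integral>\<^sup>+x. F x \<partial>distr (PiM Basis (\<lambda>_. lborel)) borel (\<lambda>f. \<Sum>b\<in>Basis. f b *\<^sub>R b))"
    by (simp only: lborel_eq[symmetric])
  also have "\<dots> = (\<integral>\<^sup>+\<omega>. F (\<Sum>b\<in>Basis. \<omega> b *\<^sub>R b) \<partial>PiM Basis (\<lambda>_. lborel))"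
    by (rule nn_integral_distr) measurable
  also have "\<dots> = margs es F 0"
    using margs_eq_PiM_integral[OF assms(1,2), of 0] unfolding assms(3) by simp
  finally show ?thesis by simp
qed

text \<open>One variable \<open>e\<close> is integrated out at a time. The factor \<open>marg e F\<close> does not depend on it, and
  Hoelder's inequality for the other factors turns the integrand for \<open>F\<close> into the
  integrand for \<open>marg e F\<close> over the remaining directions.\<close>

lemma margs_prod_marg_le:
  fixes F :: "'a::euclidean_space \<Rightarrow> ennreal"
  assumes "F \<in> borel_measurable borel" "distinct es" and p: "p \<ge> 0" and "(real (length es) - 1) * p \<le> 1"
  shows "margs es (\<lambda>x. epow (F x) (1 - (real (length es) - 1) * p) * (\<Prod>e\<in>set es. epow (marg e F x) p)) x
    \<le> epow (margs es F x) (1 + p)"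
  using assms(1,2,4)
proof (induction es arbitrary: F)
  case Nil
  show ?case by simp
next
  case (Cons e s)
  note [measurable] = Cons.prems(1)
  have e: "e \<notin> set s" "distinct s" using Cons.prems by auto
  define q where "q = 1 - real (length s) * p"
  have q: "q \<ge> 0" using Cons.prems by (simp add: q_def)
  have step: "marg e (\<lambda>x. epow (F x) q * (\<Prod>j\<in>set (e # s). epow (marg j F x) p)) x
     \<le> epow (marg e F x) (1 - (real (length s) - 1) * p) * (\<Prod>j\<in>set s. epow (marg j (marg e F) x) p)" for x
  proof -
    define G where "G j = (if j = e then F else marg j F)" for j
    define w where "w j = (if j = e then q else p)" for j
    have ws: "(\<Sum>j\<in>insert e (set s). w j) = 1"
    proof -
      have "(\<Sum>j\<in>set s. w j) = (\<Sum>j\<in>set s. p)" using e by (intro sum.cong) (auto simp: w_def)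
      then show ?thesis using e by (simp add: w_def q_def distinct_card)
    qed
    have Gm [measurable]: "G j \<in> borel_measurable borel" for j by (simp add: G_def)
    have prodG: "(\<Prod>j\<in>insert e (set s). epow (H (G j)) (w j)) = epow (H F) q * (\<Prod>j\<in>set s. epow (H (marg j F)) p)" for H
    proof -
      have "(\<Prod>j\<in>set s. epow (H (G j)) (w j)) = (\<Prod>j\<in>set s. epow (H (marg j F)) p)"
        using e by (intro prod.cong) (auto simp: w_def G_def)
      then show ?thesis using e by (simp add: w_def G_def)
    qed
    have "marg e (\<lambda>x. epow (F x) q * (\<Prod>j\<in>set (e # s). epow (marg j F x) p)) x
      = (\<integral>\<^sup>+t. epow (marg e F x) p * (\<Prod>j\<in>insert e (set s). epow (G j (x + t *\<^sub>R e)) (w j)) \<partial>lborel)"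
      unfolding marg_def[of e "\<lambda>x. _ x * _ x"] prodG[of "\<lambda>f. f (x + _ *\<^sub>R e)"]
      using e by (simp add: marg_shift mult_ac)
    also have "\<dots> = epow (marg e F x) p * (\<integral>\<^sup>+t. (\<Prod>j\<in>insert e (set s). epow (G j (x + t *\<^sub>R e)) (w j)) \<partial>lborel)"
      by (rule nn_integral_cmult) measurable
    also have "\<dots> \<le> epow (marg e F x) p * (\<Prod>j\<in>insert e (set s). epow (\<integral>\<^sup>+t. G j (x + t *\<^sub>R e) \<partial>lborel) (w j))"
      by (intro mult_left_mono nn_integral_Hoelder ws) (use p q in \<open>auto simp: w_def\<close>)
    also have "\<dots> = epow (marg e F x) p * (epow (marg e F x) q * (\<Prod>j\<in>set s. epow (marg e (marg j F) x) p))"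
      unfolding prodG[of "\<lambda>f. \<integral>\<^sup>+t. f (x + t *\<^sub>R e) \<partial>lborel"] marg_def[of e] ..
    also have "\<dots> = epow (marg e F x) (p + q) * (\<Prod>j\<in>set s. epow (marg j (marg e F) x) p)"
      using p q by (simp add: epow_add mult.assoc marg_commute[of F e])
    finally show ?thesis by (simp add: q_def algebra_simps)
  qed
  have "margs (e # s) (\<lambda>x. epow (F x) (1 - (real (length (e # s)) - 1) * p) * (\<Prod>e\<in>set (e # s). epow (marg e F x) p)) x
    \<le> margs s (\<lambda>x. epow (marg e F x) (1 - (real (length s) - 1) * p) * (\<Prod>j\<in>set s. epow (marg j (marg e F) x) p)) x"
    unfolding margs.simps using step by (intro margs_mono) (simp add: q_def)
  also have "\<dots> \<le> epow (margs s (marg e F) x) (1 + p)"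
    using Cons.prems p by (intro Cons.IH) (auto simp: algebra_simps)
  finally show ?case by simp
qed

text \<open>With \<open>p = 1 / (n - 1)\<close> the power of \<open>F\<close> itself has exponent \<open>0\<close> once all \<open>n\<close> directions are
  integrated out, and only the marginals remain.\<close>

lemma Gagliardo:
  fixes F :: "'a::euclidean_space \<Rightarrow> ennreal"
  assumes F: "F \<in> borel_measurable borel" and n: "DIM('a) \<ge> 2"
  defines "p \<equiv> 1 / (real DIM('a) - 1)"
  shows "(\<integral>\<^sup>+x. (\<Prod>e\<in>Basis. epow (marg e F x) p) \<partial>lborel) \<le> epow (\<integral>\<^sup>+x. F x \<partial>lborel) (1 + p)"
proof -
  obtain es where es: "set es = (Basis :: 'a set)" "distinct es"
    using finite_distinct_list[of "Basis :: 'a set", OF finite_Basis] by (elim exE conjE)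
  have len: "length es = DIM('a)" using distinct_card[OF es(2)] unfolding es(1) by simp
  have p: "p \<ge> 0" "(real (length es) - 1) * p = 1" using n unfolding p_def len by simp_all
  note [measurable] = F
  have "(\<integral>\<^sup>+x. (\<Prod>e\<in>Basis. epow (marg e F x) p) \<partial>lborel) = margs es (\<lambda>x. \<Prod>e\<in>Basis. epow (marg e F x) p) 0"
    by (rule margs_Basis[OF _ es(2,1), symmetric]) measurable
  also have "\<dots> \<le> epow (margs es F 0) (1 + p)"
    using margs_prod_marg_le[OF F es(2) p(1), of 0] unfolding p(2) es(1) by simp
  also have "margs es F 0 = (\<integral>\<^sup>+x. F x \<partial>lborel)"
    by (rule margs_Basis[OF F es(2,1)])
  finally show ?thesis .
qed

lemma prod_mono_ennreal:
  fixes f h :: "'i \<Rightarrow> ennreal"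
  assumes "\<And>i. i \<in> I \<Longrightarrow> f i \<le> h i"
  shows "prod f I \<le> prod h I"
  using assms by (induction I rule: infinite_finite_induct) (auto intro: mult_mono)

text \<open>The fundamental theorem of calculus on the half-line from \<open>x\<close> in direction \<open>e\<close>, along which
  \<open>\<phi>\<close> eventually vanishes.\<close>

lemma abs_powr_le_marg:
  fixes \<phi> :: "'a::euclidean_space \<Rightarrow> real"
  assumes c: "compact_C1 \<phi> g" and e: "e \<in> Basis" and s: "s > 0"
  shows "ennreal (\<bar>\<phi> x\<bar> powr (s + 1)) \<le> marg e (\<lambda>y. ennreal ((s + 1) * \<bar>\<phi> y\<bar> powr s * norm (g y))) x"
proof -
  obtain r where r: "\<And>x. norm x > r \<Longrightarrow> \<phi> x = 0" using c by (auto simp: compact_C1_def)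
  define T where "T = \<bar>r\<bar> + norm x + 1"
  have T: "T \<ge> 0" by (simp add: T_def)
  have "norm (T *\<^sub>R e) = T" using e T by simp
  then have "norm (T *\<^sub>R e + x) \<ge> T - norm x" using norm_diff_ineq[of "T *\<^sub>R e" x] by linarith
  then have "norm (x + T *\<^sub>R e) > r" unfolding T_def by (simp add: add.commute)
  then have end0: "\<phi> (x + T *\<^sub>R e) = 0" by (rule r)
  have gc: "continuous_on UNIV g" using c by (auto simp: compact_C1_def)
  define f where "f t = (s + 1) * (\<bar>\<phi> (x + t *\<^sub>R e)\<bar> powr (s - 1) * \<phi> (x + t *\<^sub>R e)) * (g (x + t *\<^sub>R e) \<bullet> e)" for t
  have fc: "continuous_on UNIV f" unfolding f_def
    by (intro continuous_intros continuous_on_compose2[OF gc]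
        continuous_on_compose2[OF continuous_abs_powr_times[OF s]] continuous_on_compose2[OF compact_C1_continuous[OF c]]) auto
  have der: "((\<lambda>t. \<bar>\<phi> (x + t *\<^sub>R e)\<bar> powr (s + 1)) has_real_derivative f t) (at t)" for t
  proof -
    have "((\<lambda>t. \<phi> (x + t *\<^sub>R e)) has_real_derivative (g (x + t *\<^sub>R e) \<bullet> e)) (at t)"
      by (rule compact_C1_line_derivative[OF c])
    from DERIV_chain2[OF has_real_derivative_abs_powr[OF s] this]
    show ?thesis unfolding f_def by simp
  qed
  have ftc: "has_bochner_integral lborel (\<lambda>t. f t * indicator {0..T} t) (- (\<bar>\<phi> x\<bar> powr (s + 1)))"
    using has_bochner_integral_FTC_Icc_real[of 0 T "\<lambda>t. \<bar>\<phi> (x + t *\<^sub>R e)\<bar> powr (s + 1)" f] der fc T s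
    by (simp add: end0 continuous_on_eq_continuous_at)
  then have i: "integrable lborel (\<lambda>t. f t * indicator {0..T} t)" and v: "(LINT t|lborel. f t * indicator {0..T} t) = - (\<bar>\<phi> x\<bar> powr (s + 1))"
    by (auto simp: has_bochner_integral_iff)
  have "ennreal (\<bar>\<phi> x\<bar> powr (s + 1)) = ennreal (norm (LINT t|lborel. f t * indicator {0..T} t))"
    unfolding v by simp
  also have "\<dots> \<le> (\<integral>\<^sup>+t. norm (f t * indicator {0..T} t) \<partial>lborel)"
    by (rule integral_norm_bound_ennreal[OF i])
  also have "\<dots> \<le> (\<integral>\<^sup>+t. ennreal ((s + 1) * \<bar>\<phi> (x + t *\<^sub>R e)\<bar> powr s * norm (g (x + t *\<^sub>R e))) \<partial>lborel)"
  proof (intro nn_integral_mono ennreal_leI)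
    fix t
    let ?y = "x + t *\<^sub>R e"
    have "norm (f t * indicator {0..T} t) \<le> \<bar>f t\<bar>" by (simp add: indicator_def)
    also have "\<bar>f t\<bar> = (s + 1) * \<bar>\<phi> ?y\<bar> powr s * \<bar>g ?y \<bullet> e\<bar>"
      using s by (auto simp: f_def abs_mult powr_diff)
    also have "\<dots> \<le> (s + 1) * \<bar>\<phi> ?y\<bar> powr s * norm (g ?y)"
      using s e by (intro mult_left_mono Basis_le_norm) auto
    finally show "norm (f t * indicator {0..T} t) \<le> (s + 1) * \<bar>\<phi> ?y\<bar> powr s * norm (g ?y)" .
  qed
  finally show ?thesis unfolding marg_def .
qed

text \<open>Gagliardo's inequality is applied to the power \<open>s + 1 = \<gamma>\<close> of \<open>\<bar>\<phi>\<bar>\<close>. The exponent is chosen such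
  that both the left-hand side and, after the Cauchy-Schwarz inequality, the power \<open>2 s\<close> on the right-hand side
  are the critical power. Since the integral \<open>X\<close> of the critical power is finite, its smaller power on the
  right-hand side can be divided out.\<close>
theorem Sobolev_inequality:
  fixes \<phi> :: "'a::euclidean_space \<Rightarrow> real"
  assumes c: "compact_C1 \<phi> g" and n: "DIM('a) \<ge> 3"
  defines "P \<equiv> 2 * real DIM('a) / (real DIM('a) - 2)" and "\<gamma> \<equiv> 2 * (real DIM('a) - 1) / (real DIM('a) - 2)"
  shows "integrable lborel (\<lambda>x. \<bar>\<phi> x\<bar> powr P)"
    and "(LINT x|lborel. \<bar>\<phi> x\<bar> powr P) \<le> (\<gamma>\<^sup>2 * (LINT x|lborel. (norm (g x))\<^sup>2)) powr (P / 2)"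
proof -
  define N where "N = real DIM('a)"
  have N: "N \<ge> 3" using n by (simp add: N_def)
  define s where "s = N / (N - 2)"
  define p where "p = 1 / (N - 1)"
  have s: "s > 0" and p: "p > 0" using N by (auto simp: s_def p_def)
  have PN: "P = 2 * N / (N - 2)" unfolding P_def N_def ..
  have \<gamma>N: "\<gamma> = 2 * (N - 1) / (N - 2)" unfolding \<gamma>_def N_def ..
  have \<gamma>: "\<gamma> = s + 1" using N unfolding \<gamma>N s_def by (simp add: divide_simps)
  have P: "P = 2 * s" "P > 0" using N unfolding PN s_def by simp_all
  have [measurable]: "\<phi> \<in> borel_measurable borel" "g \<in> borel_measurable borel" using compact_C1_borel[OF c] by auto
  obtain r where r: "\<And>x. norm x > r \<Longrightarrow> \<phi> x = 0" using c by (auto simp: compact_C1_def)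
  obtain B where B: "B > 0" "\<And>x. \<bar>\<phi> x\<bar> \<le> B" "\<And>x. norm (g x) \<le> B" using compact_C1_bounded[OF c] by blast
  show ip: "integrable lborel (\<lambda>x. \<bar>\<phi> x\<bar> powr P)"
    by (rule integrable_bounded_support[where B = "B powr P" and r = r])
      (use B r P in \<open>auto intro!: powr_mono2\<close>)
  define X G Y where "X = (LINT x|lborel. \<bar>\<phi> x\<bar> powr P)" and "G = (LINT x|lborel. (norm (g x))\<^sup>2)"
    and "Y = \<gamma>\<^sup>2 * G"
  have X0: "X \<ge> 0" and G0: "G \<ge> 0" by (simp_all add: X_def G_def)
  define F where "F y = ennreal ((s + 1) * \<bar>\<phi> y\<bar> powr s * norm (g y))" for y
  have Fm: "F \<in> borel_measurable borel" unfolding F_def by measurable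
  have sq: "(\<bar>\<phi> x\<bar> powr s)\<^sup>2 = \<bar>\<phi> x\<bar> powr P" for x
    by (simp add: P(1) power2_eq_square flip: powr_add)
  have CS: "integrable lborel (\<lambda>x. \<bar>\<phi> x\<bar> powr s * norm (g x))"
    "(LINT x|lborel. \<bar>\<phi> x\<bar> powr s * norm (g x))\<^sup>2 \<le> X * G"
    using integral_Cauchy_Schwarz[of "\<lambda>x. \<bar>\<phi> x\<bar> powr s" lborel "\<lambda>x. norm (g x)"]
      compact_C1_integrable_products(4)[OF c] ip
    by (simp_all add: sq X_def G_def)
  define A where "A = (s + 1) * (LINT x|lborel. \<bar>\<phi> x\<bar> powr s * norm (g x))"
  have A0: "A \<ge> 0" using s by (simp add: A_def)
  have A2: "A\<^sup>2 \<le> Y * X"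
    using mult_left_mono[OF CS(2), of "(s + 1)\<^sup>2"] by (simp add: A_def Y_def \<gamma> power_mult_distrib mult_ac)
  have FA: "(\<integral>\<^sup>+x. F x \<partial>lborel) = ennreal A"
    unfolding F_def A_def using CS(1) s
    by (subst nn_integral_eq_integral) (auto simp: mult.assoc)
  have pt: "ennreal (\<bar>\<phi> x\<bar> powr P) \<le> (\<Prod>e\<in>Basis. epow (marg e F x) p)" for x
  proof -
    have "ennreal (\<bar>\<phi> x\<bar> powr P) = (\<Prod>e\<in>(Basis :: 'a set). ennreal (\<bar>\<phi> x\<bar> powr ((s + 1) * p)))"
    proof -
      have "(s + 1) * p * N = P"
        using N unfolding s_def p_def PN by (simp add: divide_simps)
      then have "(\<bar>\<phi> x\<bar> powr ((s + 1) * p)) ^ DIM('a) = \<bar>\<phi> x\<bar> powr P"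
        using n by (cases "\<phi> x = 0") (simp_all add: N_def powr_powr flip: powr_realpow)
      then show ?thesis by (simp add: ennreal_power)
    qed
    also have "\<dots> = (\<Prod>e\<in>(Basis :: 'a set). epow (ennreal (\<bar>\<phi> x\<bar> powr (s + 1))) p)"
      using p by (simp add: epow_ennreal powr_powr)
    also have "\<dots> \<le> (\<Prod>e\<in>Basis. epow (marg e F x) p)"
    proof -
      have "epow (ennreal (\<bar>\<phi> x\<bar> powr (s + 1))) p \<le> epow (marg e F x) p" if "e \<in> Basis" for e
        using abs_powr_le_marg[OF c that s] p unfolding F_def by (intro epow_mono) auto
      then show ?thesis by (rule prod_mono_ennreal)
    qed
    finally show ?thesis .
  qed
  have "ennreal X = (\<integral>\<^sup>+x. ennreal (\<bar>\<phi> x\<bar> powr P) \<partial>lborel)"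
    unfolding X_def by (rule nn_integral_eq_integral[symmetric]) (use ip in auto)
  also have "\<dots> \<le> (\<integral>\<^sup>+x. (\<Prod>e\<in>Basis. epow (marg e F x) p) \<partial>lborel)"
    by (intro nn_integral_mono pt)
  also have "\<dots> \<le> epow (ennreal A) (1 + p)"
    unfolding FA[symmetric] p_def N_def by (rule Gagliardo[OF Fm]) (use n in simp)
  also have "\<dots> = ennreal (A powr (1 + p))" using A0 p by (simp add: epow_ennreal)
  finally have XA: "X \<le> A powr (1 + p)" by simp
  have "X \<le> Y powr (P / 2)"
  proof (cases "X = 0")
    case False
    then have X: "X > 0" using X0 by simp
    have Y0: "Y \<ge> 0" using G0 by (simp add: Y_def)
    have p1: "p < 1" using N by (simp add: p_def)
    have "X\<^sup>2 \<le> (A powr (1 + p))\<^sup>2" using XA X0 by (intro power_mono)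
    also have "\<dots> = (A\<^sup>2) powr (1 + p)" using A0 by (simp add: power2_eq_square powr_mult)
    also have "\<dots> \<le> (Y * X) powr (1 + p)" using A2 p by (intro powr_mono2) auto
    also have "\<dots> = Y powr (1 + p) * X powr (1 + p)" using Y0 X0 by (simp add: powr_mult)
    also have "X\<^sup>2 = X powr (1 - p) * X powr (1 + p)"
      using X by (simp add: powr_add[symmetric])
    finally have "X powr (1 - p) \<le> Y powr (1 + p)" using X by simp
    then have "(X powr (1 - p)) powr (1 / (1 - p)) \<le> (Y powr (1 + p)) powr (1 / (1 - p))"
      using p1 by (intro powr_mono2) auto
    then have "X \<le> Y powr ((1 + p) / (1 - p))"
      using p1 X by (simp add: powr_powr)
    moreover have "(1 + p) / (1 - p) = P / 2"
      using N unfolding p_def PN by (simp add: divide_simps)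
    ultimately show ?thesis by simp
  qed simp
  then show "(LINT x|lborel. \<bar>\<phi> x\<bar> powr P) \<le> (\<gamma>\<^sup>2 * (LINT x|lborel. (norm (g x))\<^sup>2)) powr (P / 2)"
    unfolding X_def Y_def G_def .
qed

section \<open>Test functions and weak gradients on a bounded open set\<close>

definition grad :: "(real^'n \<Rightarrow> real) \<Rightarrow> real^'n \<Rightarrow> real^'n" where
  "grad \<phi> x = (\<chi> i. partial_deriv i \<phi> x)"

lemma grad_component: "grad \<phi> x $ i = partial_deriv i \<phi> x" by (simp add: grad_def)

lemma grad_unique: assumes "compact_C1 \<phi> g" shows "grad \<phi> = g"
proof
  fix x
  have "(\<phi> has_derivative (\<lambda>h. g x \<bullet> h)) (at x)" using assms by (simp add: compact_C1_def)
  from frechet_derivative_at[OF this, symmetric]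
  show "grad \<phi> x = g x" by (simp add: grad_def partial_deriv_def vec_eq_iff inner_axis)
qed

lemma test_function_compact_C1:
  fixes \<phi> :: "real^'n \<Rightarrow> real"
  assumes "\<phi> \<in> test_functions \<Omega>"
  shows "compact_C1 \<phi> (grad \<phi>)"
proof -
  have "times_cont_diff (Suc 0) \<phi>" using assms by (auto simp: test_functions_def smooth_def)
  then have d: "\<phi> differentiable (at x)" and c: "continuous_on UNIV (\<lambda>x. frechet_derivative \<phi> (at x) v)" for x v
    by auto
  have "frechet_derivative \<phi> (at x) v = grad \<phi> x \<bullet> v" for x v
  proof -
    have lin: "linear (frechet_derivative \<phi> (at x))" by (rule linear_frechet_derivative[OF d])
    have "frechet_derivative \<phi> (at x) v = frechet_derivative \<phi> (at x) (\<Sum>i\<in>UNIV. v $ i *\<^sub>R axis i 1)"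
      by (simp add: basis_expansion flip: scalar_mult_eq_scaleR)
    also have "\<dots> = (\<Sum>i\<in>UNIV. v $ i * frechet_derivative \<phi> (at x) (axis i 1))"
      by (simp add: linear_sum[OF lin] linear_scale[OF lin])
    also have "\<dots> = grad \<phi> x \<bullet> v"
      by (simp add: inner_vec_def grad_def partial_deriv_def mult.commute)
    finally show ?thesis .
  qed
  then have "(\<phi> has_derivative (\<lambda>h. grad \<phi> x \<bullet> h)) (at x)" for x
    using d[of x] unfolding frechet_derivative_works by (metis (no_types, lifting) ext)
  moreover have "continuous_on UNIV (grad \<phi>)"
    unfolding grad_def[abs_def] partial_deriv_def by (intro continuous_on_vec_lambda c)
  moreover have "\<exists>r. \<forall>x. norm x > r \<longrightarrow> \<phi> x = 0"
  proof -
    have "bounded (closure {x. \<phi> x \<noteq> 0})" using assms by (auto simp: test_functions_def compact_imp_bounded)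
    then obtain r where "\<forall>x\<in>closure {x. \<phi> x \<noteq> 0}. norm x \<le> r" by (auto simp: bounded_iff)
    then show ?thesis using closure_subset[of "{x. \<phi> x \<noteq> 0}"] by (intro exI[of _ r]) force
  qed
  ultimately show ?thesis by (simp add: compact_C1_def)
qed

lemma test_function_zero:
  assumes "\<phi> \<in> test_functions \<Omega>" "x \<notin> \<Omega>"
  shows "\<phi> x = 0" "grad \<phi> x = 0"
proof -
  have x: "x \<in> - closure {x. \<phi> x \<noteq> 0}" using assms by (auto simp: test_functions_def)
  then show "\<phi> x = 0" using closure_subset[of "{x. \<phi> x \<noteq> 0}"] by auto
  show "grad \<phi> x = 0"
    by (rule compact_C1_gradient_zero_on_open[OF test_function_compact_C1[OF assms(1)] _ x])
      (use closure_subset[of "{x. \<phi> x \<noteq> 0}"] in auto)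
qed

lemma grad_add_cmult:
  assumes "\<phi> \<in> test_functions \<Omega>" "\<psi> \<in> test_functions \<Omega>"
  shows "grad (\<lambda>x. \<phi> x + t * \<psi> x) x = grad \<phi> x + t *\<^sub>R grad \<psi> x"
    and "grad (\<lambda>x. t * \<psi> x) x = t *\<^sub>R grad \<psi> x"
    and "grad (\<lambda>x. \<phi> x - \<psi> x) x = grad \<phi> x - grad \<psi> x"
proof -
  note c = assms[THEN test_function_compact_C1]
  show "grad (\<lambda>x. \<phi> x + t * \<psi> x) x = grad \<phi> x + t *\<^sub>R grad \<psi> x"
    using grad_unique[OF compact_C1_add[OF c(1) compact_C1_cmult[OF c(2)]]] by simp
  show "grad (\<lambda>x. t * \<psi> x) x = t *\<^sub>R grad \<psi> x"
    using grad_unique[OF compact_C1_cmult[OF c(2)]] by simp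
  show "grad (\<lambda>x. \<phi> x - \<psi> x) x = grad \<phi> x - grad \<psi> x"
    using grad_unique[OF compact_C1_diff[OF c]] by simp
qed

lemma test_functions_diff:
  assumes "\<phi> \<in> test_functions \<Omega>" "\<psi> \<in> test_functions \<Omega>"
  shows "(\<lambda>x. \<phi> x - \<psi> x) \<in> test_functions \<Omega>"
  using test_functions_add[OF assms(1) test_functions_cmult[OF assms(2), of "-1"]] by simp

lemma test_functions_add_cmult:
  assumes "\<phi> \<in> test_functions \<Omega>" "\<psi> \<in> test_functions \<Omega>"
  shows "(\<lambda>x. \<phi> x + t * \<psi> x) \<in> test_functions \<Omega>"
  using test_functions_add[OF assms(1) test_functions_cmult[OF assms(2)]] .

lemma Lp_on_2: "u \<in> Lp_on \<Omega> 2 \<longleftrightarrow> u \<in> borel_measurable (lebesgue_on \<Omega>) \<and> integrable (lebesgue_on \<Omega>) (\<lambda>x. (u x)\<^sup>2)"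
proof -
  have "\<bar>y\<bar> powr 2 = y\<^sup>2" for y :: real by (cases "y = 0") auto
  then show ?thesis by (simp add: Lp_on_def)
qed

lemma measurable_vec_iff:
  "g \<in> borel_measurable M \<longleftrightarrow> (\<forall>i. (\<lambda>x. g x $ i) \<in> borel_measurable M)" for g :: "'x \<Rightarrow> real^'n"
  by (subst borel_measurable_euclidean_space) (auto simp: Basis_vec_def inner_axis)

lemma norm_vec_square: "(norm (y :: real^'n))\<^sup>2 = (\<Sum>i\<in>UNIV. (y $ i)\<^sup>2)"
  unfolding power2_norm_eq_inner inner_vec_def by (simp add: power2_eq_square)

lemma component_square_le: "(y $ i)\<^sup>2 \<le> (norm (y :: real^'n))\<^sup>2"
  using component_le_norm_cart[of y i] by (simp add: abs_le_square_iff[symmetric])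

lemma weak_gradientD:
  "weak_gradient_L2 \<Omega> u g \<Longrightarrow> \<phi> \<in> test_functions \<Omega> \<Longrightarrow>
    (LINT x|lebesgue_on \<Omega>. u x * grad \<phi> x $ i) = - (LINT x|lebesgue_on \<Omega>. g x $ i * \<phi> x)"
  by (simp add: weak_gradient_L2_def grad_component)

lemma weak_gradient_square_integrable:
  assumes "weak_gradient_L2 \<Omega> u g"
  shows "g \<in> borel_measurable (lebesgue_on \<Omega>)" "integrable (lebesgue_on \<Omega>) (\<lambda>x. (norm (g x))\<^sup>2)"
  using assms unfolding weak_gradient_L2_def Lp_on_2 norm_vec_square measurable_vec_iff by auto

lemma square_integrable_component:
  fixes g :: "'x \<Rightarrow> real^'n"
  assumes [measurable]: "g \<in> borel_measurable M" and "integrable M (\<lambda>x. (norm (g x))\<^sup>2)"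
  shows "(\<lambda>x. g x $ i) \<in> borel_measurable M" "integrable M (\<lambda>x. (g x $ i)\<^sup>2)"
proof -
  show [measurable]: "(\<lambda>x. g x $ i) \<in> borel_measurable M" using assms measurable_vec_iff by blast
  show "integrable M (\<lambda>x. (g x $ i)\<^sup>2)"
    by (rule Bochner_Integration.integrable_bound[OF assms(2)]) (auto simp: component_square_le)
qed

lemma L2_tendsto_product:
  fixes w :: "nat \<Rightarrow> 'x \<Rightarrow> real"
  assumes [measurable]: "\<And>k. w k \<in> borel_measurable M" "u \<in> borel_measurable M" "h \<in> borel_measurable M"
    and i: "\<And>k. integrable M (\<lambda>x. (w k x)\<^sup>2)" "integrable M (\<lambda>x. (u x)\<^sup>2)" "integrable M (\<lambda>x. (h x)\<^sup>2)"
    and lim: "(\<lambda>k. LINT x|M. (w k x - u x)\<^sup>2) \<longlonglongrightarrow> 0"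
  shows "(\<lambda>k. LINT x|M. w k x * h x) \<longlonglongrightarrow> (LINT x|M. u x * h x)"
proof -
  have d: "integrable M (\<lambda>x. (w k x - u x)\<^sup>2)" for k
    using integrable_norm_square_diff[of "w k" M u] i by simp
  have CS: "((LINT x|M. w k x * h x) - (LINT x|M. u x * h x))\<^sup>2 \<le> (LINT x|M. (w k x - u x)\<^sup>2) * (LINT x|M. (h x)\<^sup>2)" for k
  proof -
    have "(LINT x|M. w k x * h x) - (LINT x|M. u x * h x) = (LINT x|M. (w k x - u x) * h x)"
      unfolding left_diff_distrib by (rule Bochner_Integration.integral_diff[symmetric]; rule integral_Cauchy_Schwarz) (use i in auto)
    then show ?thesis using integral_Cauchy_Schwarz(2)[OF _ _ d[of k] i(3)] by simp
  qed
  have lim0: "(\<lambda>k. (LINT x|M. (w k x - u x)\<^sup>2) * (LINT x|M. (h x)\<^sup>2)) \<longlonglongrightarrow> 0"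
    using tendsto_mult[OF lim tendsto_const, of "LINT x|M. (h x)\<^sup>2"] by simp
  have "(\<lambda>k. ((LINT x|M. w k x * h x) - (LINT x|M. u x * h x))\<^sup>2) \<longlonglongrightarrow> 0"
    by (rule Lim_null_comparison[OF _ lim0]) (simp add: CS)
  then have "(\<lambda>k. sqrt (((LINT x|M. w k x * h x) - (LINT x|M. u x * h x))\<^sup>2)) \<longlonglongrightarrow> sqrt 0"
    by (rule tendsto_real_sqrt)
  then have "(\<lambda>k. (LINT x|M. w k x * h x) - (LINT x|M. u x * h x)) \<longlonglongrightarrow> 0"
    unfolding real_sqrt_abs real_sqrt_zero by (rule tendsto_rabs_zero_cancel)
  then show ?thesis by (rule LIM_zero_cancel)
qed

locale bounded_domain =
  fixes \<Omega> :: "(real^'n) set"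
  assumes open_domain: "open \<Omega>" and bounded_domain: "bounded \<Omega>" and dim: "CARD('n) \<ge> 3"
begin

abbreviation "M \<equiv> lebesgue_on \<Omega>"
abbreviation "T \<equiv> test_functions \<Omega>"

definition "P = 2 * real CARD('n) / (real CARD('n) - 2)"

lemma P_gt_2: "P > 2" using dim by (simp add: P_def field_simps)

lemma domain_sets: "\<Omega> \<in> sets lebesgue" using open_domain by auto

lemma finite_domain: "finite_measure M"
proof
  have "emeasure M (space M) = emeasure lborel \<Omega>"
    using open_domain by (simp add: emeasure_restrict_space)
  then show "emeasure M (space M) \<noteq> \<infinity>" using emeasure_bounded_finite[OF bounded_domain] by simp
qed

sublocale finite_measure M by (rule finite_domain)

lemma borel_measurable_domain: "f \<in> borel_measurable borel \<Longrightarrow> f \<in> borel_measurable M"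
  by (intro measurable_restrict_space1 measurable_completion) simp

lemma integral_domain:
  fixes F :: "real^'n \<Rightarrow> real"
  assumes F: "F \<in> borel_measurable borel" and z: "\<And>x. x \<notin> \<Omega> \<Longrightarrow> F x = 0"
  shows "integrable M F \<longleftrightarrow> integrable lborel F" "(LINT x|M. F x) = (LINT x|lborel. F x)"
proof -
  have e: "(\<lambda>x. indicator \<Omega> x *\<^sub>R F x) = F" using z by (auto simp: indicator_def fun_eq_iff)
  have "integrable M F \<longleftrightarrow> integrable lebesgue (\<lambda>x. indicator \<Omega> x *\<^sub>R F x)"
    using domain_sets by (subst integrable_restrict_space) (auto simp: set_integrable_def)
  then show "integrable M F \<longleftrightarrow> integrable lborel F" unfolding e using F by (simp add: integrable_completion)
  have "(LINT x|M. F x) = (LINT x|lebesgue. indicator \<Omega> x *\<^sub>R F x)"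
    using domain_sets by (subst integral_restrict_space) auto
  then show "(LINT x|M. F x) = (LINT x|lborel. F x)" unfolding e using F by (simp add: integral_completion)
qed

lemma test_measurable:
  assumes "\<phi> \<in> T"
  shows "\<phi> \<in> borel_measurable borel" "grad \<phi> \<in> borel_measurable borel"
    "\<phi> \<in> borel_measurable M" "grad \<phi> \<in> borel_measurable M"
  using compact_C1_borel[OF test_function_compact_C1[OF assms]] borel_measurable_domain by auto

lemma test_square_integrals:
  assumes \<phi>: "\<phi> \<in> T"
  shows "integrable M (\<lambda>x. (\<phi> x)\<^sup>2)" "integrable M (\<lambda>x. (norm (grad \<phi> x))\<^sup>2)"
    "(LINT x|M. (\<phi> x)\<^sup>2) = (LINT x|lborel. (\<phi> x)\<^sup>2)"
    "(LINT x|M. (norm (grad \<phi> x))\<^sup>2) = (LINT x|lborel. (norm (grad \<phi> x))\<^sup>2)"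
proof -
  note [measurable] = test_measurable[OF \<phi>]
  note c = test_function_compact_C1[OF \<phi>]
  have 1: "(\<lambda>x. (\<phi> x)\<^sup>2) \<in> borel_measurable borel" "(\<lambda>x. (norm (grad \<phi> x))\<^sup>2) \<in> borel_measurable borel" by measurable
  have 2: "x \<notin> \<Omega> \<Longrightarrow> (\<phi> x)\<^sup>2 = 0" "x \<notin> \<Omega> \<Longrightarrow> (norm (grad \<phi> x))\<^sup>2 = 0" for x
    using test_function_zero[OF \<phi>] by auto
  show "integrable M (\<lambda>x. (\<phi> x)\<^sup>2)" "integrable M (\<lambda>x. (norm (grad \<phi> x))\<^sup>2)"
    "(LINT x|M. (\<phi> x)\<^sup>2) = (LINT x|lborel. (\<phi> x)\<^sup>2)"
    "(LINT x|M. (norm (grad \<phi> x))\<^sup>2) = (LINT x|lborel. (norm (grad \<phi> x))\<^sup>2)"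
    using integral_domain[OF 1(1) 2(1)] integral_domain[OF 1(2) 2(2)] compact_C1_integrable_products(3,4)[OF c] by auto
qed

lemma test_Poincare:
  obtains C where "C > 0" "\<And>\<phi>. \<phi> \<in> T \<Longrightarrow> (LINT x|M. (\<phi> x)\<^sup>2) \<le> C * (LINT x|M. (norm (grad \<phi> x))\<^sup>2)"
proof -
  obtain r where r: "r > 0" "\<And>x. x \<in> \<Omega> \<Longrightarrow> norm x \<le> r" using bounded_domain bounded_pos by metis
  show ?thesis
  proof (rule that[of "(2 * r + 1)\<^sup>2"])
    fix \<phi> assume \<phi>: "\<phi> \<in> T"
    have "\<phi> x = 0" if "norm x > r" for x using test_function_zero[OF \<phi>] r(2)[of x] that by force
    then show "(LINT x|M. (\<phi> x)\<^sup>2) \<le> (2 * r + 1)\<^sup>2 * (LINT x|M. (norm (grad \<phi> x))\<^sup>2)"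
      using compact_C1_Poincare[OF test_function_compact_C1[OF \<phi>], of r] r(1) by (simp add: test_square_integrals[OF \<phi>])
  qed (use r in simp)
qed

lemma test_Sobolev:
  obtains C where "C > 0"
    "\<And>\<phi>. \<phi> \<in> T \<Longrightarrow> integrable M (\<lambda>x. \<bar>\<phi> x\<bar> powr P)"
    "\<And>\<phi>. \<phi> \<in> T \<Longrightarrow> (LINT x|M. \<bar>\<phi> x\<bar> powr P) \<le> C * (LINT x|M. (norm (grad \<phi> x))\<^sup>2) powr (P / 2)"
proof -
  define \<gamma> where "\<gamma> = 2 * (real CARD('n) - 1) / (real CARD('n) - 2)"
  have \<gamma>: "\<gamma> > 0" using dim by (simp add: \<gamma>_def)
  have *: "integrable M (\<lambda>x. \<bar>\<phi> x\<bar> powr P)"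
    "(LINT x|M. \<bar>\<phi> x\<bar> powr P) \<le> \<gamma>\<^sup>2 powr (P / 2) * (LINT x|M. (norm (grad \<phi> x))\<^sup>2) powr (P / 2)" if \<phi>: "\<phi> \<in> T" for \<phi>
  proof -
    note [measurable] = test_measurable[OF \<phi>]
    have m: "(\<lambda>x. \<bar>\<phi> x\<bar> powr P) \<in> borel_measurable borel" by measurable
    have z: "x \<notin> \<Omega> \<Longrightarrow> \<bar>\<phi> x\<bar> powr P = 0" for x using test_function_zero[OF \<phi>] by auto
    have t: "integrable M (\<lambda>x. \<bar>\<phi> x\<bar> powr P) \<longleftrightarrow> integrable lborel (\<lambda>x. \<bar>\<phi> x\<bar> powr P)"
       "(LINT x|M. \<bar>\<phi> x\<bar> powr P) = (LINT x|lborel. \<bar>\<phi> x\<bar> powr P)"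
      using integral_domain[OF m z] by auto
    have "integrable lborel (\<lambda>x. \<bar>\<phi> x\<bar> powr P)"
      using Sobolev_inequality(1)[OF test_function_compact_C1[OF \<phi>]] dim unfolding P_def by simp
    then show "integrable M (\<lambda>x. \<bar>\<phi> x\<bar> powr P)" unfolding t(1) .
    have "(LINT x|lborel. \<bar>\<phi> x\<bar> powr P) \<le> (\<gamma>\<^sup>2 * (LINT x|lborel. (norm (grad \<phi> x))\<^sup>2)) powr (P / 2)"
      using Sobolev_inequality(2)[OF test_function_compact_C1[OF \<phi>]] dim unfolding P_def \<gamma>_def by simp
    then have "(LINT x|M. \<bar>\<phi> x\<bar> powr P) \<le> (\<gamma>\<^sup>2 * (LINT x|M. (norm (grad \<phi> x))\<^sup>2)) powr (P / 2)"
      unfolding t(2) test_square_integrals(4)[OF \<phi>] .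
    then show "(LINT x|M. \<bar>\<phi> x\<bar> powr P) \<le> \<gamma>\<^sup>2 powr (P / 2) * (LINT x|M. (norm (grad \<phi> x))\<^sup>2) powr (P / 2)"
      by (simp add: powr_mult)
  qed
  show ?thesis by (rule that[of "\<gamma>\<^sup>2 powr (P / 2)"]) (use * \<gamma> in auto)
qed

lemma test_Rellich:
  assumes \<phi>: "\<And>k. \<phi> k \<in> T" and K: "\<And>k. (LINT x|M. (norm (grad (\<phi> k) x))\<^sup>2) \<le> K"
  obtains \<sigma> :: "nat \<Rightarrow> nat" where "strict_mono \<sigma>"
    "\<And>\<epsilon>. \<epsilon> > 0 \<Longrightarrow> \<exists>N. \<forall>m\<ge>N. \<forall>n\<ge>N. (LINT x|M. (\<phi> (\<sigma> m) x - \<phi> (\<sigma> n) x)\<^sup>2) < \<epsilon>"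
proof -
  obtain r where r: "r > 0" "\<And>x. x \<in> \<Omega> \<Longrightarrow> norm x \<le> r" using bounded_domain bounded_pos by metis
  have z: "\<phi> k x = 0" if "norm x > r" for k x using test_function_zero[OF \<phi>] r(2)[of x] that by force
  obtain \<sigma> :: "nat \<Rightarrow> nat" where "strict_mono \<sigma>"
    "\<And>\<epsilon>. \<epsilon> > 0 \<Longrightarrow> \<exists>N. \<forall>m\<ge>N. \<forall>n\<ge>N. (LINT x|lborel. (\<phi> (\<sigma> m) x - \<phi> (\<sigma> n) x)\<^sup>2) < \<epsilon>"
    by (rule Rellich[where g = "\<lambda>k. grad (\<phi> k)" and \<phi> = \<phi> and r = r and K = K])
      (use test_function_compact_C1[OF \<phi>] z r(1) K test_square_integrals(4)[OF \<phi>] in auto)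
  then show ?thesis using that test_square_integrals(3)[OF test_functions_diff[OF \<phi> \<phi>]] by simp
qed

lemma test_weak_gradient:
  assumes \<phi>: "\<phi> \<in> T"
  shows "weak_gradient_L2 \<Omega> \<phi> (grad \<phi>)"
  unfolding weak_gradient_L2_def
proof (intro conjI ballI allI)
  fix i
  show "(\<lambda>x. grad \<phi> x $ i) \<in> Lp_on \<Omega> 2"
    unfolding Lp_on_2 using square_integrable_component test_measurable(4)[OF \<phi>] test_square_integrals(2)[OF \<phi>] by blast
next
  fix \<psi> i assume \<psi>: "\<psi> \<in> T"
  note [measurable] = test_measurable[OF \<phi>] test_measurable[OF \<psi>]
  have c [measurable]: "(\<lambda>x. grad \<phi> x $ i) \<in> borel_measurable borel" "(\<lambda>x. grad \<psi> x $ i) \<in> borel_measurable borel"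
    using test_measurable(2)[OF \<phi>] test_measurable(2)[OF \<psi>] measurable_vec_iff by blast+
  have "(LINT x|M. \<phi> x * grad \<psi> x $ i) = (LINT x|lborel. \<phi> x * grad \<psi> x $ i)"
    by (rule integral_domain) (use test_function_zero[OF \<phi>] in auto)
  moreover have "(LINT x|M. grad \<phi> x $ i * \<psi> x) = (LINT x|lborel. grad \<phi> x $ i * \<psi> x)"
    by (rule integral_domain) (use test_function_zero[OF \<phi>] in auto)
  moreover have "(LINT x|lborel. \<phi> x * grad \<psi> x $ i) = - (LINT x|lborel. grad \<phi> x $ i * \<psi> x)"
    using compact_C1_integration_by_parts[OF \<phi>[THEN test_function_compact_C1] \<psi>[THEN test_function_compact_C1], of "axis i 1"]
    by (simp add: inner_axis)
  ultimately show "(LINT x|M. \<phi> x * partial_deriv i \<psi> x) = - (LINT x|M. grad \<phi> x $ i * \<psi> x)"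
    by (simp add: grad_component)
qed

lemma square_integrable_imp_integrable:
  fixes f :: "real^'n \<Rightarrow> real"
  assumes "f \<in> borel_measurable M" "integrable M (\<lambda>x. (f x)\<^sup>2)"
  shows "integrable M f"
  using integral_Cauchy_Schwarz(1)[OF assms(1) _ assms(2), of "\<lambda>_. 1"] by simp

lemma test_product_integrable:
  assumes u: "u \<in> borel_measurable M" "integrable M (\<lambda>x. (u x)\<^sup>2)" and \<phi>: "\<phi> \<in> T"
  shows "integrable M (\<lambda>x. u x * \<phi> x)" "integrable M (\<lambda>x. u x * grad \<phi> x $ i)"
  using integral_Cauchy_Schwarz(1)[OF u(1) test_measurable(3)[OF \<phi>] u(2) test_square_integrals(1)[OF \<phi>]]
    integral_Cauchy_Schwarz(1)[OF u(1) _ u(2), of "\<lambda>x. grad \<phi> x $ i"]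
    square_integrable_component[OF test_measurable(4)[OF \<phi>] test_square_integrals(2)[OF \<phi>], of i]
  by auto

text \<open>Components of weak gradients are square integrable, hence integrable on a bounded set, so the fundamental
  lemma applies to their differences.\<close>

lemma weak_gradient_unique:
  assumes g: "weak_gradient_L2 \<Omega> u g" and h: "weak_gradient_L2 \<Omega> u h"
  shows "AE x in M. g x = h x"
proof -
  note G = weak_gradient_square_integrable[OF g] and H = weak_gradient_square_integrable[OF h]
  have "AE x in M. g x $ i = h x $ i" for i
  proof -
    note gi = square_integrable_component[OF G, of i] and hi = square_integrable_component[OF H, of i]
    have "AE x in M. g x $ i - h x $ i = 0"
    proof (rule fundamental_lemma_calculus_of_variations[OF open_domain])
      show "integrable M (\<lambda>x. g x $ i - h x $ i)"
        using square_integrable_imp_integrable[OF gi] square_integrable_imp_integrable[OF hi] by simp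
      fix \<phi> assume \<phi>: "\<phi> \<in> T"
      have "(LINT x|M. g x $ i * \<phi> x) = (LINT x|M. h x $ i * \<phi> x)"
        using weak_gradientD[OF g \<phi>, of i] weak_gradientD[OF h \<phi>, of i] by simp
      then show "(LINT x|M. (g x $ i - h x $ i) * \<phi> x) = 0"
        unfolding left_diff_distrib using test_product_integrable(1)[OF gi \<phi>] test_product_integrable(1)[OF hi \<phi>] by simp
    qed
    then show ?thesis by simp
  qed
  then have "AE x in M. \<forall>i. g x $ i = h x $ i" by (subst AE_all_countable) auto
  then show ?thesis by eventually_elim (simp add: vec_eq_iff)
qed

lemma weak_gradient_diff_test:
  assumes u: "u \<in> borel_measurable M" "integrable M (\<lambda>x. (u x)\<^sup>2)" and g: "weak_gradient_L2 \<Omega> u g" and \<phi>: "\<phi> \<in> T"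
  shows "weak_gradient_L2 \<Omega> (\<lambda>x. u x - \<phi> x) (\<lambda>x. g x - grad \<phi> x)"
  unfolding weak_gradient_L2_def
proof (intro conjI ballI allI)
  note G = weak_gradient_square_integrable[OF g]
  note \<phi>2 = test_square_integrals[OF \<phi>] and \<phi>m = test_measurable[OF \<phi>]
  fix i
  note gi = square_integrable_component[OF G, of i]
  note \<phi>i = square_integrable_component[OF \<phi>m(4) \<phi>2(2), of i]
  show "(\<lambda>x. (g x - grad \<phi> x) $ i) \<in> Lp_on \<Omega> 2"
    unfolding Lp_on_2 using integrable_norm_square_diff[OF gi(1) \<phi>i(1)] gi \<phi>i by auto
  fix \<psi> assume \<psi>: "\<psi> \<in> T"
  have "(LINT x|M. u x * grad \<psi> x $ i) = - (LINT x|M. g x $ i * \<psi> x)"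
      "(LINT x|M. \<phi> x * grad \<psi> x $ i) = - (LINT x|M. grad \<phi> x $ i * \<psi> x)"
    by (rule weak_gradientD[OF g \<psi>], rule weak_gradientD[OF test_weak_gradient[OF \<phi>] \<psi>])
  then show "(LINT x|M. (u x - \<phi> x) * partial_deriv i \<psi> x) = - (LINT x|M. (g x - grad \<phi> x) $ i * \<psi> x)"
    using test_product_integrable(1)[OF gi \<psi>] test_product_integrable(1)[OF \<phi>i \<psi>]
      test_product_integrable(2)[OF u \<psi>, of i] test_product_integrable(2)[OF \<phi>m(3) \<phi>2(1) \<psi>, of i]
    by (simp add: left_diff_distrib grad_component)
qed

text \<open>The space \<open>W12_0\<close> is accessed through approximating sequences: \<open>W12_norm\<close> involves the selected weak
  gradient of a difference, whereas here the gradients of the test functions and a limit \<open>g\<close> are explicit.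
  The lemmas \<open>W12_0_if_W_limit\<close> and \<open>W_limit_if_W12_0\<close> translate between the two.\<close>

definition W_limit :: "(nat \<Rightarrow> real^'n \<Rightarrow> real) \<Rightarrow> (real^'n \<Rightarrow> real) \<Rightarrow> (real^'n \<Rightarrow> real^'n) \<Rightarrow> bool" where
  "W_limit \<psi> u g \<longleftrightarrow> (\<forall>j. \<psi> j \<in> T) \<and>
     u \<in> borel_measurable M \<and> integrable M (\<lambda>x. (u x)\<^sup>2) \<and> g \<in> borel_measurable M \<and> integrable M (\<lambda>x. (norm (g x))\<^sup>2) \<and>
     (\<lambda>j. LINT x|M. (\<psi> j x - u x)\<^sup>2) \<longlonglongrightarrow> 0 \<and> (\<lambda>j. LINT x|M. (norm (grad (\<psi> j) x - g x))\<^sup>2) \<longlonglongrightarrow> 0"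

lemma W_limit_weak_gradient:
  assumes "W_limit \<psi> u g"
  shows "weak_gradient_L2 \<Omega> u g"
  unfolding weak_gradient_L2_def
proof (intro conjI ballI allI)
  have \<psi>: "\<And>j. \<psi> j \<in> T" and u: "u \<in> borel_measurable M" "integrable M (\<lambda>x. (u x)\<^sup>2)"
    and g: "g \<in> borel_measurable M" "integrable M (\<lambda>x. (norm (g x))\<^sup>2)"
    and lu: "(\<lambda>j. LINT x|M. (\<psi> j x - u x)\<^sup>2) \<longlonglongrightarrow> 0" and lg: "(\<lambda>j. LINT x|M. (norm (grad (\<psi> j) x - g x))\<^sup>2) \<longlonglongrightarrow> 0"
    using assms by (auto simp: W_limit_def)
  fix i
  note gi = square_integrable_component[OF g, of i]
  show "(\<lambda>x. g x $ i) \<in> Lp_on \<Omega> 2" using gi by (simp add: Lp_on_2)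
  fix \<phi> assume \<phi>: "\<phi> \<in> T"
  note \<psi>m = test_measurable[OF \<psi>] and \<psi>2 = test_square_integrals[OF \<psi>]
  note \<phi>m = test_measurable[OF \<phi>] and \<phi>2 = test_square_integrals[OF \<phi>]
  note \<psi>i = square_integrable_component[OF \<psi>m(4) \<psi>2(2), of _ i]
  note \<phi>i = square_integrable_component[OF \<phi>m(4) \<phi>2(2), of i]
  have 1: "(\<lambda>j. LINT x|M. \<psi> j x * grad \<phi> x $ i) \<longlonglongrightarrow> (LINT x|M. u x * grad \<phi> x $ i)"
    by (rule L2_tendsto_product[OF \<psi>m(3) u(1) \<phi>i(1) \<psi>2(1) u(2) \<phi>i(2) lu])
  have "(\<lambda>j. LINT x|M. (grad (\<psi> j) x $ i - g x $ i)\<^sup>2) \<longlonglongrightarrow> 0"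
  proof (rule Lim_null_comparison[OF always_eventually lg], rule allI)
    fix j
    have "(LINT x|M. (grad (\<psi> j) x $ i - g x $ i)\<^sup>2) \<le> (LINT x|M. (norm (grad (\<psi> j) x - g x))\<^sup>2)"
      using integrable_norm_square_diff[OF \<psi>m(4) g(1) \<psi>2(2) g(2), of j]
        integrable_norm_square_diff[OF \<psi>i(1) gi(1), of j] \<psi>i(2)[of j] gi(2) component_square_le[of "grad (\<psi> j) _ - g _" i]
      by (intro integral_mono) auto
    then show "norm (LINT x|M. (grad (\<psi> j) x $ i - g x $ i)\<^sup>2) \<le> (LINT x|M. (norm (grad (\<psi> j) x - g x))\<^sup>2)" by simp
  qed
  from L2_tendsto_product[OF \<psi>i(1) gi(1) \<phi>m(3) \<psi>i(2) gi(2) \<phi>2(1) this]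
  have "(\<lambda>j. - (LINT x|M. grad (\<psi> j) x $ i * \<phi> x)) \<longlonglongrightarrow> - (LINT x|M. g x $ i * \<phi> x)"
    by (rule tendsto_minus)
  moreover have "- (LINT x|M. grad (\<psi> j) x $ i * \<phi> x) = (LINT x|M. \<psi> j x * grad \<phi> x $ i)" for j
    using weak_gradientD[OF test_weak_gradient[OF \<psi>[of j]] \<phi>, of i] by simp
  ultimately have "(LINT x|M. u x * grad \<phi> x $ i) = - (LINT x|M. g x $ i * \<phi> x)"
    using 1 LIMSEQ_unique by simp
  then show "(LINT x|M. u x * partial_deriv i \<phi> x) = - (LINT x|M. g x $ i * \<phi> x)"
    by (simp add: grad_component)
qed

lemma wgrad_eq_AE:
  assumes "weak_gradient_L2 \<Omega> u g"
  shows "weak_gradient_L2 \<Omega> u (wgrad \<Omega> u)" "AE x in M. wgrad \<Omega> u x = g x"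
proof -
  show "weak_gradient_L2 \<Omega> u (wgrad \<Omega> u)" unfolding wgrad_def by (rule someI[of "weak_gradient_L2 \<Omega> u", OF assms])
  then show "AE x in M. wgrad \<Omega> u x = g x" using weak_gradient_unique assms by blast
qed

lemma W12_norm_square:
  assumes u: "u \<in> borel_measurable M" "integrable M (\<lambda>x. (u x)\<^sup>2)" and g: "weak_gradient_L2 \<Omega> u g" and \<phi>: "\<phi> \<in> T"
  shows "W12_norm \<Omega> (\<lambda>x. u x - \<phi> x) = sqrt ((LINT x|M. (\<phi> x - u x)\<^sup>2) + (LINT x|M. (norm (grad \<phi> x - g x))\<^sup>2))"
proof -
  note w = weak_gradient_diff_test[OF u g \<phi>]
  note G = weak_gradient_square_integrable(1)[OF g]
    and W = weak_gradient_square_integrable(1)[OF wgrad_eq_AE(1)[OF w]]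
  have [measurable]: "g \<in> borel_measurable M" "grad \<phi> \<in> borel_measurable M"
    "wgrad \<Omega> (\<lambda>x. u x - \<phi> x) \<in> borel_measurable M" using G W test_measurable[OF \<phi>] by auto
  have "(LINT x|M. (norm (wgrad \<Omega> (\<lambda>x. u x - \<phi> x) x))\<^sup>2) = (LINT x|M. (norm (grad \<phi> x - g x))\<^sup>2)"
  proof (rule integral_cong_AE)
    show "AE x in M. (norm (wgrad \<Omega> (\<lambda>x. u x - \<phi> x) x))\<^sup>2 = (norm (grad \<phi> x - g x))\<^sup>2"
      using wgrad_eq_AE(2)[OF w] by eventually_elim (simp add: norm_minus_commute)
  qed measurable
  then show ?thesis unfolding W12_norm_def by (simp add: power2_commute)
qed

lemma W12_0_if_W_limit:
  assumes l: "W_limit \<psi> u g"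
  shows "u \<in> W12_0 \<Omega>" "AE x in M. wgrad \<Omega> u x = g x"
proof -
  note wg = W_limit_weak_gradient[OF l]
  have \<psi>: "\<And>j. \<psi> j \<in> T" and u: "u \<in> borel_measurable M" "integrable M (\<lambda>x. (u x)\<^sup>2)"
    and lu: "(\<lambda>j. LINT x|M. (\<psi> j x - u x)\<^sup>2) \<longlonglongrightarrow> 0" and lg: "(\<lambda>j. LINT x|M. (norm (grad (\<psi> j) x - g x))\<^sup>2) \<longlonglongrightarrow> 0"
    using l by (auto simp: W_limit_def)
  show "AE x in M. wgrad \<Omega> u x = g x" using wgrad_eq_AE[OF wg] by simp
  have "(\<lambda>j. sqrt ((LINT x|M. (\<psi> j x - u x)\<^sup>2) + (LINT x|M. (norm (grad (\<psi> j) x - g x))\<^sup>2))) \<longlonglongrightarrow> sqrt (0 + 0)"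
    by (intro tendsto_intros lu lg)
  then have "(\<lambda>j. W12_norm \<Omega> (\<lambda>x. u x - \<psi> j x)) \<longlonglongrightarrow> 0"
    unfolding W12_norm_square[OF u wg \<psi>] by simp
  then have "\<exists>\<phi>\<in>T. W12_norm \<Omega> (\<lambda>x. u x - \<phi> x) < \<epsilon>" if "\<epsilon> > 0" for \<epsilon>
    using order_tendstoD(2)[of _ 0 sequentially \<epsilon>] that \<psi> by (fastforce simp: eventually_sequentially)
  then show "u \<in> W12_0 \<Omega>"
    using u wg unfolding W12_0_def W12_def by (auto simp: Lp_on_2)
qed

lemma W_limit_if_W12_0:
  assumes "u \<in> W12_0 \<Omega>"
  obtains \<psi> where "W_limit \<psi> u (wgrad \<Omega> u)"
proof -
  have u: "u \<in> borel_measurable M" "integrable M (\<lambda>x. (u x)\<^sup>2)" and "\<exists>g. weak_gradient_L2 \<Omega> u g"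
    using assms unfolding W12_0_def W12_def by (auto simp: Lp_on_2)
  then have wg: "weak_gradient_L2 \<Omega> u (wgrad \<Omega> u)" using wgrad_eq_AE by blast
  have "\<exists>\<phi>\<in>T. W12_norm \<Omega> (\<lambda>x. u x - \<phi> x) < inverse (real (Suc j))" for j
    using assms unfolding W12_0_def by auto
  then obtain \<psi> where \<psi>: "\<And>j. \<psi> j \<in> T" "\<And>j. W12_norm \<Omega> (\<lambda>x. u x - \<psi> j x) < inverse (real (Suc j))"
    by metis
  define A B where "A j = (LINT x|M. (\<psi> j x - u x)\<^sup>2)" and "B j = (LINT x|M. (norm (grad (\<psi> j) x - wgrad \<Omega> u x))\<^sup>2)" for j
  have AB: "0 \<le> A j" "0 \<le> B j" for j by (auto simp: A_def B_def)
  have "sqrt (A j + B j) \<le> inverse (real (Suc j))" for j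
    using \<psi>(2)[of j] unfolding W12_norm_square[OF u wg \<psi>(1)] A_def B_def by simp
  then have "(\<lambda>j. sqrt (A j + B j)) \<longlonglongrightarrow> 0"
    using AB by (intro Lim_null_comparison[OF always_eventually LIMSEQ_inverse_real_of_nat]) auto
  then have "(\<lambda>j. (sqrt (A j + B j))\<^sup>2) \<longlonglongrightarrow> 0\<^sup>2" by (intro tendsto_power)
  then have lim: "(\<lambda>j. A j + B j) \<longlonglongrightarrow> 0" using AB by simp
  have "A \<longlonglongrightarrow> 0" "B \<longlonglongrightarrow> 0"
    using AB by (auto intro!: Lim_null_comparison[OF always_eventually lim])
  then have "W_limit \<psi> u (wgrad \<Omega> u)"
    unfolding W_limit_def A_def B_def using u weak_gradient_square_integrable[OF wg] \<psi>(1) by auto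
  then show ?thesis using that by blast
qed

end

section \<open>Convergence of functionals with critical growth\<close>

lemma abs_add_powr_le:
  fixes x y p :: real
  assumes "p \<ge> 0"
  shows "\<bar>x + y\<bar> powr p \<le> 2 powr p * (\<bar>x\<bar> powr p + \<bar>y\<bar> powr p)"
proof -
  have "\<bar>x + y\<bar> powr p \<le> (2 * max \<bar>x\<bar> \<bar>y\<bar>) powr p" using assms by (intro powr_mono2) auto
  also have "\<dots> = 2 powr p * (max \<bar>x\<bar> \<bar>y\<bar>) powr p" by (simp add: powr_mult)
  also have "\<dots> \<le> 2 powr p * (\<bar>x\<bar> powr p + \<bar>y\<bar> powr p)" by (intro mult_left_mono) (auto simp: max_def)
  finally show ?thesis .
qed

text \<open>For close arguments this is uniform continuity on a compact interval and smallness of \<open>k\<close> relative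
  to \<open>\<bar>t\<bar> powr p\<close> outside it; for distant ones the quadratic term absorbs the bounded part of \<open>k\<close>. The
  estimate turns convergence in mean square and a bound in the critical norm into convergence of the
  integrals of \<open>k\<close>.\<close>

lemma subcritical_modulus:
  fixes k :: "real \<Rightarrow> real"
  assumes kc: "continuous_on UNIV k" and e: "\<epsilon> > 0"
    and B: "\<And>t. \<bar>t\<bar> \<ge> B \<Longrightarrow> \<bar>k t\<bar> \<le> \<epsilon> * \<bar>t\<bar> powr p"
  obtains C where "C \<ge> 0" "\<And>s t. \<bar>k s - k t\<bar> \<le> \<epsilon> * (1 + \<bar>s\<bar> powr p + \<bar>t\<bar> powr p) + C * (s - t)\<^sup>2"
proof -
  define L where "L = \<bar>B\<bar> + 1"
  have "compact (k ` {-L..L})" by (intro compact_continuous_image continuous_on_subset[OF kc]) auto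
  obtain b where b: "\<And>t. t \<in> {-L..L} \<Longrightarrow> \<bar>k t\<bar> \<le> b"
  proof -
    have "bounded (k ` {-L..L})" using \<open>compact (k ` {-L..L})\<close> by (rule compact_imp_bounded)
    then obtain b where "\<forall>y\<in>k ` {-L..L}. norm y \<le> b" unfolding bounded_iff by blast
    then show ?thesis using that[of b] by simp
  qed
  have b0: "b \<ge> 0" using order_trans[OF abs_ge_zero b[of 0]] by (simp add: L_def)
  have "uniformly_continuous_on {-L..L} k"
    by (intro compact_uniformly_continuous continuous_on_subset[OF kc]) auto
  then obtain d where d: "d > 0" "\<And>s t. s \<in> {-L..L} \<Longrightarrow> t \<in> {-L..L} \<Longrightarrow> \<bar>s - t\<bar> < d \<Longrightarrow> \<bar>k s - k t\<bar> < \<epsilon>"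
    unfolding uniformly_continuous_on_def using e by (metis dist_real_def abs_minus_commute)
  define \<delta> where "\<delta> = min d 1"
  have \<delta>: "\<delta> > 0" using d by (simp add: \<delta>_def)
  \<comment> \<open>at distance \<open>\<delta>\<close> or more the quadratic term alone outweighs the bounded part of \<open>k\<close>\<close>
  define C where "C = 2 * b / \<delta>\<^sup>2"
  have C0: "C \<ge> 0" using b0 by (simp add: C_def)
  have "\<bar>k s - k t\<bar> \<le> \<epsilon> * (1 + \<bar>s\<bar> powr p + \<bar>t\<bar> powr p) + C * (s - t)\<^sup>2" for s t
  proof (cases "\<bar>s - t\<bar> < \<delta>")
    case True
    show ?thesis
    proof (cases "\<bar>s\<bar> \<le> L \<and> \<bar>t\<bar> \<le> L")
      case True
      then have "\<bar>k s - k t\<bar> < \<epsilon>" using d(2)[of s t] \<open>\<bar>s - t\<bar> < \<delta>\<close> by (auto simp: \<delta>_def abs_le_iff)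
      moreover have "0 \<le> \<epsilon> * \<bar>s\<bar> powr p" "0 \<le> \<epsilon> * \<bar>t\<bar> powr p" "0 \<le> C * (s - t)\<^sup>2" using e C0 by auto
      ultimately show ?thesis unfolding distrib_left mult_1_right by linarith
    next
      case False
      then have "\<bar>s\<bar> \<ge> B" "\<bar>t\<bar> \<ge> B" using True by (auto simp: \<delta>_def L_def)
      then have "\<bar>k s\<bar> \<le> \<epsilon> * \<bar>s\<bar> powr p" "\<bar>k t\<bar> \<le> \<epsilon> * \<bar>t\<bar> powr p" using B by auto
      moreover have "0 \<le> C * (s - t)\<^sup>2" using C0 by simp
      ultimately show ?thesis using e abs_triangle_ineq4[of "k s" "k t"] by (simp add: algebra_simps)
    qed
  next
    case False
    have "\<bar>k t\<bar> \<le> b + \<epsilon> * \<bar>t\<bar> powr p" for t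
    proof (cases "\<bar>t\<bar> \<ge> B")
      case True
      then show ?thesis using B[OF True] b0 by simp
    next
      case False
      then have "\<bar>k t\<bar> \<le> b" by (intro b) (auto simp: L_def)
      moreover have "0 \<le> \<epsilon> * \<bar>t\<bar> powr p" using e by simp
      ultimately show ?thesis by linarith
    qed
    from this[of s] this[of t] have "\<bar>k s - k t\<bar> \<le> 2 * b + \<epsilon> * (\<bar>s\<bar> powr p + \<bar>t\<bar> powr p)"
      using abs_triangle_ineq4[of "k s" "k t"] by (simp add: algebra_simps)
    moreover have "2 * b \<le> C * (s - t)\<^sup>2"
    proof -
      have "\<delta>\<^sup>2 \<le> (s - t)\<^sup>2" using False \<delta> by (simp add: abs_le_square_iff[symmetric])
      then have "C * \<delta>\<^sup>2 \<le> C * (s - t)\<^sup>2" using C0 by (rule mult_left_mono)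
      then show ?thesis using \<delta> by (simp add: C_def)
    qed
    ultimately show ?thesis using e by (simp add: algebra_simps)
  qed
  then show ?thesis using that C0 by blast
qed

context bounded_domain
begin

definition "P' = P / (P - 1)"

lemma dual_exponent: "P' > 1" "1 / P' + 1 / P = 1" "(P - 1) * P' = P"
  using P_gt_2 by (auto simp: P'_def field_simps)

lemma Young_P: "\<bar>x * y\<bar> \<le> \<bar>x\<bar> powr P' + \<bar>y\<bar> powr P"
proof -
  have "\<bar>x\<bar> * \<bar>y\<bar> \<le> \<bar>x\<bar> powr P' / P' + \<bar>y\<bar> powr P / P"
    using P_gt_2 dual_exponent by (intro Youngs_inequality) auto
  also have "\<dots> \<le> \<bar>x\<bar> powr P' / 1 + \<bar>y\<bar> powr P / 1"
    using P_gt_2 dual_exponent(1) by (intro add_mono divide_left_mono) auto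
  finally show ?thesis by (simp add: abs_mult)
qed

lemma dual_product_integrable:
  assumes [measurable]: "h \<in> borel_measurable M" "u \<in> borel_measurable M"
    and "integrable M (\<lambda>x. \<bar>h x\<bar> powr P')" "integrable M (\<lambda>x. \<bar>u x\<bar> powr P)"
  shows "integrable M (\<lambda>x. h x * u x)"
    and "\<bar>LINT x|M. h x * u x\<bar> \<le> (LINT x|M. \<bar>h x\<bar> powr P') + (LINT x|M. \<bar>u x\<bar> powr P)"
proof -
  have b: "norm (h x * u x) \<le> norm (\<bar>h x\<bar> powr P' + \<bar>u x\<bar> powr P)" for x
    using Young_P[of "h x" "u x"] by simp
  show i: "integrable M (\<lambda>x. h x * u x)"
    by (rule Bochner_Integration.integrable_bound[OF Bochner_Integration.integrable_add[OF assms(3,4)]]) (use b in auto)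
  have "\<bar>LINT x|M. h x * u x\<bar> \<le> (LINT x|M. \<bar>h x * u x\<bar>)" by (rule integral_abs_bound)
  also have "\<dots> \<le> (LINT x|M. \<bar>h x\<bar> powr P' + \<bar>u x\<bar> powr P)"
    by (rule integral_mono) (use i assms Young_P in auto)
  finally show "\<bar>LINT x|M. h x * u x\<bar> \<le> (LINT x|M. \<bar>h x\<bar> powr P') + (LINT x|M. \<bar>u x\<bar> powr P)"
    using assms by simp
qed

lemma growth_integrable:
  fixes f :: "real \<Rightarrow> real"
  assumes f: "continuous_on UNIV f" and g: "\<And>t. \<bar>f t\<bar> \<le> C * (1 + \<bar>t\<bar> powr P)"
    and u [measurable]: "u \<in> borel_measurable M" and "integrable M (\<lambda>x. \<bar>u x\<bar> powr P)"
  shows "integrable M (\<lambda>x. f (u x))"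
proof (rule Bochner_Integration.integrable_bound)
  show "integrable M (\<lambda>x. C * (1 + \<bar>u x\<bar> powr P))" using assms(4) by simp
  have [measurable]: "f \<in> borel_measurable borel" using f by (rule borel_measurable_continuous_onI)
  show "(\<lambda>x. f (u x)) \<in> borel_measurable M" by measurable
  show "AE x in M. norm (f (u x)) \<le> norm (C * (1 + \<bar>u x\<bar> powr P))"
    using g by (intro AE_I2) (metis abs_ge_self order_trans real_norm_def)
qed

lemma test_powr_integrable: "\<phi> \<in> T \<Longrightarrow> integrable M (\<lambda>x. \<bar>\<phi> x\<bar> powr P)"
  using test_Sobolev by metis

lemma test_bounded:
  assumes "\<phi> \<in> T"
  obtains B where "B > 0" "\<And>x. \<bar>\<phi> x\<bar> \<le> B" "\<And>x. norm (grad \<phi> x) \<le> B"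
  using compact_C1_bounded[OF test_function_compact_C1[OF assms]] by blast

text \<open>By Sobolev's inequality and Fatou's lemma, convergence of gradients in mean square forces
  convergence in the critical norm. A subsequence then converges pointwise with an integrable
  majorant, so that dominated convergence applies to every functional of critical growth.\<close>

lemma W_limit_dominated:
  assumes l: "W_limit \<psi> u g"
  obtains r H where "strict_mono (r :: nat \<Rightarrow> nat)" "integrable M H" "integrable M (\<lambda>x. \<bar>u x\<bar> powr P)"
    "AE x in M. (\<lambda>j. \<psi> (r j) x) \<longlonglongrightarrow> u x" "AE x in M. (\<lambda>j. grad (\<psi> (r j)) x) \<longlonglongrightarrow> g x"
    "AE x in M. \<forall>j. \<bar>\<psi> (r j) x\<bar> powr P \<le> H x" "AE x in M. \<forall>j. (norm (grad (\<psi> (r j)) x))\<^sup>2 \<le> H x"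
proof -
  have \<psi>: "\<And>j. \<psi> j \<in> T" and u [measurable]: "u \<in> borel_measurable M" and u2: "integrable M (\<lambda>x. (u x)\<^sup>2)"
    and g [measurable]: "g \<in> borel_measurable M" and g2: "integrable M (\<lambda>x. (norm (g x))\<^sup>2)"
    and lu: "(\<lambda>j. LINT x|M. (\<psi> j x - u x)\<^sup>2) \<longlonglongrightarrow> 0" and lg: "(\<lambda>j. LINT x|M. (norm (grad (\<psi> j) x - g x))\<^sup>2) \<longlonglongrightarrow> 0"
    using l by (auto simp: W_limit_def)
  note \<psi>m [measurable] = test_measurable(3,4)[OF \<psi>] and \<psi>2 = test_square_integrals[OF \<psi>]
  have iu: "integrable M (\<lambda>x. (\<psi> j x - u x)\<^sup>2)" for j
    using integrable_norm_square_diff[of "\<psi> j" M u] \<psi>2(1) u2 by simp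
  have ig: "integrable M (\<lambda>x. (norm (grad (\<psi> j) x - g x))\<^sup>2)" for j
    by (intro integrable_norm_square_diff \<psi>m g \<psi>2(2) g2)
  define d where "d j x = (\<psi> j x - u x)\<^sup>2 + (norm (grad (\<psi> j) x - g x))\<^sup>2" for j x
  have di: "integrable M (d j)" "0 \<le> d j x" for j x using iu ig by (auto simp: d_def[abs_def])
  have dl: "(\<lambda>j. LINT x|M. d j x) \<longlonglongrightarrow> 0"
    using tendsto_add[OF lu lg] iu ig by (simp add: d_def)
  obtain r S where r: "strict_mono (r :: nat \<Rightarrow> nat)" and S: "integrable M S"
    and S0: "AE x in M. (\<lambda>j. d (r j) x) \<longlonglongrightarrow> 0" and Sb: "AE x in M. \<forall>j. d (r j) x \<le> S x"
    using L1_null_dominated_subsequence[of M d, OF di dl] by blast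
  have ptu: "AE x in M. (\<lambda>j. \<psi> (r j) x) \<longlonglongrightarrow> u x" and ptg: "AE x in M. (\<lambda>j. grad (\<psi> (r j)) x) \<longlonglongrightarrow> g x"
  proof -
    have *: "(\<lambda>j. \<psi> (r j) x) \<longlonglongrightarrow> u x \<and> (\<lambda>j. grad (\<psi> (r j)) x) \<longlonglongrightarrow> g x" if "(\<lambda>j. d (r j) x) \<longlonglongrightarrow> 0" for x
    proof -
      have s: "(\<lambda>j. sqrt (d (r j) x)) \<longlonglongrightarrow> 0" using tendsto_real_sqrt[OF that] by simp
      have "norm (\<psi> (r j) x - u x) \<le> sqrt (d (r j) x)" "norm (grad (\<psi> (r j)) x - g x) \<le> sqrt (d (r j) x)" for j
        by (auto simp: d_def intro!: real_le_rsqrt)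
      then have "(\<lambda>j. \<psi> (r j) x - u x) \<longlonglongrightarrow> 0" "(\<lambda>j. grad (\<psi> (r j)) x - g x) \<longlonglongrightarrow> 0"
        by (auto intro: Lim_null_comparison[OF _ s])
      then show ?thesis by (auto intro: LIM_zero_cancel)
    qed
    show "AE x in M. (\<lambda>j. \<psi> (r j) x) \<longlonglongrightarrow> u x" using S0 by eventually_elim (use * in blast)
    show "AE x in M. (\<lambda>j. grad (\<psi> (r j)) x) \<longlonglongrightarrow> g x" using S0 by eventually_elim (use * in blast)
  qed
  obtain C where C: "C > 0"
    "\<And>\<phi>. \<phi> \<in> T \<Longrightarrow> (LINT x|M. \<bar>\<phi> x\<bar> powr P) \<le> C * (LINT x|M. (norm (grad \<phi> x))\<^sup>2) powr (P / 2)"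
    using test_Sobolev by metis
  define G where "G j = (LINT x|M. (norm (grad (\<psi> (r j)) x - g x))\<^sup>2)" for j
  have G0: "G j \<ge> 0" for j by (simp add: G_def)
  have Gl: "G \<longlonglongrightarrow> 0" unfolding G_def[abs_def] using LIMSEQ_subseq_LIMSEQ[OF lg r] by (simp add: o_def)
  \<comment> \<open>the second summand makes room for the gradient distance of a later member to the limit\<close>
  define b where "b j = C * (2 * G j + 2 * inverse (real (Suc j))) powr (P / 2)" for j
  have bl: "b \<longlonglongrightarrow> 0"
  proof -
    have "(\<lambda>j. 2 * G j + 2 * inverse (real (Suc j))) \<longlonglongrightarrow> 2 * 0 + 2 * 0"
      by (intro tendsto_intros Gl LIMSEQ_inverse_real_of_nat)
    then have "(\<lambda>j. (2 * G j + 2 * inverse (real (Suc j))) powr (P / 2)) \<longlonglongrightarrow> 0 powr (P / 2)"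
      using P_gt_2 G0 by (intro tendsto_powr') auto
    from tendsto_mult[OF tendsto_const[of C] this] show ?thesis using P_gt_2 unfolding b_def[abs_def] by simp
  qed
  define e where "e j x = \<bar>\<psi> (r j) x - u x\<bar> powr P" for j x
  have e: "integrable M (e j)" "(LINT x|M. e j x) \<le> b j" for j
  proof -
    have dT: "(\<lambda>x. \<psi> (r j) x - \<psi> (r i) x) \<in> T" for i by (intro test_functions_diff \<psi>)
    have le: "\<forall>\<^sub>F i in sequentially. (LINT x|M. \<bar>\<psi> (r j) x - \<psi> (r i) x\<bar> powr P) \<le> b j"
    proof -
      have "\<forall>\<^sub>F i in sequentially. G i < inverse (real (Suc j))" using order_tendstoD(2)[OF Gl] by simp
      then show ?thesis
      proof eventually_elim
        case (elim i)
        have "(LINT x|M. (norm (grad (\<lambda>x. \<psi> (r j) x - \<psi> (r i) x) x))\<^sup>2) \<le>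
          (LINT x|M. 2 * (norm (grad (\<psi> (r j)) x - g x))\<^sup>2 + 2 * (norm (grad (\<psi> (r i)) x - g x))\<^sup>2)"
          using test_square_integrals(2)[OF dT[of i]] ig
          by (intro integral_mono) (auto simp: grad_add_cmult(3)[OF \<psi> \<psi>] norm_diff_square_le)
        also have "\<dots> = 2 * G j + 2 * G i" unfolding G_def using ig by simp
        also have "\<dots> \<le> 2 * G j + 2 * inverse (real (Suc j))" using elim by simp
        finally have D: "(LINT x|M. (norm (grad (\<lambda>x. \<psi> (r j) x - \<psi> (r i) x) x))\<^sup>2) \<le> 2 * G j + 2 * inverse (real (Suc j))" .
        have "(LINT x|M. \<bar>\<psi> (r j) x - \<psi> (r i) x\<bar> powr P) \<le> C * (LINT x|M. (norm (grad (\<lambda>x. \<psi> (r j) x - \<psi> (r i) x) x))\<^sup>2) powr (P / 2)"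
          by (rule C(2)[OF dT])
        also have "\<dots> \<le> b j" unfolding b_def using C(1) P_gt_2 D by (intro mult_left_mono powr_mono2) auto
        finally show ?case .
      qed
    qed
    have pt: "AE x in M. (\<lambda>i. \<bar>\<psi> (r j) x - \<psi> (r i) x\<bar> powr P) \<longlonglongrightarrow> e j x"
      using ptu
    proof eventually_elim
      case (elim x)
      then have "(\<lambda>i. \<bar>\<psi> (r j) x - \<psi> (r i) x\<bar>) \<longlonglongrightarrow> \<bar>\<psi> (r j) x - u x\<bar>" by (intro tendsto_intros)
      then show ?case unfolding e_def using P_gt_2 by (intro tendsto_powr') auto
    qed
    have em: "e j \<in> borel_measurable M" unfolding e_def[abs_def] by measurable
    show "integrable M (e j)" "(LINT x|M. e j x) \<le> b j"
      using Fatou_mean_limit[of "\<lambda>i x. \<bar>\<psi> (r j) x - \<psi> (r i) x\<bar> powr P" M "e j" "b j", OF _ em _ _ pt _ le]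
        test_powr_integrable[OF dT] by (auto simp: e_def)
  qed
  have e0: "0 \<le> e j x" for j x by (simp add: e_def)
  have el: "(\<lambda>j. LINT x|M. e j x) \<longlonglongrightarrow> 0"
  proof (rule Lim_null_comparison[OF _ bl], rule always_eventually, rule allI)
    show "norm (LINT x|M. e j x) \<le> b j" for j using e(2)[of j] by (simp add: e_def)
  qed
  obtain r' S' where r': "strict_mono (r' :: nat \<Rightarrow> nat)" and S': "integrable M S'"
    and Sb': "AE x in M. \<forall>j. e (r' j) x \<le> S' x"
    using L1_null_dominated_subsequence[of M e, OF e(1) e0 el] by blast
  have uP: "integrable M (\<lambda>x. \<bar>u x\<bar> powr P)"
  proof (rule Bochner_Integration.integrable_bound)
    show "integrable M (\<lambda>x. 2 powr P * (\<bar>\<psi> (r 0) x\<bar> powr P + e 0 x))"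
      using test_powr_integrable[OF \<psi>] e(1) by simp
    show "AE x in M. norm (\<bar>u x\<bar> powr P) \<le> norm (2 powr P * (\<bar>\<psi> (r 0) x\<bar> powr P + e 0 x))"
    proof (rule AE_I2)
      fix x
      have "\<bar>\<psi> (r 0) x + (u x - \<psi> (r 0) x)\<bar> powr P \<le> 2 powr P * (\<bar>\<psi> (r 0) x\<bar> powr P + \<bar>u x - \<psi> (r 0) x\<bar> powr P)"
        using P_gt_2 by (intro abs_add_powr_le) simp
      then show "norm (\<bar>u x\<bar> powr P) \<le> norm (2 powr P * (\<bar>\<psi> (r 0) x\<bar> powr P + e 0 x))"
        by (simp add: e_def abs_minus_commute)
    qed
  qed measurable
  define H where "H x = 2 powr P * (\<bar>u x\<bar> powr P + \<bar>S' x\<bar>) + (2 * \<bar>S x\<bar> + 2 * (norm (g x))\<^sup>2)" for x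
  show ?thesis
  proof (rule that[of "\<lambda>j. r (r' j)" H])
    show "strict_mono (\<lambda>j. r (r' j))" using r r' by (simp add: strict_mono_def)
    show "integrable M H" unfolding H_def using uP S S' g2 by auto
    show "AE x in M. (\<lambda>j. \<psi> (r (r' j)) x) \<longlonglongrightarrow> u x" using ptu
    proof eventually_elim
      case (elim x)
      show ?case using LIMSEQ_subseq_LIMSEQ[OF elim r'] by (simp add: o_def)
    qed
    show "AE x in M. (\<lambda>j. grad (\<psi> (r (r' j))) x) \<longlonglongrightarrow> g x" using ptg
    proof eventually_elim
      case (elim x)
      show ?case using LIMSEQ_subseq_LIMSEQ[OF elim r'] by (simp add: o_def)
    qed
    show "AE x in M. \<forall>j. \<bar>\<psi> (r (r' j)) x\<bar> powr P \<le> H x" using Sb'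
    proof (eventually_elim, intro allI)
      fix x j assume "\<forall>j. e (r' j) x \<le> S' x"
      then have "e (r' j) x \<le> \<bar>S' x\<bar>" by (meson abs_ge_self order_trans)
      moreover have "\<bar>u x + (\<psi> (r (r' j)) x - u x)\<bar> powr P \<le> 2 powr P * (\<bar>u x\<bar> powr P + e (r' j) x)"
        unfolding e_def using P_gt_2 by (intro abs_add_powr_le) simp
      ultimately have "\<bar>\<psi> (r (r' j)) x\<bar> powr P \<le> 2 powr P * (\<bar>u x\<bar> powr P + \<bar>S' x\<bar>)"
        by (simp add: order_trans[OF _ mult_left_mono])
      then show "\<bar>\<psi> (r (r' j)) x\<bar> powr P \<le> H x" unfolding H_def by (simp add: add_increasing2)
    qed
    show "AE x in M. \<forall>j. (norm (grad (\<psi> (r (r' j))) x))\<^sup>2 \<le> H x" using Sb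
    proof (eventually_elim, intro allI)
      fix x j assume "\<forall>j. d (r j) x \<le> S x"
      then have "d (r (r' j)) x \<le> \<bar>S x\<bar>" by (meson abs_ge_self order_trans)
      moreover have "(norm (grad (\<psi> (r (r' j))) x - g x))\<^sup>2 \<le> d (r (r' j)) x" by (simp add: d_def)
      ultimately have "(norm (grad (\<psi> (r (r' j))) x))\<^sup>2 \<le> 2 * \<bar>S x\<bar> + 2 * (norm (g x))\<^sup>2"
        using norm_square_le[of "grad (\<psi> (r (r' j))) x" "g x"] by linarith
      moreover have "0 \<le> 2 powr P * (\<bar>u x\<bar> powr P + \<bar>S' x\<bar>)" by simp
      ultimately show "(norm (grad (\<psi> (r (r' j))) x))\<^sup>2 \<le> H x" unfolding H_def by linarith
    qed
  qed (rule uP)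
qed

end

section \<open>Minimisation of the energy\<close>

context bounded_domain
begin

definition dirichlet :: "(real^'n \<Rightarrow> real) \<Rightarrow> real" where
  "dirichlet \<phi> = (LINT x|M. (norm (grad \<phi> x))\<^sup>2)"

definition energy :: "(real \<Rightarrow> real) \<Rightarrow> (real \<Rightarrow> real) \<Rightarrow> (real^'n \<Rightarrow> real) \<Rightarrow> (real^'n \<Rightarrow> real) \<Rightarrow> real" where
  "energy F k h \<phi> = dirichlet \<phi> / 2 + (LINT x|M. F (\<phi> x)) - (LINT x|M. k (\<phi> x)) - (LINT x|M. h x * \<phi> x)"

lemma dirichlet_nonneg: "dirichlet \<phi> \<ge> 0" by (simp add: dirichlet_def)

lemma dirichlet_mid:
  assumes "\<phi> \<in> T" "\<psi> \<in> T"
  shows "dirichlet (\<lambda>x. \<phi> x / 2 + \<psi> x / 2) = dirichlet \<phi> / 2 + dirichlet \<psi> / 2 - dirichlet (\<lambda>x. \<phi> x - \<psi> x) / 4"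
proof -
  have eq: "(\<lambda>x. \<phi> x / 2 + \<psi> x / 2) = (\<lambda>x. (1 / 2) * \<phi> x + (1 / 2) * \<psi> x)" by (simp add: fun_eq_iff)
  have g: "grad (\<lambda>x. \<phi> x / 2 + \<psi> x / 2) x = (1 / 2) *\<^sub>R grad \<phi> x + (1 / 2) *\<^sub>R grad \<psi> x" for x
    unfolding eq using grad_add_cmult(1)[OF test_functions_cmult[OF assms(1), of "1/2"] assms(2), of "1/2" x]
      grad_add_cmult(2)[OF assms(2,1), of "1/2" x] by simp
  have pt: "(norm ((1 / 2) *\<^sub>R p + (1 / 2) *\<^sub>R q))\<^sup>2 = (norm p)\<^sup>2 / 2 + (norm q)\<^sup>2 / 2 - (norm (p - q))\<^sup>2 / 4" for p q :: "real^'n"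
    unfolding power2_norm_eq_inner by (simp add: inner_add inner_diff inner_commute field_simps)
  note i = test_square_integrals(2)[OF assms(1)] test_square_integrals(2)[OF assms(2)]
    test_square_integrals(2)[OF test_functions_diff[OF assms], unfolded grad_add_cmult(3)[OF assms]]
  show ?thesis unfolding dirichlet_def g pt grad_add_cmult(3)[OF assms] using i by simp
qed

end

text \<open>\<open>F\<close> is the convex part of critical growth, \<open>k\<close> the subcritical part, \<open>\<Gamma>\<close> the derivative of
  \<open>F - k\<close>. The barrier says that the energy is bounded away from its value \<open>0\<close> at the zero function on a shell,
  so that a minimising sequence in the ball eventually lies inside the shell.\<close>
locale variational_problem = bounded_domain \<Omega> for \<Omega> :: "(real^'n) set" +
  fixes F k \<Gamma> :: "real \<Rightarrow> real" and h :: "real^'n \<Rightarrow> real" and C A0 A1 \<eta> :: real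
  assumes F_cont: "continuous_on UNIV F" and F_nonneg: "\<And>t. F t \<ge> 0" and F_0: "F 0 = 0"
    and F_mid: "\<And>s t. F (s / 2 + t / 2) \<le> F s / 2 + F t / 2"
    and F_growth: "\<And>t. \<bar>F t\<bar> \<le> C * (1 + \<bar>t\<bar> powr P)"
    and k_cont: "continuous_on UNIV k" and k_0: "k 0 = 0"
    and k_sub: "\<And>\<epsilon>. \<epsilon> > 0 \<Longrightarrow> \<exists>B. \<forall>t. \<bar>t\<bar> \<ge> B \<longrightarrow> \<bar>k t\<bar> \<le> \<epsilon> * \<bar>t\<bar> powr P"
    and k_growth: "\<And>t. \<bar>k t\<bar> \<le> C * (1 + \<bar>t\<bar> powr P)"
    and \<Gamma>_cont: "continuous_on UNIV \<Gamma>"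
    and \<Gamma>_deriv: "\<And>t. ((\<lambda>t. F t - k t) has_real_derivative \<Gamma> t) (at t)"
    and \<Gamma>_growth: "\<And>t. \<bar>\<Gamma> t\<bar> \<le> C * (1 + \<bar>t\<bar> powr (P - 1))"
    and C_pos: "C > 0"
    and h_meas: "h \<in> borel_measurable M" and h_int: "integrable M (\<lambda>x. \<bar>h x\<bar> powr P')"
    and A: "0 \<le> A0" "A0 < A1" and \<eta>: "\<eta> > 0"
    and barrier: "\<And>\<phi>. \<phi> \<in> T \<Longrightarrow> A0 \<le> dirichlet \<phi> \<Longrightarrow> dirichlet \<phi> \<le> A1 \<Longrightarrow> energy F k h \<phi> \<ge> \<eta>"
begin

abbreviation "J \<equiv> energy F k h"
definition "adm = {\<phi>\<in>T. dirichlet \<phi> \<le> A1}"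
definition "m = Inf (J ` adm)"

lemma test_integrals:
  assumes \<phi>: "\<phi> \<in> T"
  shows "integrable M (\<lambda>x. F (\<phi> x))" "integrable M (\<lambda>x. k (\<phi> x))" "integrable M (\<lambda>x. h x * \<phi> x)"
  using growth_integrable[OF F_cont F_growth test_measurable(3)[OF \<phi>] test_powr_integrable[OF \<phi>]]
    growth_integrable[OF k_cont k_growth test_measurable(3)[OF \<phi>] test_powr_integrable[OF \<phi>]]
    dual_product_integrable(1)[OF h_meas test_measurable(3)[OF \<phi>] h_int test_powr_integrable[OF \<phi>]]
  by auto

lemma adm_powr_bound:
  obtains S where "S \<ge> 0" "\<And>\<phi>. \<phi> \<in> adm \<Longrightarrow> (LINT x|M. \<bar>\<phi> x\<bar> powr P) \<le> S"
proof -
  obtain c where c: "c > 0" "\<And>\<phi>. \<phi> \<in> T \<Longrightarrow> (LINT x|M. \<bar>\<phi> x\<bar> powr P) \<le> c * (LINT x|M. (norm (grad \<phi> x))\<^sup>2) powr (P / 2)"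
    using test_Sobolev by metis
  show ?thesis
  proof (rule that[of "c * A1 powr (P / 2)"])
    fix \<phi> assume "\<phi> \<in> adm"
    then have \<phi>: "\<phi> \<in> T" and "dirichlet \<phi> \<le> A1" by (auto simp: adm_def)
    then have "c * dirichlet \<phi> powr (P / 2) \<le> c * A1 powr (P / 2)"
      using c(1) P_gt_2 dirichlet_nonneg by (intro mult_left_mono powr_mono2) auto
    then show "(LINT x|M. \<bar>\<phi> x\<bar> powr P) \<le> c * A1 powr (P / 2)" using c(2)[OF \<phi>] by (simp add: dirichlet_def)
  qed (use c(1) in simp)
qed

text \<open>The bound of the critical norm on the ball makes the energy bounded below, so that the infimum is not
  the default value of an unbounded set.\<close>

lemma m_le: "\<phi> \<in> adm \<Longrightarrow> m \<le> J \<phi>"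
proof -
  assume "\<phi> \<in> adm"
  obtain S where S: "\<And>\<phi>. \<phi> \<in> adm \<Longrightarrow> (LINT x|M. \<bar>\<phi> x\<bar> powr P) \<le> S" using adm_powr_bound by metis
  define W where "W = - (C * (measure M (space M) + S)) - ((LINT x|M. \<bar>h x\<bar> powr P') + S)"
  have "W \<le> J \<phi>" if a: "\<phi> \<in> adm" for \<phi>
  proof -
    have \<phi>: "\<phi> \<in> T" using a by (simp add: adm_def)
    note i = test_integrals[OF \<phi>] and iP = test_powr_integrable[OF \<phi>]
    have "(LINT x|M. k (\<phi> x)) \<le> (LINT x|M. C * (1 + \<bar>\<phi> x\<bar> powr P))"
      using i(2) iP k_growth by (intro integral_mono) (auto simp: abs_le_iff)
    also have "\<dots> = C * (measure M (space M) + (LINT x|M. \<bar>\<phi> x\<bar> powr P))" using iP by simp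
    also have "\<dots> \<le> C * (measure M (space M) + S)" using S[OF a] C_pos by simp
    finally have 1: "(LINT x|M. k (\<phi> x)) \<le> C * (measure M (space M) + S)" .
    have "\<bar>LINT x|M. h x * \<phi> x\<bar> \<le> (LINT x|M. \<bar>h x\<bar> powr P') + (LINT x|M. \<bar>\<phi> x\<bar> powr P)"
      by (rule dual_product_integrable(2)[OF h_meas test_measurable(3)[OF \<phi>] h_int iP])
    then have 2: "(LINT x|M. h x * \<phi> x) \<le> (LINT x|M. \<bar>h x\<bar> powr P') + S" using S[OF a] by linarith
    have 3: "0 \<le> (LINT x|M. F (\<phi> x))" using F_nonneg by simp
    show ?thesis unfolding W_def energy_def using 1 2 3 dirichlet_nonneg[of \<phi>] by linarith
  qed
  then have "bdd_below (J ` adm)" by (rule bdd_belowI2)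
  then show "m \<le> J \<phi>" unfolding m_def using \<open>\<phi> \<in> adm\<close> by (intro cInf_lower) auto
qed

lemma zero_adm: "(\<lambda>x. 0) \<in> adm" and J_zero: "J (\<lambda>x. 0) = 0"
proof -
  have g: "grad (\<lambda>x::real^'n. 0) x = 0" for x
    using grad_add_cmult(2)[OF test_functions_0 test_functions_0, of 0 x] by simp
  show "(\<lambda>x. 0) \<in> adm" using A by (simp add: adm_def test_functions_0 dirichlet_def g)
  show "J (\<lambda>x. 0) = 0" by (simp add: energy_def dirichlet_def g F_0 k_0)
qed

lemma m_nonpos: "m \<le> 0" using m_le[OF zero_adm] J_zero by simp

lemma minimising_sequence:
  obtains \<phi> where "\<And>j. \<phi> j \<in> adm" "\<And>j. J (\<phi> j) < m + inverse (real (Suc j))"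
proof -
  have "\<exists>\<phi>\<in>adm. J \<phi> < m + inverse (real (Suc j))" for j
    using cInf_lessD[of "J ` adm" "m + inverse (real (Suc j))"] zero_adm unfolding m_def by auto
  then show ?thesis using that by metis
qed

text \<open>The quadratic part of the energy is uniformly convex and its critical part convex, so an
  almost minimal energy at two functions and the minimum as a lower bound at their midpoint control
  the distance of the gradients by the deviation from convexity of the subcritical part.\<close>

lemma dirichlet_diff_le:
  assumes a: "\<phi> \<in> adm" "\<psi> \<in> adm"
  shows "dirichlet (\<lambda>x. \<phi> x - \<psi> x) \<le> 4 * (J \<phi> - m) + 4 * (J \<psi> - m)
     + 8 * (LINT x|M. \<bar>k (\<phi> x / 2 + \<psi> x / 2) - k (\<phi> x) / 2 - k (\<psi> x) / 2\<bar>)"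
    and "(\<lambda>x. \<phi> x / 2 + \<psi> x / 2) \<in> adm"
proof -
  let ?w = "\<lambda>x. \<phi> x / 2 + \<psi> x / 2"
  have T: "\<phi> \<in> T" "\<psi> \<in> T" using a by (auto simp: adm_def)
  have w: "?w \<in> T"
    using test_functions_add_cmult[OF test_functions_cmult[OF T(1), of "1/2"] T(2), of "1/2"] by simp
  show adm: "?w \<in> adm" using a w dirichlet_nonneg[of "\<lambda>x. \<phi> x - \<psi> x"] by (simp add: adm_def dirichlet_mid[OF T])
  note i1 = test_integrals[OF T(1)] and i2 = test_integrals[OF T(2)] and iw = test_integrals[OF w]
  have "(LINT x|M. F (?w x)) \<le> (LINT x|M. F (\<phi> x) / 2 + F (\<psi> x) / 2)"
    using i1 i2 iw F_mid by (intro integral_mono) auto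
  then have 1: "(LINT x|M. F (?w x)) \<le> (LINT x|M. F (\<phi> x)) / 2 + (LINT x|M. F (\<psi> x)) / 2"
    using i1 i2 by simp
  have 2: "(LINT x|M. h x * ?w x) = (LINT x|M. h x * \<phi> x) / 2 + (LINT x|M. h x * \<psi> x) / 2"
    using i1(3) i2(3) by (simp add: distrib_left)
  let ?d = "\<lambda>x. k (?w x) - k (\<phi> x) / 2 - k (\<psi> x) / 2"
  have "(LINT x|M. ?d x) = (LINT x|M. k (?w x)) - (LINT x|M. k (\<phi> x)) / 2 - (LINT x|M. k (\<psi> x)) / 2"
    using i1(2) i2(2) iw(2) by simp
  moreover have "- (LINT x|M. \<bar>?d x\<bar>) \<le> (LINT x|M. ?d x)" using integral_abs_bound[of M ?d] by linarith
  ultimately have 3: "- (LINT x|M. k (?w x)) \<le> (LINT x|M. \<bar>?d x\<bar>) - (LINT x|M. k (\<phi> x)) / 2 - (LINT x|M. k (\<psi> x)) / 2"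
    by linarith
  have "m \<le> J ?w" by (rule m_le[OF adm])
  then show "dirichlet (\<lambda>x. \<phi> x - \<psi> x) \<le> 4 * (J \<phi> - m) + 4 * (J \<psi> - m) + 8 * (LINT x|M. \<bar>?d x\<bar>)"
    unfolding energy_def dirichlet_mid[OF T] using 1 2 3 by (simp add: field_simps)
qed

text \<open>The pointwise modulus of \<open>k\<close> is integrated; its term of critical growth is small because the critical
  norm is bounded on the ball.\<close>

lemma subcritical_defect_small:
  assumes e: "\<epsilon> > 0"
  obtains c where "c \<ge> 0" "\<And>\<phi> \<psi>. \<phi> \<in> adm \<Longrightarrow> \<psi> \<in> adm \<Longrightarrow>
    (LINT x|M. \<bar>k (\<phi> x / 2 + \<psi> x / 2) - k (\<phi> x) / 2 - k (\<psi> x) / 2\<bar>) \<le> \<epsilon> + c * (LINT x|M. (\<phi> x - \<psi> x)\<^sup>2)"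
proof -
  obtain S where S: "S \<ge> 0" "\<And>\<phi>. \<phi> \<in> adm \<Longrightarrow> (LINT x|M. \<bar>\<phi> x\<bar> powr P) \<le> S" using adm_powr_bound by metis
  define \<mu> where "\<mu> = measure M (space M)"
  define \<delta> where "\<delta> = \<epsilon> / (\<mu> + 2 * S + 1)"
  have \<mu>: "\<mu> \<ge> 0" by (simp add: \<mu>_def)
  have \<delta>: "\<delta> > 0" using e S(1) \<mu> by (simp add: \<delta>_def)
  obtain B where "\<And>t. \<bar>t\<bar> \<ge> B \<Longrightarrow> \<bar>k t\<bar> \<le> \<delta> * \<bar>t\<bar> powr P" using k_sub[OF \<delta>] by blast
  then obtain c where c: "c \<ge> 0" "\<And>s t. \<bar>k s - k t\<bar> \<le> \<delta> * (1 + \<bar>s\<bar> powr P + \<bar>t\<bar> powr P) + c * (s - t)\<^sup>2"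
    using subcritical_modulus[OF k_cont \<delta>] by metis
  show ?thesis
  proof (rule that[of "c / 4"])
    fix \<phi> \<psi> assume a: "\<phi> \<in> adm" "\<psi> \<in> adm"
    let ?w = "\<lambda>x. \<phi> x / 2 + \<psi> x / 2"
    have wa: "?w \<in> adm" by (rule dirichlet_diff_le(2)[OF a])
    have T: "\<phi> \<in> T" "\<psi> \<in> T" "?w \<in> T" using a wa by (auto simp: adm_def)
    note iP = test_powr_integrable[OF T(1)] test_powr_integrable[OF T(2)] test_powr_integrable[OF T(3)]
    note i2 = test_square_integrals(1)[OF test_functions_diff[OF T(1,2)]]
    note ik = test_integrals(2)[OF T(1)] test_integrals(2)[OF T(2)] test_integrals(2)[OF T(3)]
    have pt: "\<bar>k (s / 2 + t / 2) - k s / 2 - k t / 2\<bar> \<le>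
      \<delta> * (1 + \<bar>s / 2 + t / 2\<bar> powr P + (\<bar>s\<bar> powr P + \<bar>t\<bar> powr P) / 2) + c / 4 * (s - t)\<^sup>2" for s t
    proof -
      have q: "(s / 2 + t / 2 - s)\<^sup>2 = (s - t)\<^sup>2 / 4" "(s / 2 + t / 2 - t)\<^sup>2 = (s - t)\<^sup>2 / 4"
        by (simp_all add: power2_eq_square field_simps)
      show ?thesis
        using c(2)[of "s / 2 + t / 2" s] c(2)[of "s / 2 + t / 2" t] unfolding q by (simp add: field_simps abs_if split: if_splits)
    qed
    have "(LINT x|M. \<bar>k (?w x) - k (\<phi> x) / 2 - k (\<psi> x) / 2\<bar>) \<le>
      (LINT x|M. \<delta> * (1 + \<bar>?w x\<bar> powr P + (\<bar>\<phi> x\<bar> powr P + \<bar>\<psi> x\<bar> powr P) / 2) + c / 4 * (\<phi> x - \<psi> x)\<^sup>2)"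
      using ik iP i2 pt by (intro integral_mono) auto
    also have "\<dots> = \<delta> * (\<mu> + (LINT x|M. \<bar>?w x\<bar> powr P) + ((LINT x|M. \<bar>\<phi> x\<bar> powr P) + (LINT x|M. \<bar>\<psi> x\<bar> powr P)) / 2)
      + c / 4 * (LINT x|M. (\<phi> x - \<psi> x)\<^sup>2)"
      using iP i2 by (simp add: \<mu>_def)
    also have "\<dots> \<le> \<delta> * (\<mu> + S + (S + S) / 2) + c / 4 * (LINT x|M. (\<phi> x - \<psi> x)\<^sup>2)"
    proof (rule add_right_mono, rule mult_left_mono)
      show "\<mu> + (LINT x|M. \<bar>?w x\<bar> powr P) + ((LINT x|M. \<bar>\<phi> x\<bar> powr P) + (LINT x|M. \<bar>\<psi> x\<bar> powr P)) / 2 \<le> \<mu> + S + (S + S) / 2"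
        by (intro add_mono order_refl divide_right_mono S(2) a wa) simp
    qed (use \<delta> in simp)
    also have "\<delta> * (\<mu> + S + (S + S) / 2) \<le> \<delta> * (\<mu> + 2 * S + 1)" using \<delta> by simp
    also have "\<dots> = \<epsilon>" using \<mu> S(1) unfolding \<delta>_def by simp
    finally show "(LINT x|M. \<bar>k (?w x) - k (\<phi> x) / 2 - k (\<psi> x) / 2\<bar>) \<le> \<epsilon> + c / 4 * (LINT x|M. (\<phi> x - \<psi> x)\<^sup>2)"
      by simp
  qed (use c in simp)
qed

text \<open>Rellich's theorem gives convergence in mean square, which makes the defect of the subcritical part
  small; the midpoint estimate then makes the gradients a Cauchy sequence.\<close>

lemma convergent_minimising_sequence:
  obtains \<psi> u g where "W_limit \<psi> u g" "\<And>j. \<psi> j \<in> adm" "(\<lambda>j. J (\<psi> j)) \<longlonglongrightarrow> m"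
proof -
  obtain \<phi> where \<phi>: "\<And>j. \<phi> j \<in> adm" "\<And>j. J (\<phi> j) < m + inverse (real (Suc j))"
    using minimising_sequence by blast
  then have "(LINT x|M. (norm (grad (\<phi> j) x))\<^sup>2) \<le> A1" "\<phi> j \<in> T" for j by (auto simp: adm_def dirichlet_def)
  then obtain \<sigma> :: "nat \<Rightarrow> nat" where \<sigma>: "strict_mono \<sigma>"
    and C2: "\<And>\<epsilon>. \<epsilon> > 0 \<Longrightarrow> \<exists>N. \<forall>i\<ge>N. \<forall>j\<ge>N. (LINT x|M. (\<phi> (\<sigma> i) x - \<phi> (\<sigma> j) x)\<^sup>2) < \<epsilon>"
    using test_Rellich[of \<phi> A1] by blast
  define \<psi> where "\<psi> j = \<phi> (\<sigma> j)" for j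
  have a: "\<psi> j \<in> adm" for j by (simp add: \<psi>_def \<phi>)
  then have T: "\<psi> j \<in> T" for j by (simp add: adm_def)
  have Jb: "J (\<psi> j) - m \<le> inverse (real (Suc j))" for j
  proof -
    have "inverse (real (Suc (\<sigma> j))) \<le> inverse (real (Suc j))"
      using seq_suble[OF \<sigma>, of j] by (intro le_imp_inverse_le) auto
    then show ?thesis using \<phi>(2)[of "\<sigma> j"] unfolding \<psi>_def by linarith
  qed
  have Jm: "m \<le> J (\<psi> j)" for j by (rule m_le[OF a])
  have Jl: "(\<lambda>j. J (\<psi> j)) \<longlonglongrightarrow> m"
  proof -
    have "(\<lambda>j. J (\<psi> j) - m) \<longlonglongrightarrow> 0"
      by (rule Lim_null_comparison[OF _ LIMSEQ_inverse_real_of_nat]) (use Jb Jm in \<open>simp add: always_eventually\<close>)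
    then show ?thesis by (rule LIM_zero_cancel)
  qed
  have CD: "\<exists>N. \<forall>i\<ge>N. \<forall>j\<ge>N. (LINT x|M. (norm (grad (\<psi> i) x - grad (\<psi> j) x))\<^sup>2) < \<epsilon>" if e: "\<epsilon> > 0" for \<epsilon>
  proof -
    have e4: "\<epsilon> / 32 > 0" using e by simp
    obtain c where c: "c \<ge> 0" "\<And>\<phi> \<psi>. \<phi> \<in> adm \<Longrightarrow> \<psi> \<in> adm \<Longrightarrow>
      (LINT x|M. \<bar>k (\<phi> x / 2 + \<psi> x / 2) - k (\<phi> x) / 2 - k (\<psi> x) / 2\<bar>) \<le> \<epsilon> / 32 + c * (LINT x|M. (\<phi> x - \<psi> x)\<^sup>2)"
      using subcritical_defect_small[OF e4] by blast
    have "\<epsilon> / (32 * (c + 1)) > 0" using e c(1) by (intro divide_pos_pos) auto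
    from C2[OF this] obtain N1 where N1: "\<And>i j. i \<ge> N1 \<Longrightarrow> j \<ge> N1 \<Longrightarrow> (LINT x|M. (\<psi> i x - \<psi> j x)\<^sup>2) < \<epsilon> / (32 * (c + 1))"
      unfolding \<psi>_def by blast
    have "\<forall>\<^sub>F j in sequentially. inverse (real (Suc j)) < \<epsilon> / 32"
      by (rule order_tendstoD(2)[OF LIMSEQ_inverse_real_of_nat e4])
    then obtain N2 where N2: "\<And>j. j \<ge> N2 \<Longrightarrow> inverse (real (Suc j)) < \<epsilon> / 32" by (auto simp: eventually_sequentially)
    show ?thesis
    proof (intro exI[of _ "max N1 N2"] allI impI)
      fix i j assume i: "max N1 N2 \<le> i" and j: "max N1 N2 \<le> j"
      let ?L = "LINT x|M. (\<psi> i x - \<psi> j x)\<^sup>2"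
      have "c * ?L \<le> (c + 1) * ?L" by (intro mult_right_mono) auto
      also have "\<dots> \<le> (c + 1) * (\<epsilon> / (32 * (c + 1)))" using N1[of i j] i j c(1) by (intro mult_left_mono) auto
      also have "\<dots> = \<epsilon> / 32" using c(1) by (simp add: divide_simps)
      finally have "c * ?L \<le> \<epsilon> / 32" .
      then have d: "(LINT x|M. \<bar>k (\<psi> i x / 2 + \<psi> j x / 2) - k (\<psi> i x) / 2 - k (\<psi> j x) / 2\<bar>) \<le> \<epsilon> / 16"
        using c(2)[OF a[of i] a[of j]] by linarith
      have J32: "J (\<psi> i) - m < \<epsilon> / 32" "J (\<psi> j) - m < \<epsilon> / 32"
        using Jb[of i] Jb[of j] N2[of i] N2[of j] i j by auto
      have "dirichlet (\<lambda>x. \<psi> i x - \<psi> j x) \<le> 4 * (J (\<psi> i) - m) + 4 * (J (\<psi> j) - m) + 8 * (\<epsilon> / 16)"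
        by (rule order_trans[OF dirichlet_diff_le(1)[OF a[of i] a[of j]]], intro add_left_mono mult_left_mono d) simp
      also have "\<dots> < 4 * (\<epsilon> / 32) + 4 * (\<epsilon> / 32) + 8 * (\<epsilon> / 16)"
        by (intro add_strict_right_mono add_strict_mono mult_strict_left_mono J32) simp_all
      also have "\<dots> < \<epsilon>" using e by simp
      finally have "dirichlet (\<lambda>x. \<psi> i x - \<psi> j x) < \<epsilon>" .
      then show "(LINT x|M. (norm (grad (\<psi> i) x - grad (\<psi> j) x))\<^sup>2) < \<epsilon>"
        by (simp add: dirichlet_def grad_add_cmult(3)[OF T T])
    qed
  qed
  have Cu: "\<exists>N. \<forall>i\<ge>N. \<forall>j\<ge>N. (LINT x|M. (norm (\<psi> i x - \<psi> j x))\<^sup>2) < \<epsilon>" if "\<epsilon> > 0" for \<epsilon>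
    using C2[OF that] by (simp add: \<psi>_def)
  note tm = test_measurable(3,4)[OF T] and t2 = test_square_integrals(1,2)[OF T]
  have t1: "integrable M (\<lambda>x. (norm (\<psi> j x))\<^sup>2)" for j using t2(1) by simp
  obtain u where u: "u \<in> borel_measurable M" "integrable M (\<lambda>x. (norm (u x))\<^sup>2)"
    "(\<lambda>j. LINT x|M. (norm (\<psi> j x - u x))\<^sup>2) \<longlonglongrightarrow> 0"
    using L2_complete[of \<psi> M, OF tm(1) t1 Cu] by blast
  obtain g where g: "g \<in> borel_measurable M" "integrable M (\<lambda>x. (norm (g x))\<^sup>2)"
    "(\<lambda>j. LINT x|M. (norm (grad (\<psi> j) x - g x))\<^sup>2) \<longlonglongrightarrow> 0"
    using L2_complete[of "\<lambda>j. grad (\<psi> j)" M, OF tm(2) t2(2) CD] by blast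
  have "W_limit \<psi> u g" unfolding W_limit_def using T u g by simp
  then show ?thesis using that a Jl by blast
qed

text \<open>The barrier keeps the minimising sequence away from the boundary of the admissible set, so
  small multiples of a test function may be added to it.\<close>

lemma minimiser_variation:
  obtains u g where "u \<in> W12_0 \<Omega>" "AE x in M. wgrad \<Omega> u x = g x"
    "g \<in> borel_measurable M" "integrable M (\<lambda>x. (norm (g x))\<^sup>2)"
    "u \<in> borel_measurable M" "integrable M (\<lambda>x. \<bar>u x\<bar> powr P)"
    "\<And>\<phi>. \<phi> \<in> T \<Longrightarrow> \<exists>t0>0. \<forall>t. \<bar>t\<bar> \<le> t0 \<longrightarrow>
       0 \<le> t * (LINT x|M. g x \<bullet> grad \<phi> x) + t\<^sup>2 / 2 * dirichlet \<phi>
          + (LINT x|M. (F (u x + t * \<phi> x) - k (u x + t * \<phi> x)) - (F (u x) - k (u x))) - t * (LINT x|M. h x * \<phi> x)"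
proof -
  obtain w0 u g where l0: "W_limit w0 u g" and a0: "\<And>j. w0 j \<in> adm" and J0: "(\<lambda>j. J (w0 j)) \<longlonglongrightarrow> m"
    using convergent_minimising_sequence by blast
  obtain r H where r: "strict_mono (r :: nat \<Rightarrow> nat)" and H: "integrable M H" and uP: "integrable M (\<lambda>x. \<bar>u x\<bar> powr P)"
    and ptu: "AE x in M. (\<lambda>j. w0 (r j) x) \<longlonglongrightarrow> u x" and ptg: "AE x in M. (\<lambda>j. grad (w0 (r j)) x) \<longlonglongrightarrow> g x"
    and Hu: "AE x in M. \<forall>j. \<bar>w0 (r j) x\<bar> powr P \<le> H x" and Hg: "AE x in M. \<forall>j. (norm (grad (w0 (r j)) x))\<^sup>2 \<le> H x"
    using W_limit_dominated[OF l0] by blast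
  define w where "w j = w0 (r j)" for j
  have a: "w j \<in> adm" and T: "w j \<in> T" for j using a0 by (auto simp: w_def adm_def)
  have Jl: "(\<lambda>j. J (w j)) \<longlonglongrightarrow> m" using LIMSEQ_subseq_LIMSEQ[OF J0 r] by (simp add: w_def o_def)
  note pt = ptu[folded w_def] ptg[folded w_def] and dom = Hu[folded w_def] Hg[folded w_def]
  have u [measurable]: "u \<in> borel_measurable M" and g [measurable]: "g \<in> borel_measurable M" and g2: "integrable M (\<lambda>x. (norm (g x))\<^sup>2)"
    using l0 by (auto simp: W_limit_def)
  have [measurable]: "F \<in> borel_measurable borel" "k \<in> borel_measurable borel"
    using F_cont k_cont borel_measurable_continuous_onI by blast+
  have [measurable]: "h \<in> borel_measurable M" by (rule h_meas)
  note wm [measurable] = test_measurable(3,4)[OF T]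
  define \<Lambda> where "\<Lambda> t = F t - k t" for t
  have \<Lambda>c: "continuous_on UNIV \<Lambda>" unfolding \<Lambda>_def[abs_def] by (intro continuous_intros F_cont k_cont)
  have [measurable]: "\<Lambda> \<in> borel_measurable borel" using \<Lambda>c by (rule borel_measurable_continuous_onI)
  have \<Lambda>g: "\<bar>\<Lambda> t\<bar> \<le> 2 * C * (1 + \<bar>t\<bar> powr P)" for t
    unfolding \<Lambda>_def using F_growth[of t] k_growth[of t] abs_triangle_ineq4[of "F t" "k t"] by linarith
  define Q where "Q \<phi> t = (LINT x|M. (norm (g x + t *\<^sub>R grad \<phi> x))\<^sup>2) / 2 + (LINT x|M. \<Lambda> (u x + t * \<phi> x))
     - (LINT x|M. h x * (u x + t * \<phi> x))" for \<phi> t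
  have lim: "(\<lambda>j. J (\<lambda>x. w j x + t * \<phi> x)) \<longlonglongrightarrow> Q \<phi> t"
    and int: "integrable M (\<lambda>x. \<Lambda> (u x + t * \<phi> x))" "integrable M (\<lambda>x. h x * (u x + t * \<phi> x))"
    if \<phi>: "\<phi> \<in> T" for \<phi> t
  proof -
    obtain B where B: "B > 0" "\<And>x. \<bar>\<phi> x\<bar> \<le> B" "\<And>x. norm (grad \<phi> x) \<le> B" using test_bounded[OF \<phi>] by blast
    note [measurable] = test_measurable(3,4)[OF \<phi>]
    have wT: "(\<lambda>x. w j x + t * \<phi> x) \<in> T" for j by (rule test_functions_add_cmult[OF T \<phi>])
    define K where "K = 2 powr P * (\<bar>t\<bar> * B) powr P"
    have bound: "\<bar>y + t * \<phi> x\<bar> powr P \<le> 2 powr P * \<bar>y\<bar> powr P + K" for y x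
    proof -
      have "\<bar>t * \<phi> x\<bar> powr P \<le> (\<bar>t\<bar> * B) powr P"
        using B(2)[of x] P_gt_2 by (intro powr_mono2) (auto simp: abs_mult intro: mult_left_mono)
      then have "2 powr P * \<bar>t * \<phi> x\<bar> powr P \<le> K" unfolding K_def by (rule mult_left_mono) simp
      then show ?thesis using abs_add_powr_le[of P y "t * \<phi> x"] P_gt_2 by (simp add: distrib_left)
    qed
    have uP': "integrable M (\<lambda>x. \<bar>u x + t * \<phi> x\<bar> powr P)"
    proof (rule Bochner_Integration.integrable_bound)
      show "integrable M (\<lambda>x. 2 powr P * \<bar>u x\<bar> powr P + K)" using uP by simp
      show "AE x in M. norm (\<bar>u x + t * \<phi> x\<bar> powr P) \<le> norm (2 powr P * \<bar>u x\<bar> powr P + K)"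
      proof (rule AE_I2)
        fix x
        show "norm (\<bar>u x + t * \<phi> x\<bar> powr P) \<le> norm (2 powr P * \<bar>u x\<bar> powr P + K)"
          using bound[of "u x" x] by (simp add: K_def)
      qed
    qed measurable
    show "integrable M (\<lambda>x. \<Lambda> (u x + t * \<phi> x))"
      by (rule growth_integrable[OF \<Lambda>c \<Lambda>g _ uP']) measurable
    show "integrable M (\<lambda>x. h x * (u x + t * \<phi> x))"
      by (rule dual_product_integrable(1)[OF h_meas _ h_int uP']) measurable
    have 1: "(\<lambda>j. LINT x|M. (norm (grad (w j) x + t *\<^sub>R grad \<phi> x))\<^sup>2) \<longlonglongrightarrow> (LINT x|M. (norm (g x + t *\<^sub>R grad \<phi> x))\<^sup>2)"
    proof (rule integral_dominated_convergence[where w = "\<lambda>x. 2 * H x + 2 * (\<bar>t\<bar> * B)\<^sup>2"])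
      show "integrable M (\<lambda>x. 2 * H x + 2 * (\<bar>t\<bar> * B)\<^sup>2)" using H by simp
      show "AE x in M. (\<lambda>j. (norm (grad (w j) x + t *\<^sub>R grad \<phi> x))\<^sup>2) \<longlonglongrightarrow> (norm (g x + t *\<^sub>R grad \<phi> x))\<^sup>2"
        using pt(2) by eventually_elim (intro tendsto_intros)
      show "AE x in M. norm ((norm (grad (w j) x + t *\<^sub>R grad \<phi> x))\<^sup>2) \<le> 2 * H x + 2 * (\<bar>t\<bar> * B)\<^sup>2" for j
        using dom(2)
      proof eventually_elim
        case (elim x)
        have "norm (t *\<^sub>R grad \<phi> x) \<le> \<bar>t\<bar> * B" using B(3)[of x] by (simp add: mult_left_mono)
        then have "(norm (t *\<^sub>R grad \<phi> x))\<^sup>2 \<le> (\<bar>t\<bar> * B)\<^sup>2" by (intro power_mono) auto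
        then show ?case
          using norm_diff_square_le[of "grad (w j) x" "- (t *\<^sub>R grad \<phi> x)" 0] elim[rule_format, of j] by simp
      qed
    qed measurable
    have 2: "(\<lambda>j. LINT x|M. \<Lambda> (w j x + t * \<phi> x)) \<longlonglongrightarrow> (LINT x|M. \<Lambda> (u x + t * \<phi> x))"
    proof (rule integral_dominated_convergence[where w = "\<lambda>x. 2 * C * (1 + (2 powr P * H x + K))"])
      show "integrable M (\<lambda>x. 2 * C * (1 + (2 powr P * H x + K)))" using H by simp
      show "AE x in M. (\<lambda>j. \<Lambda> (w j x + t * \<phi> x)) \<longlonglongrightarrow> \<Lambda> (u x + t * \<phi> x)"
        using pt(1)
      proof eventually_elim
        case (elim x)
        have "(\<lambda>j. w j x + t * \<phi> x) \<longlonglongrightarrow> u x + t * \<phi> x" by (intro tendsto_intros elim)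
        then show ?case
          by (rule continuous_on_tendsto_compose[OF \<Lambda>c]) auto
      qed
      show "AE x in M. norm (\<Lambda> (w j x + t * \<phi> x)) \<le> 2 * C * (1 + (2 powr P * H x + K))" for j
        using dom(1)
      proof eventually_elim
        case (elim x)
        have "2 powr P * \<bar>w j x\<bar> powr P \<le> 2 powr P * H x" by (intro mult_left_mono elim[rule_format]) simp
        then have "\<bar>w j x + t * \<phi> x\<bar> powr P \<le> 2 powr P * H x + K" using bound[of "w j x" x] by linarith
        then have "2 * C * (1 + \<bar>w j x + t * \<phi> x\<bar> powr P) \<le> 2 * C * (1 + (2 powr P * H x + K))"
          using C_pos by (intro mult_left_mono) auto
        then show ?case using \<Lambda>g[of "w j x + t * \<phi> x"] by simp
      qed
    qed measurable
    have 3: "(\<lambda>j. LINT x|M. h x * (w j x + t * \<phi> x)) \<longlonglongrightarrow> (LINT x|M. h x * (u x + t * \<phi> x))"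
    proof (rule integral_dominated_convergence[where w = "\<lambda>x. \<bar>h x\<bar> powr P' + (2 powr P * H x + K)"])
      show "integrable M (\<lambda>x. \<bar>h x\<bar> powr P' + (2 powr P * H x + K))" using H h_int by simp
      show "AE x in M. (\<lambda>j. h x * (w j x + t * \<phi> x)) \<longlonglongrightarrow> h x * (u x + t * \<phi> x)"
        using pt(1) by eventually_elim (intro tendsto_intros)
      show "AE x in M. norm (h x * (w j x + t * \<phi> x)) \<le> \<bar>h x\<bar> powr P' + (2 powr P * H x + K)" for j
        using dom(1)
      proof eventually_elim
        case (elim x)
        have "2 powr P * \<bar>w j x\<bar> powr P \<le> 2 powr P * H x" by (intro mult_left_mono elim[rule_format]) simp
        then have "\<bar>w j x + t * \<phi> x\<bar> powr P \<le> 2 powr P * H x + K" using bound[of "w j x" x] by linarith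
        then show ?case using Young_P[of "h x" "w j x + t * \<phi> x"] unfolding real_norm_def by linarith
      qed
    qed measurable
    have Jw: "J (\<lambda>x. w j x + t * \<phi> x) = (LINT x|M. (norm (grad (w j) x + t *\<^sub>R grad \<phi> x))\<^sup>2) / 2
        + (LINT x|M. \<Lambda> (w j x + t * \<phi> x)) - (LINT x|M. h x * (w j x + t * \<phi> x))" for j
      unfolding energy_def dirichlet_def grad_add_cmult(1)[OF T \<phi>] \<Lambda>_def
      using test_integrals(1,2)[OF wT] by simp
    show "(\<lambda>j. J (\<lambda>x. w j x + t * \<phi> x)) \<longlonglongrightarrow> Q \<phi> t"
      unfolding Jw Q_def by (intro tendsto_intros 1 2 3) simp
  qed
  have Q0: "Q \<phi> 0 = m" if "\<phi> \<in> T" for \<phi>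
    using LIMSEQ_unique[OF lim[OF that, of 0]] Jl by simp
  have var: "\<exists>t0>0. \<forall>t. \<bar>t\<bar> \<le> t0 \<longrightarrow> m \<le> Q \<phi> t" if \<phi>: "\<phi> \<in> T" for \<phi>
  proof -
    \<comment> \<open>\<open>Q \<phi>\<close> extends the energy to the limit; \<open>t0\<close> is such that a variation by \<open>t0 \<phi>\<close> cannot cross the shell\<close>
    define t0 where "t0 = min 1 ((A1 - A0) / (A0 + 2 * dirichlet \<phi> + 1))"
    have den: "A0 + 2 * dirichlet \<phi> + 1 > 0" using A dirichlet_nonneg[of \<phi>] by simp
    have t0: "t0 > 0" using A den by (simp add: t0_def)
    have inner: "\<forall>\<^sub>F j in sequentially. dirichlet (w j) < A0"
    proof -
      have "m < \<eta>" using m_nonpos \<eta> by simp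
      from order_tendstoD(2)[OF Jl this] show ?thesis
      proof eventually_elim
        case (elim j)
        show ?case
        proof (rule ccontr)
          assume "\<not> dirichlet (w j) < A0"
          then have "J (w j) \<ge> \<eta>" using barrier[OF T[of j]] a[of j] by (simp add: adm_def)
          then show False using elim by simp
        qed
      qed
    qed
    have "m \<le> Q \<phi> t" if t: "\<bar>t\<bar> \<le> t0" for t
    proof (rule tendsto_lowerbound[OF lim[OF \<phi>, of t]])
      show "\<forall>\<^sub>F j in sequentially. m \<le> J (\<lambda>x. w j x + t * \<phi> x)"
        using inner
      proof eventually_elim
        case (elim j)
        have t1: "\<bar>t\<bar> \<le> 1" using t by (simp add: t0_def)
        note i = test_square_integrals(2)[OF T[of j]] test_square_integrals(2)[OF \<phi>]
        have wT: "(\<lambda>x. w j x + t * \<phi> x) \<in> T" by (rule test_functions_add_cmult[OF T \<phi>])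
        have pt: "(norm (p + t *\<^sub>R q))\<^sup>2 \<le> (norm p)\<^sup>2 + \<bar>t\<bar> * ((norm p)\<^sup>2 + 2 * (norm q)\<^sup>2)" for p q :: "real^'n"
        proof -
          have "(norm (p + t *\<^sub>R q))\<^sup>2 \<le> (norm p + \<bar>t\<bar> * norm q)\<^sup>2"
            using norm_triangle_ineq[of p "t *\<^sub>R q"] by (intro power_mono) auto
          also have "\<dots> = (norm p)\<^sup>2 + \<bar>t\<bar> * (2 * norm p * norm q) + \<bar>t\<bar> * (\<bar>t\<bar> * (norm q)\<^sup>2)"
            by (simp add: power2_eq_square algebra_simps)
          also have "\<dots> \<le> (norm p)\<^sup>2 + \<bar>t\<bar> * ((norm p)\<^sup>2 + (norm q)\<^sup>2) + \<bar>t\<bar> * (1 * (norm q)\<^sup>2)"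
          proof (intro add_mono mult_left_mono mult_right_mono)
            show "2 * norm p * norm q \<le> (norm p)\<^sup>2 + (norm q)\<^sup>2" using sum_squares_bound[of "norm p" "norm q"] by simp
          qed (use t1 in auto)
          finally show ?thesis by (simp add: algebra_simps)
        qed
        have "dirichlet (\<lambda>x. w j x + t * \<phi> x) \<le> (LINT x|M. (norm (grad (w j) x))\<^sup>2 + \<bar>t\<bar> * ((norm (grad (w j) x))\<^sup>2 + 2 * (norm (grad \<phi> x))\<^sup>2))"
          unfolding dirichlet_def using test_square_integrals(2)[OF wT] i
          by (intro integral_mono) (auto simp: grad_add_cmult(1)[OF T \<phi>] pt)
        also have "\<dots> = dirichlet (w j) + \<bar>t\<bar> * (dirichlet (w j) + 2 * dirichlet \<phi>)"
          unfolding dirichlet_def using i by simp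
        also have "\<dots> \<le> A0 + \<bar>t\<bar> * (A0 + 2 * dirichlet \<phi> + 1)"
          using elim mult_left_mono[of "dirichlet (w j) + 2 * dirichlet \<phi>" "A0 + 2 * dirichlet \<phi> + 1" "\<bar>t\<bar>"] by simp
        also have "\<dots> \<le> A0 + (A1 - A0) / (A0 + 2 * dirichlet \<phi> + 1) * (A0 + 2 * dirichlet \<phi> + 1)"
          using t den by (intro add_left_mono mult_right_mono) (auto simp: t0_def)
        also have "\<dots> = A1" using den by simp
        finally show ?case using wT by (intro m_le) (simp add: adm_def)
      qed
    qed simp
    then show ?thesis using t0 by blast
  qed
  show ?thesis
  proof (rule that[of u g])
    show "u \<in> W12_0 \<Omega>" "AE x in M. wgrad \<Omega> u x = g x" using W12_0_if_W_limit[OF l0] by auto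
    fix \<phi> assume \<phi>: "\<phi> \<in> T"
    obtain t0 where t0: "t0 > 0" "\<And>t. \<bar>t\<bar> \<le> t0 \<Longrightarrow> m \<le> Q \<phi> t" using var[OF \<phi>] by blast
    note \<phi>m [measurable] = test_measurable(3,4)[OF \<phi>] and \<phi>2 = test_square_integrals(2)[OF \<phi>]
    have gp: "integrable M (\<lambda>x. g x \<bullet> grad \<phi> x)"
      by (rule integrable_inner_L2[OF g \<phi>m(2) g2 \<phi>2])
    have diff: "Q \<phi> t - Q \<phi> 0 = t * (LINT x|M. g x \<bullet> grad \<phi> x) + t\<^sup>2 / 2 * dirichlet \<phi>
          + (LINT x|M. \<Lambda> (u x + t * \<phi> x) - \<Lambda> (u x)) - t * (LINT x|M. h x * \<phi> x)" for t
    proof -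
      have "(LINT x|M. (norm (g x + t *\<^sub>R grad \<phi> x))\<^sup>2) = (LINT x|M. (norm (g x))\<^sup>2 + (2 * t) * (g x \<bullet> grad \<phi> x) + t\<^sup>2 * (norm (grad \<phi> x))\<^sup>2)"
      proof (rule Bochner_Integration.integral_cong[OF refl])
        show "(norm (g x + t *\<^sub>R grad \<phi> x))\<^sup>2 = (norm (g x))\<^sup>2 + (2 * t) * (g x \<bullet> grad \<phi> x) + t\<^sup>2 * (norm (grad \<phi> x))\<^sup>2" for x
          unfolding power2_norm_eq_inner by (simp add: inner_add inner_commute power2_eq_square algebra_simps)
      qed
      also have "\<dots> = (LINT x|M. (norm (g x))\<^sup>2) + (2 * t) * (LINT x|M. g x \<bullet> grad \<phi> x) + t\<^sup>2 * dirichlet \<phi>"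
        unfolding dirichlet_def using g2 gp \<phi>2 by simp
      finally have 1: "(LINT x|M. (norm (g x + t *\<^sub>R grad \<phi> x))\<^sup>2) = (LINT x|M. (norm (g x))\<^sup>2) + (2 * t) * (LINT x|M. g x \<bullet> grad \<phi> x) + t\<^sup>2 * dirichlet \<phi>" .
      have 2: "(LINT x|M. \<Lambda> (u x + t * \<phi> x) - \<Lambda> (u x)) = (LINT x|M. \<Lambda> (u x + t * \<phi> x)) - (LINT x|M. \<Lambda> (u x))"
        using int(1)[OF \<phi>, of t] int(1)[OF \<phi>, of 0] by simp
      have 3: "(LINT x|M. h x * (u x + t * \<phi> x)) = (LINT x|M. h x * u x) + t * (LINT x|M. h x * \<phi> x)"
      proof -
        have "(LINT x|M. h x * (u x + t * \<phi> x)) = (LINT x|M. h x * u x + t * (h x * \<phi> x))"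
          by (simp add: algebra_simps)
        then show ?thesis using int(2)[OF \<phi>, of 0] test_integrals(3)[OF \<phi>] by simp
      qed
      show ?thesis unfolding Q_def 1 2 3 by (simp add: field_simps)
    qed
    show "\<exists>t0>0. \<forall>t. \<bar>t\<bar> \<le> t0 \<longrightarrow>
       0 \<le> t * (LINT x|M. g x \<bullet> grad \<phi> x) + t\<^sup>2 / 2 * dirichlet \<phi>
          + (LINT x|M. (F (u x + t * \<phi> x) - k (u x + t * \<phi> x)) - (F (u x) - k (u x))) - t * (LINT x|M. h x * \<phi> x)"
    proof (intro exI[of _ t0] conjI allI impI t0(1))
      fix t assume "\<bar>t\<bar> \<le> t0"
      then have "0 \<le> Q \<phi> t - Q \<phi> 0" using t0(2) Q0[OF \<phi>] by simp
      then show "0 \<le> t * (LINT x|M. g x \<bullet> grad \<phi> x) + t\<^sup>2 / 2 * dirichlet \<phi>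
          + (LINT x|M. (F (u x + t * \<phi> x) - k (u x + t * \<phi> x)) - (F (u x) - k (u x))) - t * (LINT x|M. h x * \<phi> x)"
        unfolding diff \<Lambda>_def .
    qed
  qed (use u g g2 uP in auto)
qed

end

section \<open>The Euler-Lagrange equation\<close>

lemma powr_le_one_add:
  fixes y :: real
  assumes "0 \<le> y" "0 \<le> r" "r \<le> p"
  shows "y powr r \<le> 1 + y powr p"
proof (cases "y \<le> 1")
  case True
  then have "y powr r \<le> 1 powr r" using assms by (intro powr_mono2) auto
  then show ?thesis by (simp add: add_increasing2)
next
  case False
  then have "y powr r \<le> y powr p" using assms by (intro powr_mono) auto
  then show ?thesis by simp
qed

lemma mean_value_increment:
  fixes f f' :: "real \<Rightarrow> real"
  assumes d: "\<And>t. (f has_real_derivative f' t) (at t)"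
  shows "\<exists>z. \<bar>z\<bar> \<le> \<bar>a\<bar> + \<bar>y\<bar> \<and> f (a + y) - f a = y * f' z"
proof -
  consider "y > 0" | "y < 0" | "y = 0" by linarith
  then show ?thesis
  proof cases
    case 1
    then obtain z where "a < z" "z < a + y" "f (a + y) - f a = (a + y - a) * f' z"
      using MVT2[of a "a + y" f f'] d by auto
    then show ?thesis by (intro exI[of _ z]) auto
  next
    case 2
    then obtain z where "a + y < z" "z < a" "f a - f (a + y) = (a - (a + y)) * f' z"
      using MVT2[of "a + y" a f f'] d by auto
    then show ?thesis by (intro exI[of _ z]) auto
  next
    case 3
    then show ?thesis by (intro exI[of _ a]) auto
  qed
qed

context variational_problem
begin

text \<open>Since \<open>\<phi>\<close> is bounded, the mean value theorem bounds the difference quotients by a multiple of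
  \<open>1 + \<bar>u\<bar> powr P\<close>.\<close>

lemma difference_quotient_integral_limit:
  assumes [measurable]: "u \<in> borel_measurable M" and uP: "integrable M (\<lambda>x. \<bar>u x\<bar> powr P)" and \<phi>: "\<phi> \<in> T"
  defines "t \<equiv> \<lambda>j. inverse (real (Suc j))"
  shows "(\<lambda>j. LINT x|M. ((F (u x + t j * \<phi> x) - k (u x + t j * \<phi> x)) - (F (u x) - k (u x))) / t j)
     \<longlonglongrightarrow> (LINT x|M. \<Gamma> (u x) * \<phi> x)"
proof -
  obtain B where B: "B > 0" "\<And>x. \<bar>\<phi> x\<bar> \<le> B" "\<And>x. norm (grad \<phi> x) \<le> B" using test_bounded[OF \<phi>] by blast
  note [measurable] = test_measurable(3)[OF \<phi>]
  have [measurable]: "F \<in> borel_measurable borel" "k \<in> borel_measurable borel" "\<Gamma> \<in> borel_measurable borel"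
    by (rule borel_measurable_continuous_onI; rule F_cont k_cont \<Gamma>_cont)+
  have t: "t j > 0" "t j \<le> 1" for j by (auto simp: t_def field_simps)
  define W where "W x = C * (1 + (1 + 2 powr P * (\<bar>u x\<bar> powr P + B powr P))) * B" for x
  show ?thesis
  proof (rule integral_dominated_convergence[where w = W])
    show "integrable M W" unfolding W_def using uP by simp
    show "AE x in M. (\<lambda>j. ((F (u x + t j * \<phi> x) - k (u x + t j * \<phi> x)) - (F (u x) - k (u x))) / t j) \<longlonglongrightarrow> \<Gamma> (u x) * \<phi> x"
    proof (rule AE_I2)
      fix x
      have "((\<lambda>s. u x + s * \<phi> x) has_real_derivative \<phi> x) (at 0)"
        by (auto intro!: derivative_eq_intros)
      from DERIV_chain2[OF _ this, of "\<lambda>t. F t - k t" "\<Gamma> (u x)"]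
      have "((\<lambda>s. F (u x + s * \<phi> x) - k (u x + s * \<phi> x)) has_real_derivative \<Gamma> (u x) * \<phi> x) (at 0)"
        using \<Gamma>_deriv[of "u x"] by simp
      then have "((\<lambda>s. ((F (u x + s * \<phi> x) - k (u x + s * \<phi> x)) - (F (u x) - k (u x))) / s) \<longlongrightarrow> \<Gamma> (u x) * \<phi> x) (at 0)"
        unfolding DERIV_def by simp
      moreover have "filterlim t (at 0) sequentially"
        unfolding t_def by (rule filterlim_inverse_Suc_at_0)
      ultimately show "(\<lambda>j. ((F (u x + t j * \<phi> x) - k (u x + t j * \<phi> x)) - (F (u x) - k (u x))) / t j) \<longlonglongrightarrow> \<Gamma> (u x) * \<phi> x"
        by (rule filterlim_compose)
    qed
    show "AE x in M. norm (((F (u x + t j * \<phi> x) - k (u x + t j * \<phi> x)) - (F (u x) - k (u x))) / t j) \<le> W x" for j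
    proof (rule AE_I2)
      fix x
      obtain z where z: "\<bar>z\<bar> \<le> \<bar>u x\<bar> + \<bar>t j * \<phi> x\<bar>"
        "(F (u x + t j * \<phi> x) - k (u x + t j * \<phi> x)) - (F (u x) - k (u x)) = t j * \<phi> x * \<Gamma> z"
        using mean_value_increment[of "\<lambda>t. F t - k t" \<Gamma> "u x" "t j * \<phi> x", OF \<Gamma>_deriv] by blast
      have "\<bar>t j * \<phi> x\<bar> \<le> 1 * B" unfolding abs_mult using t[of j] B(2)[of x] by (intro mult_mono) auto
      then have "\<bar>z\<bar> \<le> \<bar>u x\<bar> + B" using z(1) by linarith
      then have "\<bar>z\<bar> powr P \<le> \<bar>\<bar>u x\<bar> + B\<bar> powr P" using P_gt_2 B(1) by (intro powr_mono2) auto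
      also have "\<dots> \<le> 2 powr P * (\<bar>u x\<bar> powr P + B powr P)"
        using abs_add_powr_le[of P "\<bar>u x\<bar>" B] P_gt_2 B(1) by simp
      finally have "\<bar>z\<bar> powr (P - 1) \<le> 1 + 2 powr P * (\<bar>u x\<bar> powr P + B powr P)"
        using powr_le_one_add[of "\<bar>z\<bar>" "P - 1" P] P_gt_2 by simp
      then have "C * (1 + \<bar>z\<bar> powr (P - 1)) \<le> C * (1 + (1 + 2 powr P * (\<bar>u x\<bar> powr P + B powr P)))"
        using C_pos by (intro mult_left_mono) auto
      with \<Gamma>_growth[of z] have G: "\<bar>\<Gamma> z\<bar> \<le> C * (1 + (1 + 2 powr P * (\<bar>u x\<bar> powr P + B powr P)))" by linarith
      have "norm (((F (u x + t j * \<phi> x) - k (u x + t j * \<phi> x)) - (F (u x) - k (u x))) / t j) = \<bar>\<Gamma> z\<bar> * \<bar>\<phi> x\<bar>"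
        unfolding z(2) using t(1)[of j] by (simp add: abs_mult)
      also have "\<dots> \<le> W x" unfolding W_def using G B C_pos by (intro mult_mono) auto
      finally show "norm (((F (u x + t j * \<phi> x) - k (u x + t j * \<phi> x)) - (F (u x) - k (u x))) / t j) \<le> W x" .
    qed
  qed measurable
qed

lemma dual_integrable_add:
  assumes [measurable]: "p \<in> borel_measurable M" "q \<in> borel_measurable M"
    and "integrable M (\<lambda>x. \<bar>p x\<bar> powr P')" "integrable M (\<lambda>x. \<bar>q x\<bar> powr P')"
  shows "integrable M (\<lambda>x. \<bar>p x + q x\<bar> powr P')"
proof (rule Bochner_Integration.integrable_bound)
  show "integrable M (\<lambda>x. 2 powr P' * (\<bar>p x\<bar> powr P' + \<bar>q x\<bar> powr P'))" using assms by simp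
  show "AE x in M. norm (\<bar>p x + q x\<bar> powr P') \<le> norm (2 powr P' * (\<bar>p x\<bar> powr P' + \<bar>q x\<bar> powr P'))"
    using abs_add_powr_le[of P'] dual_exponent by (intro AE_I2) simp
qed measurable

text \<open>The one-sided derivative of the energy at the minimiser is nonnegative for \<open>\<phi>\<close> and for \<open>- \<phi>\<close>, which is the
  weak equation for test functions. The right-hand side \<open>\<zeta>\<close> has a finite dual norm, so both
  sides pass to the limit along test functions approximating \<open>v\<close>.\<close>
theorem weak_solution_exists:
  "\<exists>u. weak_solution \<Omega> (\<lambda>x t. h x - \<Gamma> t) u"
proof -
  obtain u g where u0: "u \<in> W12_0 \<Omega>" and gu: "AE x in M. wgrad \<Omega> u x = g x"
    and g [measurable]: "g \<in> borel_measurable M" and g2: "integrable M (\<lambda>x. (norm (g x))\<^sup>2)"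
    and u [measurable]: "u \<in> borel_measurable M" and uP: "integrable M (\<lambda>x. \<bar>u x\<bar> powr P)"
    and var: "\<And>\<phi>. \<phi> \<in> T \<Longrightarrow> \<exists>t0>0. \<forall>t. \<bar>t\<bar> \<le> t0 \<longrightarrow>
       0 \<le> t * (LINT x|M. g x \<bullet> grad \<phi> x) + t\<^sup>2 / 2 * dirichlet \<phi>
          + (LINT x|M. (F (u x + t * \<phi> x) - k (u x + t * \<phi> x)) - (F (u x) - k (u x))) - t * (LINT x|M. h x * \<phi> x)"
    using minimiser_variation by blast
  have [measurable]: "\<Gamma> \<in> borel_measurable borel" "h \<in> borel_measurable M"
    by (rule borel_measurable_continuous_onI[OF \<Gamma>_cont], rule h_meas)
  define L where "L \<phi> = (LINT x|M. g x \<bullet> grad \<phi> x) + (LINT x|M. \<Gamma> (u x) * \<phi> x) - (LINT x|M. h x * \<phi> x)" for \<phi>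
  have L_nonneg: "0 \<le> L \<phi>" if \<phi>: "\<phi> \<in> T" for \<phi>
  proof -
    define t where "t j = inverse (real (Suc j))" for j
    have t: "t j > 0" for j by (simp add: t_def)
    have tl: "t \<longlonglongrightarrow> 0" unfolding t_def[abs_def] by (rule LIMSEQ_inverse_real_of_nat)
    let ?q = "\<lambda>j. (LINT x|M. ((F (u x + t j * \<phi> x) - k (u x + t j * \<phi> x)) - (F (u x) - k (u x))) / t j)"
    have "(\<lambda>j. (LINT x|M. g x \<bullet> grad \<phi> x) + t j / 2 * dirichlet \<phi> + ?q j - (LINT x|M. h x * \<phi> x))
      \<longlonglongrightarrow> (LINT x|M. g x \<bullet> grad \<phi> x) + 0 / 2 * dirichlet \<phi> + (LINT x|M. \<Gamma> (u x) * \<phi> x) - (LINT x|M. h x * \<phi> x)"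
      using difference_quotient_integral_limit[OF u uP \<phi>] tl unfolding t_def[symmetric]
      by (intro tendsto_intros) auto
    then have lim: "(\<lambda>j. (LINT x|M. g x \<bullet> grad \<phi> x) + t j / 2 * dirichlet \<phi> + ?q j - (LINT x|M. h x * \<phi> x)) \<longlonglongrightarrow> L \<phi>"
      by (simp add: L_def)
    obtain t0 where t0: "t0 > 0" "\<And>t. \<bar>t\<bar> \<le> t0 \<Longrightarrow>
       0 \<le> t * (LINT x|M. g x \<bullet> grad \<phi> x) + t\<^sup>2 / 2 * dirichlet \<phi>
          + (LINT x|M. (F (u x + t * \<phi> x) - k (u x + t * \<phi> x)) - (F (u x) - k (u x))) - t * (LINT x|M. h x * \<phi> x)"
      using var[OF \<phi>] by blast
    show ?thesis
    proof (rule tendsto_lowerbound[OF lim])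
      show "\<forall>\<^sub>F j in sequentially. 0 \<le> (LINT x|M. g x \<bullet> grad \<phi> x) + t j / 2 * dirichlet \<phi> + ?q j - (LINT x|M. h x * \<phi> x)"
        using order_tendstoD(2)[OF tl t0(1)]
      proof eventually_elim
        case (elim j)
        let ?I = "LINT x|M. (F (u x + t j * \<phi> x) - k (u x + t j * \<phi> x)) - (F (u x) - k (u x))"
        have "0 \<le> (t j * (LINT x|M. g x \<bullet> grad \<phi> x) + (t j)\<^sup>2 / 2 * dirichlet \<phi> + ?I - t j * (LINT x|M. h x * \<phi> x)) / t j"
          using t0(2)[of "t j"] elim t[of j] by simp
        also have "\<dots> = (LINT x|M. g x \<bullet> grad \<phi> x) + t j / 2 * dirichlet \<phi> + ?I / t j - (LINT x|M. h x * \<phi> x)"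
          using t[of j] by (simp add: field_simps power2_eq_square)
        also have "?I / t j = ?q j" by simp
        finally show ?case .
      qed
    qed simp
  qed
  define \<zeta> where "\<zeta> x = h x - \<Gamma> (u x)" for x
  have \<zeta>m [measurable]: "\<zeta> \<in> borel_measurable M" unfolding \<zeta>_def[abs_def] by measurable
  have \<zeta>P: "integrable M (\<lambda>x. \<bar>\<zeta> x\<bar> powr P')"
  proof -
    have "integrable M (\<lambda>x. \<bar>- \<Gamma> (u x)\<bar> powr P')"
    proof (rule Bochner_Integration.integrable_bound)
      show "integrable M (\<lambda>x. C powr P' * (2 powr P' * (1 + \<bar>u x\<bar> powr P)))" using uP by simp
      show "AE x in M. norm (\<bar>- \<Gamma> (u x)\<bar> powr P') \<le> norm (C powr P' * (2 powr P' * (1 + \<bar>u x\<bar> powr P)))"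
      proof (rule AE_I2)
        fix x
        have "\<bar>\<Gamma> (u x)\<bar> powr P' \<le> (C * (1 + \<bar>u x\<bar> powr (P - 1))) powr P'"
          using dual_exponent \<Gamma>_growth by (intro powr_mono2) auto
        also have "\<dots> = C powr P' * \<bar>1 + \<bar>u x\<bar> powr (P - 1)\<bar> powr P'" using C_pos by (simp add: powr_mult)
        also have "\<dots> \<le> C powr P' * (2 powr P' * (\<bar>1\<bar> powr P' + \<bar>\<bar>u x\<bar> powr (P - 1)\<bar> powr P'))"
          using dual_exponent by (intro mult_left_mono abs_add_powr_le) auto
        also have "\<dots> = C powr P' * (2 powr P' * (1 + \<bar>u x\<bar> powr P))" by (simp add: powr_powr dual_exponent(3))
        finally show "norm (\<bar>- \<Gamma> (u x)\<bar> powr P') \<le> norm (C powr P' * (2 powr P' * (1 + \<bar>u x\<bar> powr P)))" by simp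
      qed
    qed measurable
    from dual_integrable_add[OF _ _ h_int this] show ?thesis unfolding \<zeta>_def by simp
  qed
  have EL: "(LINT x|M. g x \<bullet> grad \<phi> x) = (LINT x|M. \<zeta> x * \<phi> x)" if \<phi>: "\<phi> \<in> T" for \<phi>
  proof -
    have m\<phi>: "(\<lambda>x. - 1 * \<phi> x) \<in> T" by (rule test_functions_cmult[OF \<phi>])
    have "L (\<lambda>x. - 1 * \<phi> x) = - L \<phi>" unfolding L_def grad_add_cmult(2)[OF \<phi> \<phi>] by simp
    then have L0: "L \<phi> = 0" using L_nonneg[OF \<phi>] L_nonneg[OF m\<phi>] by simp
    have i: "integrable M (\<lambda>x. \<zeta> x * \<phi> x)" "integrable M (\<lambda>x. h x * \<phi> x)"
      using dual_product_integrable(1)[OF _ test_measurable(3)[OF \<phi>] _ test_powr_integrable[OF \<phi>]] h_meas h_int \<zeta>m \<zeta>P by auto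
    have "(LINT x|M. h x * \<phi> x) - (LINT x|M. \<zeta> x * \<phi> x) = (LINT x|M. h x * \<phi> x - \<zeta> x * \<phi> x)" using i by simp
    also have "\<dots> = (LINT x|M. \<Gamma> (u x) * \<phi> x)" by (simp add: \<zeta>_def algebra_simps)
    finally show ?thesis using L0 unfolding L_def by simp
  qed
  obtain \<psi>0 where "W_limit \<psi>0 u (wgrad \<Omega> u)" using W_limit_if_W12_0[OF u0] by blast
  then have wu [measurable]: "wgrad \<Omega> u \<in> borel_measurable M" by (simp add: W_limit_def)
  have sol: "integrable M (\<lambda>x. wgrad \<Omega> u x \<bullet> wgrad \<Omega> v x) \<and> integrable M (\<lambda>x. \<zeta> x * v x) \<and>
     (LINT x|M. wgrad \<Omega> u x \<bullet> wgrad \<Omega> v x) = (LINT x|M. \<zeta> x * v x)" if v0: "v \<in> W12_0 \<Omega>" for v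
  proof -
    obtain \<psi> where l: "W_limit \<psi> v (wgrad \<Omega> v)" using W_limit_if_W12_0[OF v0] by blast
    then have T: "\<And>j. \<psi> j \<in> T" and v [measurable]: "v \<in> borel_measurable M"
      and wv [measurable]: "wgrad \<Omega> v \<in> borel_measurable M" and wv2: "integrable M (\<lambda>x. (norm (wgrad \<Omega> v x))\<^sup>2)"
      by (auto simp: W_limit_def)
    obtain r H where "strict_mono (r :: nat \<Rightarrow> nat)" and H: "integrable M H" and vP: "integrable M (\<lambda>x. \<bar>v x\<bar> powr P)"
      and pt: "AE x in M. (\<lambda>j. \<psi> (r j) x) \<longlonglongrightarrow> v x" "AE x in M. (\<lambda>j. grad (\<psi> (r j)) x) \<longlonglongrightarrow> wgrad \<Omega> v x"
      and dom: "AE x in M. \<forall>j. \<bar>\<psi> (r j) x\<bar> powr P \<le> H x" "AE x in M. \<forall>j. (norm (grad (\<psi> (r j)) x))\<^sup>2 \<le> H x"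
      using W_limit_dominated[OF l] by blast
    note [measurable] = test_measurable(3,4)[OF T]
    have 1: "(\<lambda>j. LINT x|M. g x \<bullet> grad (\<psi> (r j)) x) \<longlonglongrightarrow> (LINT x|M. g x \<bullet> wgrad \<Omega> v x)"
    proof (rule integral_dominated_convergence[where w = "\<lambda>x. (norm (g x))\<^sup>2 + H x"])
      show "integrable M (\<lambda>x. (norm (g x))\<^sup>2 + H x)" using g2 H by simp
      show "AE x in M. (\<lambda>j. g x \<bullet> grad (\<psi> (r j)) x) \<longlonglongrightarrow> g x \<bullet> wgrad \<Omega> v x"
        using pt(2) by eventually_elim (intro tendsto_intros)
      show "AE x in M. norm (g x \<bullet> grad (\<psi> (r j)) x) \<le> (norm (g x))\<^sup>2 + H x" for j
        using dom(2)
      proof eventually_elim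
        case (elim x)
        show ?case
          using abs_inner_le_sum_squares[of "g x" "grad (\<psi> (r j)) x"] elim[rule_format, of j]
          unfolding real_norm_def by linarith
      qed
    qed measurable
    have 2: "(\<lambda>j. LINT x|M. \<zeta> x * \<psi> (r j) x) \<longlonglongrightarrow> (LINT x|M. \<zeta> x * v x)"
    proof (rule integral_dominated_convergence[where w = "\<lambda>x. \<bar>\<zeta> x\<bar> powr P' + H x"])
      show "integrable M (\<lambda>x. \<bar>\<zeta> x\<bar> powr P' + H x)" using \<zeta>P H by simp
      show "AE x in M. (\<lambda>j. \<zeta> x * \<psi> (r j) x) \<longlonglongrightarrow> \<zeta> x * v x"
        using pt(1) by eventually_elim (intro tendsto_intros)
      show "AE x in M. norm (\<zeta> x * \<psi> (r j) x) \<le> \<bar>\<zeta> x\<bar> powr P' + H x" for j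
        using dom(1)
      proof eventually_elim
        case (elim x)
        then show ?case using Young_P[of "\<zeta> x" "\<psi> (r j) x"] elim[rule_format, of j] unfolding real_norm_def by linarith
      qed
    qed measurable
    have eq: "(LINT x|M. g x \<bullet> wgrad \<Omega> v x) = (LINT x|M. \<zeta> x * v x)"
      using LIMSEQ_unique[OF 1] 2 EL[OF T] by simp
    have gi: "integrable M (\<lambda>x. g x \<bullet> wgrad \<Omega> v x)" by (rule integrable_inner_L2[OF g wv g2 wv2])
    have ae: "AE x in M. g x \<bullet> wgrad \<Omega> v x = wgrad \<Omega> u x \<bullet> wgrad \<Omega> v x"
      using gu by eventually_elim simp
    have "integrable M (\<lambda>x. wgrad \<Omega> u x \<bullet> wgrad \<Omega> v x)"
      by (rule integrable_cong_AE_imp[OF gi _ ae]) measurable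
    moreover have "(LINT x|M. g x \<bullet> wgrad \<Omega> v x) = (LINT x|M. wgrad \<Omega> u x \<bullet> wgrad \<Omega> v x)"
      by (rule integral_cong_AE[OF _ _ ae]) measurable
    moreover have "integrable M (\<lambda>x. \<zeta> x * v x)" by (rule dual_product_integrable(1)[OF \<zeta>m v \<zeta>P vP])
    ultimately show ?thesis using eq by simp
  qed
  show ?thesis unfolding weak_solution_def using u0 sol unfolding \<zeta>_def by blast
qed

end

section \<open>The problem with critical growth and a small parameter\<close>

lemma continuous_pos_powr:
  assumes "r > 0"
  shows "continuous_on UNIV (\<lambda>t::real. (max t 0) powr r)"
  using assms by (intro continuous_on_powr' continuous_intros) auto

lemma has_real_derivative_pos_powr:
  assumes r: "r > 0"
  shows "((\<lambda>t::real. (max t 0) powr (r + 1)) has_real_derivative (r + 1) * (max t 0) powr r) (at t)"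
proof -
  consider "t > 0" | "t < 0" | "t = 0" by linarith
  then show ?thesis
  proof cases
    case 1
    have "((\<lambda>t. t powr (r + 1)) has_real_derivative (r + 1) * (max t 0) powr r) (at t)"
      using 1 by (auto intro!: derivative_eq_intros)
    then show ?thesis
      by (rule has_field_derivative_transform_within_open[where S = "{0<..}"]) (use 1 in auto)
  next
    case 2
    have "((\<lambda>t. 0) has_real_derivative (r + 1) * (max t 0) powr r) (at t)"
      using 2 by auto
    then show ?thesis
      by (rule has_field_derivative_transform_within_open[where S = "{..<0}"]) (use 2 in auto)
  next
    case 3
    from abs_powr_tendsto_0[OF r] have "((\<lambda>h. ((max (0 + h) 0) powr (r + 1) - (max 0 0) powr (r + 1)) / h) \<longlongrightarrow> 0) (at 0)"
    proof (rule Lim_null_comparison[rotated])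
      show "\<forall>\<^sub>F h in at 0. norm (((max (0 + h) 0) powr (r + 1) - (max 0 0) powr (r + 1)) / h) \<le> \<bar>h\<bar> powr r"
        using r by (auto simp: eventually_at_filter powr_add max_def)
    qed
    then show ?thesis using 3 r by (simp add: DERIV_def)
  qed
qed

lemma pos_powr_midpoint:
  fixes s t :: real
  assumes p: "p \<ge> 1"
  shows "(max (s / 2 + t / 2) 0) powr p \<le> (max s 0) powr p / 2 + (max t 0) powr p / 2"
proof -
  define x y where "x = max s 0" and "y = max t 0"
  have xy: "x \<ge> 0" "y \<ge> 0" by (auto simp: x_def y_def)
  have "(max (s / 2 + t / 2) 0) powr p \<le> (x / 2 + y / 2) powr p"
    using p by (intro powr_mono2) (auto simp: x_def y_def)
  also have "\<dots> \<le> x powr p / 2 + y powr p / 2"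
  proof (cases "x = 0 \<or> y = 0")
    case True
    have *: "(z / 2) powr p \<le> z powr p / 2" if "z \<ge> 0" for z :: real
    proof -
      have "2 powr 1 \<le> (2::real) powr p" using p by (intro powr_mono) auto
      then have "z powr p / 2 powr p \<le> z powr p / 2" by (intro divide_left_mono) auto
      then show ?thesis using that by (simp add: powr_divide)
    qed
    show ?thesis using True *[OF xy(1)] *[OF xy(2)] p by auto
  next
    case False
    then have "x \<in> {0<..}" "y \<in> {0<..}" using xy by auto
    from convex_onD[OF powr_convex[OF p], of "1/2" x y] this show ?thesis by simp
  qed
  finally show ?thesis by (simp add: x_def y_def)
qed

lemma powr_eventually_dominated:
  fixes r p \<epsilon> :: real
  assumes "r < p" "\<epsilon> > 0"
  obtains B where "B \<ge> 1" "\<And>y. y \<ge> B \<Longrightarrow> y powr r \<le> \<epsilon> * y powr p"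
proof -
  define B where "B = max 1 ((1 / \<epsilon>) powr (1 / (p - r)))"
  have "y powr r \<le> \<epsilon> * y powr p" if y: "y \<ge> B" for y
  proof -
    have y1: "y \<ge> 1" using y by (simp add: B_def)
    have "1 / \<epsilon> = ((1 / \<epsilon>) powr (1 / (p - r))) powr (p - r)" using assms by (simp add: powr_powr)
    also have "\<dots> \<le> y powr (p - r)" using y assms by (intro powr_mono2) (auto simp: B_def)
    finally have "1 \<le> \<epsilon> * y powr (p - r)" using assms by (simp add: field_simps)
    then have "1 * y powr r \<le> \<epsilon> * y powr (p - r) * y powr r" by (rule mult_right_mono) simp
    also have "\<dots> = \<epsilon> * y powr p" using y1 by (simp add: mult.assoc powr_add[symmetric])
    finally show ?thesis by simp
  qed
  then show ?thesis using that[of B] by (simp add: B_def)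
qed

context bounded_domain
begin

text \<open>Young's inequality is applied to \<open>\<phi> / \<rho>\<close>, whose gradient has norm \<open>1\<close>: this makes the estimate linear
  in \<open>\<rho>\<close>, as coercivity requires.\<close>

lemma dual_estimate:
  assumes S: "\<And>\<phi>. \<phi> \<in> T \<Longrightarrow> (LINT x|M. \<bar>\<phi> x\<bar> powr P) \<le> S * dirichlet \<phi> powr (P / 2)"
    and h: "h \<in> borel_measurable M" "integrable M (\<lambda>x. \<bar>h x\<bar> powr P')"
    and \<phi>: "\<phi> \<in> T" and \<rho>: "\<rho> > 0" "dirichlet \<phi> = \<rho>\<^sup>2"
  shows "\<bar>LINT x|M. h x * \<phi> x\<bar> \<le> \<rho> * ((LINT x|M. \<bar>h x\<bar> powr P') + S)"
proof -
  let ?v = "\<lambda>x. (1 / \<rho>) * \<phi> x"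
  have vT: "?v \<in> T" by (rule test_functions_cmult[OF \<phi>])
  have "dirichlet ?v = (LINT x|M. (1 / \<rho>)\<^sup>2 * (norm (grad \<phi> x))\<^sup>2)"
    unfolding dirichlet_def grad_add_cmult(2)[OF \<phi> \<phi>] by (simp add: power_mult_distrib power_divide)
  also have "\<dots> = (1 / \<rho>)\<^sup>2 * dirichlet \<phi>" unfolding dirichlet_def by simp
  also have "\<dots> = 1" using \<rho> by (simp add: power_divide)
  finally have "(LINT x|M. \<bar>?v x\<bar> powr P) \<le> S" using S[OF vT] by simp
  moreover have "\<bar>LINT x|M. h x * ?v x\<bar> \<le> (LINT x|M. \<bar>h x\<bar> powr P') + (LINT x|M. \<bar>?v x\<bar> powr P)"
    by (rule dual_product_integrable(2)[OF h(1) test_measurable(3)[OF vT] h(2) test_powr_integrable[OF vT]])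
  ultimately have v: "\<bar>LINT x|M. h x * ?v x\<bar> \<le> (LINT x|M. \<bar>h x\<bar> powr P') + S" by (rule order_trans[rotated, OF add_left_mono])
  have "(LINT x|M. h x * \<phi> x) = (LINT x|M. \<rho> * (h x * ?v x))" using \<rho>(1) by simp
  also have "\<dots> = \<rho> * (LINT x|M. h x * ?v x)" by (rule integral_mult_right_zero)
  finally have "\<bar>LINT x|M. h x * \<phi> x\<bar> = \<rho> * \<bar>LINT x|M. h x * ?v x\<bar>" using \<rho>(1) by (simp add: abs_mult)
  also have "\<dots> \<le> \<rho> * ((LINT x|M. \<bar>h x\<bar> powr P') + S)" using v \<rho>(1) by (intro mult_left_mono) auto
  finally show ?thesis .
qed

text \<open>As \<open>r < 2\<close>, large values of \<open>\<bar>\<phi>\<bar> powr r\<close> are dominated by a small multiple of the square, which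
  Poincare's inequality absorbs into the gradient; small values contribute a constant.\<close>

lemma sublinear_integral_bound:
  assumes p: "1 < r" "r < 2" and C: "C > 0" and a: "a \<ge> 0"
    and Poincare: "\<And>\<phi>. \<phi> \<in> T \<Longrightarrow> (LINT x|M. (\<phi> x)\<^sup>2) \<le> C * dirichlet \<phi>"
  obtains K where "K \<ge> 0" "\<And>\<phi>. \<phi> \<in> T \<Longrightarrow> a * (LINT x|M. \<bar>\<phi> x\<bar> powr r) \<le> dirichlet \<phi> / 4 + K"
proof -
  define \<epsilon> where "\<epsilon> = 1 / (4 * C * (a + 1))"
  have e: "\<epsilon> > 0" using C a by (simp add: \<epsilon>_def)
  obtain B where B: "B \<ge> 1" "\<And>y. y \<ge> B \<Longrightarrow> y powr r \<le> \<epsilon> * y powr 2"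
    using powr_eventually_dominated[OF p(2) e] by blast
  have pt: "\<bar>y\<bar> powr r \<le> \<epsilon> * y\<^sup>2 + B powr r" for y
  proof (cases "\<bar>y\<bar> \<ge> B")
    case True
    then have "y \<noteq> 0" using B(1) by auto
    then have "\<bar>y\<bar> powr 2 = y\<^sup>2" by simp
    then show ?thesis using B(2)[OF True] by (simp add: add_increasing2)
  next
    case False
    then have "\<bar>y\<bar> powr r \<le> B powr r" using p by (intro powr_mono2) auto
    moreover have "0 \<le> \<epsilon> * y\<^sup>2" using e by simp
    ultimately show ?thesis by linarith
  qed
  show ?thesis
  proof (rule that[of "a * (B powr r * measure M (space M))"])
    fix \<phi> assume \<phi>: "\<phi> \<in> T"
    note [measurable] = test_measurable(3)[OF \<phi>] and i = test_square_integrals(1)[OF \<phi>]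
    have aC: "a * \<epsilon> * C \<le> 1 / 4"
    proof -
      have "a * \<epsilon> * C = a / (4 * (a + 1))" using C by (simp add: \<epsilon>_def)
      also have "\<dots> \<le> 1 / 4" using a by (simp add: divide_le_eq)
      finally show ?thesis .
    qed
    have "integrable M (\<lambda>x. \<bar>\<phi> x\<bar> powr r)"
    proof (rule Bochner_Integration.integrable_bound)
      show "integrable M (\<lambda>x. \<epsilon> * (\<phi> x)\<^sup>2 + B powr r)" using i by simp
      show "AE x in M. norm (\<bar>\<phi> x\<bar> powr r) \<le> norm (\<epsilon> * (\<phi> x)\<^sup>2 + B powr r)"
        using pt e by (intro AE_I2) simp
    qed measurable
    then have "(LINT x|M. \<bar>\<phi> x\<bar> powr r) \<le> (LINT x|M. \<epsilon> * (\<phi> x)\<^sup>2 + B powr r)"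
      using pt i by (intro integral_mono) auto
    also have "\<dots> = \<epsilon> * (LINT x|M. (\<phi> x)\<^sup>2) + B powr r * measure M (space M)" using i by simp
    also have "\<dots> \<le> \<epsilon> * (C * dirichlet \<phi>) + B powr r * measure M (space M)"
      using Poincare[OF \<phi>] e by simp
    finally have "a * (LINT x|M. \<bar>\<phi> x\<bar> powr r) \<le> a * (\<epsilon> * (C * dirichlet \<phi>) + B powr r * measure M (space M))"
      using a by (rule mult_left_mono)
    also have "\<dots> = (a * \<epsilon> * C) * dirichlet \<phi> + a * (B powr r * measure M (space M))" by (simp add: algebra_simps)
    also have "(a * \<epsilon> * C) * dirichlet \<phi> + a * (B powr r * measure M (space M)) \<le> dirichlet \<phi> / 4 + a * (B powr r * measure M (space M))"
      using mult_right_mono[OF aC dirichlet_nonneg[of \<phi>]] by simp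
    finally show "a * (LINT x|M. \<bar>\<phi> x\<bar> powr r) \<le> dirichlet \<phi> / 4 + a * (B powr r * measure M (space M))" .
  qed (use a in simp)
qed

text \<open>\<open>R0\<close> is so large that the energy without the terms in \<open>lam\<close> is at least \<open>1\<close> outside the ball of radius
  \<open>R0\<close>. With \<open>R = R0 + 1\<close> fixed, the terms in \<open>lam\<close> lower the energy on the shell by at most \<open>lam E\<close>, since
  the critical term is nonnegative. Hence \<open>lam < 1 / (2 E)\<close> leaves a barrier of height \<open>1 / 2\<close>.\<close>

lemma critical_problem_solvable:
  fixes a b c s q :: real
  assumes \<alpha>: "\<alpha> \<in> borel_measurable M" "integrable M (\<lambda>x. \<bar>\<alpha> x\<bar> powr P')"
    and \<beta>: "\<beta> \<in> borel_measurable M" "integrable M (\<lambda>x. \<bar>\<beta> x\<bar> powr P')"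
    and b: "b > 0" and c: "c > 0" and s: "0 < s" "s < 1" and q: "1 < q" "q < P - 1"
  shows "\<exists>lamstar > 0. \<forall>lam \<in> {0<..<lamstar}. \<exists>u.
     weak_solution \<Omega> (\<lambda>x t. (\<alpha> x + lam * \<beta> x) -
        (lam * c * (max t 0) powr (P - 1) - (a * (\<bar>t\<bar> powr (s - 1) * t) + lam * b * (\<bar>t\<bar> powr (q - 1) * t)))) u"
proof -
  obtain CP where CP: "CP > 0" "\<And>\<phi>. \<phi> \<in> T \<Longrightarrow> (LINT x|M. (\<phi> x)\<^sup>2) \<le> CP * dirichlet \<phi>"
    using test_Poincare unfolding dirichlet_def by blast
  obtain S where S: "S > 0" "\<And>\<phi>. \<phi> \<in> T \<Longrightarrow> integrable M (\<lambda>x. \<bar>\<phi> x\<bar> powr P)"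
    "\<And>\<phi>. \<phi> \<in> T \<Longrightarrow> (LINT x|M. \<bar>\<phi> x\<bar> powr P) \<le> S * dirichlet \<phi> powr (P / 2)"
    using test_Sobolev unfolding dirichlet_def by blast
  have s1: "1 < s + 1" "s + 1 < 2" using s by auto
  have aa: "\<bar>a\<bar> \<ge> 0" by simp
  obtain K where K: "K \<ge> 0" "\<And>\<phi>. \<phi> \<in> T \<Longrightarrow> \<bar>a\<bar> * (LINT x|M. \<bar>\<phi> x\<bar> powr (s + 1)) \<le> dirichlet \<phi> / 4 + K"
    using sublinear_integral_bound[OF s1 CP(1) aa CP(2)] by blast
  define \<mu> where "\<mu> = measure M (space M)"
  define U where "U = (LINT x|M. \<bar>\<alpha> x\<bar> powr P') + S"
  define V where "V = (LINT x|M. \<bar>\<beta> x\<bar> powr P') + S"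
  have UV: "U \<ge> 0" "V \<ge> 0" "\<mu> \<ge> 0" using S(1) by (auto simp: U_def V_def \<mu>_def)
  define R0 where "R0 = 4 * (U + K + 1)"
  define R where "R = R0 + 1"
  have R: "R0 \<ge> 1" "R > R0" using UV K(1) by (auto simp: R0_def R_def)
  define E where "E = b * (\<mu> + S * R powr P) + R * V + 1"
  have E: "E > 0" using b UV S(1) R by (auto simp: E_def intro!: add_nonneg_pos)
  show ?thesis
  proof (intro exI[of _ "1 / (2 * E)"] conjI ballI)
    show "1 / (2 * E) > 0" using E by simp
    fix lam assume "lam \<in> {0<..<1 / (2 * E)}"
    then have lam: "lam > 0" "lam * E < 1 / 2" using E by (auto simp: field_simps)
    define h where "h x = \<alpha> x + lam * \<beta> x" for x
    define F where "F t = lam * c / P * (max t 0) powr P" for t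
    define k where "k t = a / (s + 1) * \<bar>t\<bar> powr (s + 1) + lam * b / (q + 1) * \<bar>t\<bar> powr (q + 1)" for t
    define \<Gamma> where "\<Gamma> t = lam * c * (max t 0) powr (P - 1) - (a * (\<bar>t\<bar> powr (s - 1) * t) + lam * b * (\<bar>t\<bar> powr (q - 1) * t))" for t
    define C where "C = lam * c + \<bar>a\<bar> + lam * b + 1"
    have C: "C > 0" "lam * c + \<bar>a\<bar> + lam * b \<le> C" using lam b c by (auto simp: C_def intro!: add_nonneg_pos)
    have as: "\<bar>a\<bar> / (s + 1) \<le> \<bar>a\<bar>" "lam * b / (q + 1) \<le> lam * b" "lam * c / P \<le> lam * c"
    proof -
      have dv: "x / y \<le> x" if "0 \<le> x" "1 \<le> y" for x y :: real
        using divide_left_mono[of 1 y x] that by simp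
      show "\<bar>a\<bar> / (s + 1) \<le> \<bar>a\<bar>" "lam * b / (q + 1) \<le> lam * b" "lam * c / P \<le> lam * c"
        by (rule dv; use s q lam b c P_gt_2 in simp)+
    qed
    have k_le: "\<bar>k t\<bar> \<le> \<bar>a\<bar> * \<bar>t\<bar> powr (s + 1) + lam * b * \<bar>t\<bar> powr (q + 1)" for t
    proof -
      have "\<bar>k t\<bar> \<le> \<bar>a / (s + 1) * \<bar>t\<bar> powr (s + 1)\<bar> + \<bar>lam * b / (q + 1) * \<bar>t\<bar> powr (q + 1)\<bar>"
        unfolding k_def by (rule abs_triangle_ineq)
      also have "\<dots> = \<bar>a\<bar> / (s + 1) * \<bar>t\<bar> powr (s + 1) + lam * b / (q + 1) * \<bar>t\<bar> powr (q + 1)"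
        using s q lam b by (simp add: abs_mult)
      also have "\<dots> \<le> \<bar>a\<bar> * \<bar>t\<bar> powr (s + 1) + lam * b * \<bar>t\<bar> powr (q + 1)"
        by (intro add_mono mult_right_mono as) auto
      finally show ?thesis .
    qed
    have low: "\<bar>t\<bar> powr r \<le> 1 + \<bar>t\<bar> powr p" if "0 \<le> r" "r \<le> p" for t r p :: real
      using powr_le_one_add[of "\<bar>t\<bar>" r p] that by simp
    have Fc: "continuous_on UNIV F" unfolding F_def[abs_def] using P_gt_2 by (intro continuous_intros continuous_pos_powr) auto
    have kc: "continuous_on UNIV k"
    proof -
      have pc: "continuous_on UNIV (\<lambda>t::real. \<bar>t\<bar> powr r)" if "r > 0" for r
        using that by (intro continuous_on_powr' continuous_intros) auto
      show ?thesis unfolding k_def[abs_def]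
        by (intro continuous_on_add continuous_on_mult continuous_on_const pc) (use s q in auto)
    qed
    have F_le: "\<bar>F t\<bar> \<le> C * (1 + \<bar>t\<bar> powr P)" for t
    proof -
      have "\<bar>F t\<bar> = lam * c / P * (max t 0) powr P" using lam c P_gt_2 by (simp add: F_def)
      also have "\<dots> \<le> C * (1 + \<bar>t\<bar> powr P)"
      proof (rule mult_mono)
        have "0 \<le> lam * b" using lam b by simp
        then show "lam * c / P \<le> C" using as(3) by (simp add: C_def)
        have "(max t 0) powr P \<le> \<bar>t\<bar> powr P" using P_gt_2 by (intro powr_mono2) auto
        then show "(max t 0) powr P \<le> 1 + \<bar>t\<bar> powr P" by simp
      qed (use C in auto)
      finally show ?thesis .
    qed
    have k_growth: "\<bar>k t\<bar> \<le> C * (1 + \<bar>t\<bar> powr P)" for t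
    proof -
      have "\<bar>k t\<bar> \<le> \<bar>a\<bar> * (1 + \<bar>t\<bar> powr P) + lam * b * (1 + \<bar>t\<bar> powr P)"
        by (rule order_trans[OF k_le]) (use s q P_gt_2 lam b in \<open>intro add_mono mult_left_mono low; simp\<close>)
      also have "\<dots> = (\<bar>a\<bar> + lam * b) * (1 + \<bar>t\<bar> powr P)" by (simp add: algebra_simps)
      also have "\<dots> \<le> C * (1 + \<bar>t\<bar> powr P)" using lam c by (intro mult_right_mono) (auto simp: C_def)
      finally show ?thesis .
    qed
    have k_sub: "\<exists>B. \<forall>t. \<bar>t\<bar> \<ge> B \<longrightarrow> \<bar>k t\<bar> \<le> \<epsilon> * \<bar>t\<bar> powr P" if e: "\<epsilon> > 0" for \<epsilon>
    proof -
      define \<delta> where "\<delta> = \<epsilon> / (\<bar>a\<bar> + lam * b + 1)"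
      have den: "\<bar>a\<bar> + lam * b + 1 > 0" using lam b by (simp add: add_nonneg_pos)
      then have d: "\<delta> > 0" using e by (simp add: \<delta>_def)
      have rp: "s + 1 < P" "q + 1 < P" using s q P_gt_2 by auto
      obtain B1 where B1: "\<And>y. y \<ge> B1 \<Longrightarrow> y powr (s + 1) \<le> \<delta> * y powr P" using powr_eventually_dominated[OF rp(1) d] by blast
      obtain B2 where B2: "\<And>y. y \<ge> B2 \<Longrightarrow> y powr (q + 1) \<le> \<delta> * y powr P" using powr_eventually_dominated[OF rp(2) d] by blast
      have "\<bar>k t\<bar> \<le> \<epsilon> * \<bar>t\<bar> powr P" if t: "\<bar>t\<bar> \<ge> max B1 B2" for t
      proof -
        have "\<bar>k t\<bar> \<le> \<bar>a\<bar> * (\<delta> * \<bar>t\<bar> powr P) + lam * b * (\<delta> * \<bar>t\<bar> powr P)"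
          by (rule order_trans[OF k_le]) (use B1[of "\<bar>t\<bar>"] B2[of "\<bar>t\<bar>"] t lam b in \<open>intro add_mono mult_left_mono; simp\<close>)
        also have "\<dots> \<le> (\<bar>a\<bar> + lam * b + 1) * (\<delta> * \<bar>t\<bar> powr P)" using d by (simp add: algebra_simps)
        also have "\<dots> = \<epsilon> * \<bar>t\<bar> powr P" unfolding \<delta>_def using den by simp
        finally show ?thesis .
      qed
      then show ?thesis by blast
    qed
    have \<Gamma>c: "continuous_on UNIV \<Gamma>" unfolding \<Gamma>_def[abs_def]
      by (intro continuous_on_diff continuous_on_add continuous_on_mult[OF continuous_on_const]
          continuous_pos_powr continuous_abs_powr_times) (use P_gt_2 s q in auto)
    have \<Gamma>d: "((\<lambda>t. F t - k t) has_real_derivative \<Gamma> t) (at t)" for t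
    proof -
      have "((\<lambda>t. (max t 0) powr ((P - 1) + 1)) has_real_derivative ((P - 1) + 1) * (max t 0) powr (P - 1)) (at t)"
        using P_gt_2 by (intro has_real_derivative_pos_powr) simp
      then have 1: "((\<lambda>t. (max t 0) powr P) has_real_derivative P * (max t 0) powr (P - 1)) (at t)" by simp
      have "s > 0" "q > 0" using s q by auto
      note 2 = has_real_derivative_abs_powr[OF \<open>s > 0\<close>, of t] has_real_derivative_abs_powr[OF \<open>q > 0\<close>, of t]
      show ?thesis unfolding F_def k_def \<Gamma>_def
        using DERIV_diff[OF DERIV_cmult[OF 1, of "lam * c / P"]
            DERIV_add[OF DERIV_cmult[OF 2(1), of "a / (s + 1)"] DERIV_cmult[OF 2(2), of "lam * b / (q + 1)"]]] s q P_gt_2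
        by (simp add: mult.assoc)
    qed
    have \<Gamma>g: "\<bar>\<Gamma> t\<bar> \<le> C * (1 + \<bar>t\<bar> powr (P - 1))" for t
    proof -
      have m: "(max t 0) powr (P - 1) \<le> 1 + \<bar>t\<bar> powr (P - 1)"
        using powr_mono2[of "P - 1" "max t 0" "\<bar>t\<bar>"] P_gt_2 by (simp add: add_increasing)
      have pr: "\<bar>\<bar>t\<bar> powr (r - 1) * t\<bar> \<le> 1 + \<bar>t\<bar> powr (P - 1)" if "0 < r" "r \<le> P - 1" for r
      proof -
        have "\<bar>\<bar>t\<bar> powr (r - 1) * t\<bar> = \<bar>t\<bar> powr r" by (simp add: abs_mult powr_diff)
        then show ?thesis using low[of r "P - 1" t] that by simp
      qed
      have "\<bar>\<Gamma> t\<bar> \<le> \<bar>lam * c * (max t 0) powr (P - 1)\<bar> + (\<bar>a * (\<bar>t\<bar> powr (s - 1) * t)\<bar> + \<bar>lam * b * (\<bar>t\<bar> powr (q - 1) * t)\<bar>)"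
        unfolding \<Gamma>_def by linarith
      also have "\<dots> = lam * c * (max t 0) powr (P - 1) + (\<bar>a\<bar> * \<bar>\<bar>t\<bar> powr (s - 1) * t\<bar> + lam * b * \<bar>\<bar>t\<bar> powr (q - 1) * t\<bar>)"
        using lam b c by (simp add: abs_mult)
      also have "\<dots> \<le> lam * c * (1 + \<bar>t\<bar> powr (P - 1)) + (\<bar>a\<bar> * (1 + \<bar>t\<bar> powr (P - 1)) + lam * b * (1 + \<bar>t\<bar> powr (P - 1)))"
        using m pr[of s] pr[of q] s q P_gt_2 lam b c by (intro add_mono mult_left_mono) auto
      also have "\<dots> = (lam * c + \<bar>a\<bar> + lam * b) * (1 + \<bar>t\<bar> powr (P - 1))" by (simp add: algebra_simps)
      also have "\<dots> \<le> C * (1 + \<bar>t\<bar> powr (P - 1))" using C by (intro mult_right_mono) auto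
      finally show ?thesis .
    qed
    have hm: "h \<in> borel_measurable M" unfolding h_def[abs_def] using \<alpha>(1) \<beta>(1) by measurable
    have hP: "integrable M (\<lambda>x. \<bar>h x\<bar> powr P')"
    proof (rule Bochner_Integration.integrable_bound)
      show "integrable M (\<lambda>x. 2 powr P' * (\<bar>\<alpha> x\<bar> powr P' + lam powr P' * \<bar>\<beta> x\<bar> powr P'))" using \<alpha> \<beta> by simp
      show "(\<lambda>x. \<bar>h x\<bar> powr P') \<in> borel_measurable M" using hm by measurable
      show "AE x in M. norm (\<bar>h x\<bar> powr P') \<le> norm (2 powr P' * (\<bar>\<alpha> x\<bar> powr P' + lam powr P' * \<bar>\<beta> x\<bar> powr P'))"
      proof (rule AE_I2)
        fix x
        have "\<bar>\<alpha> x + lam * \<beta> x\<bar> powr P' \<le> 2 powr P' * (\<bar>\<alpha> x\<bar> powr P' + \<bar>lam * \<beta> x\<bar> powr P')"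
          using dual_exponent by (intro abs_add_powr_le) simp
        then show "norm (\<bar>h x\<bar> powr P') \<le> norm (2 powr P' * (\<bar>\<alpha> x\<bar> powr P' + lam powr P' * \<bar>\<beta> x\<bar> powr P'))"
          using lam by (simp add: h_def abs_mult powr_mult)
      qed
    qed
    have barrier: "energy F k h \<phi> \<ge> 1 / 2" if \<phi>: "\<phi> \<in> T" and D: "R0\<^sup>2 \<le> dirichlet \<phi>" "dirichlet \<phi> \<le> R\<^sup>2" for \<phi>
    proof -
      define \<rho> where "\<rho> = sqrt (dirichlet \<phi>)"
      have \<rho>2: "dirichlet \<phi> = \<rho>\<^sup>2" using dirichlet_nonneg[of \<phi>] by (simp add: \<rho>_def)
      have \<rho>: "R0 \<le> \<rho>" "\<rho> \<le> R" unfolding \<rho>_def using D R by (auto intro: real_le_rsqrt real_le_lsqrt)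
      have \<rho>0: "\<rho> > 0" using \<rho> R by linarith
      note m = test_measurable(3)[OF \<phi>]
      note iP = S(2)[OF \<phi>]
      have PP: "(LINT x|M. \<bar>\<phi> x\<bar> powr P) \<le> S * R powr P"
      proof -
        have "dirichlet \<phi> powr (P / 2) = \<rho> powr P" using \<rho>0 by (simp add: \<rho>2 powr_powr flip: powr_numeral)
        also have "\<dots> \<le> R powr P" using \<rho> \<rho>0 P_gt_2 by (intro powr_mono2) auto
        finally show ?thesis using S(3)[OF \<phi>] mult_left_mono[of "dirichlet \<phi> powr (P / 2)" "R powr P" S] S(1) by linarith
      qed
      have ipow: "integrable M (\<lambda>x. \<bar>\<phi> x\<bar> powr r)" if "0 \<le> r" "r \<le> P" for r
      proof (rule Bochner_Integration.integrable_bound)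
        show "integrable M (\<lambda>x. 1 + \<bar>\<phi> x\<bar> powr P)" using iP by simp
        show "(\<lambda>x. \<bar>\<phi> x\<bar> powr r) \<in> borel_measurable M" using m by measurable
        show "AE x in M. norm (\<bar>\<phi> x\<bar> powr r) \<le> norm (1 + \<bar>\<phi> x\<bar> powr P)" using low[OF that] by (intro AE_I2) simp
      qed
      have rr: "0 \<le> s + 1" "s + 1 \<le> P" "0 \<le> q + 1" "q + 1 \<le> P" using s q P_gt_2 by auto
      have ik: "integrable M (\<lambda>x. k (\<phi> x))" by (rule growth_integrable[OF kc k_growth m iP])
      have "(LINT x|M. k (\<phi> x)) \<le> (LINT x|M. \<bar>a\<bar> * \<bar>\<phi> x\<bar> powr (s + 1) + lam * b * (1 + \<bar>\<phi> x\<bar> powr P))"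
      proof (rule integral_mono[OF ik])
        show "integrable M (\<lambda>x. \<bar>a\<bar> * \<bar>\<phi> x\<bar> powr (s + 1) + lam * b * (1 + \<bar>\<phi> x\<bar> powr P))"
          using ipow[OF rr(1,2)] iP by simp
        fix x
        have "lam * b * \<bar>\<phi> x\<bar> powr (q + 1) \<le> lam * b * (1 + \<bar>\<phi> x\<bar> powr P)"
          using lam b by (intro mult_left_mono low rr) auto
        then show "k (\<phi> x) \<le> \<bar>a\<bar> * \<bar>\<phi> x\<bar> powr (s + 1) + lam * b * (1 + \<bar>\<phi> x\<bar> powr P)"
          using k_le[of "\<phi> x"] by linarith
      qed
      also have "\<dots> = \<bar>a\<bar> * (LINT x|M. \<bar>\<phi> x\<bar> powr (s + 1)) + lam * b * (\<mu> + (LINT x|M. \<bar>\<phi> x\<bar> powr P))"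
        using ipow[OF rr(1,2)] iP by (simp add: \<mu>_def)
      also have "\<dots> \<le> (dirichlet \<phi> / 4 + K) + lam * b * (\<mu> + S * R powr P)"
        using K(2)[OF \<phi>] PP lam b by (intro add_mono mult_left_mono) auto
      finally have k1: "(LINT x|M. k (\<phi> x)) \<le> (dirichlet \<phi> / 4 + K) + lam * (b * (\<mu> + S * R powr P))"
        by (simp add: mult.assoc)
      have i\<alpha>: "integrable M (\<lambda>x. \<alpha> x * \<phi> x)" and i\<beta>: "integrable M (\<lambda>x. \<beta> x * \<phi> x)"
        by (rule dual_product_integrable(1)[OF \<alpha>(1) m \<alpha>(2) iP], rule dual_product_integrable(1)[OF \<beta>(1) m \<beta>(2) iP])
      have "(LINT x|M. h x * \<phi> x) = (LINT x|M. \<alpha> x * \<phi> x + lam * (\<beta> x * \<phi> x))" by (simp add: h_def algebra_simps)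
      also have "\<dots> = (LINT x|M. \<alpha> x * \<phi> x) + lam * (LINT x|M. \<beta> x * \<phi> x)" using i\<alpha> i\<beta> by simp
      finally have hs: "(LINT x|M. h x * \<phi> x) = (LINT x|M. \<alpha> x * \<phi> x) + lam * (LINT x|M. \<beta> x * \<phi> x)" .
      have h1: "(LINT x|M. \<alpha> x * \<phi> x) \<le> \<rho> * U" "(LINT x|M. \<beta> x * \<phi> x) \<le> \<rho> * V"
        using dual_estimate[OF S(3) \<alpha> \<phi> \<rho>0 \<rho>2] dual_estimate[OF S(3) \<beta> \<phi> \<rho>0 \<rho>2] by (auto simp: U_def V_def abs_le_iff)
      have "\<rho> * V \<le> R * V" using \<rho> UV by (intro mult_right_mono) auto
      then have "lam * (LINT x|M. \<beta> x * \<phi> x) \<le> lam * (R * V)" using h1(2) lam by (intro mult_left_mono) auto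
      with h1(1) hs have h2: "(LINT x|M. h x * \<phi> x) \<le> \<rho> * U + lam * (R * V)" by simp
      have F1: "0 \<le> (LINT x|M. F (\<phi> x))" using lam c P_gt_2 by (simp add: F_def)
      have small: "lam * (b * (\<mu> + S * R powr P)) + lam * (R * V) \<le> 1 / 2"
        using lam by (simp add: E_def algebra_simps)
      have "1 * 1 \<le> \<rho> * (\<rho> / 4 - U - K)"
        using \<rho>(1) R(1) K(1) UV by (intro mult_mono) (auto simp: R0_def)
      moreover have "\<rho> * (\<rho> / 4 - U - K) = \<rho>\<^sup>2 / 4 - \<rho> * U - \<rho> * K" by (simp add: power2_eq_square algebra_simps)
      moreover have "1 * K \<le> \<rho> * K" using \<rho>(1) R(1) K(1) by (intro mult_right_mono) auto
      ultimately have main: "1 \<le> \<rho>\<^sup>2 / 4 - \<rho> * U - K" by linarith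
      have "energy F k h \<phi> \<ge> dirichlet \<phi> / 2 + 0 - ((dirichlet \<phi> / 4 + K) + lam * (b * (\<mu> + S * R powr P))) - (\<rho> * U + lam * (R * V))"
        unfolding energy_def by (intro diff_mono add_mono order_refl F1 k1 h2)
      then show ?thesis using main small unfolding \<rho>2 by linarith
    qed
    interpret variational_problem \<Omega> F k \<Gamma> h C "R0\<^sup>2" "R\<^sup>2" "1 / 2"
    proof (unfold_locales)
      show "0 \<le> F t" "F 0 = 0" for t using lam c P_gt_2 by (auto simp: F_def)
      show "k 0 = 0" by (simp add: k_def)
      show "F (x / 2 + y / 2) \<le> F x / 2 + F y / 2" for x y
      proof -
        have "lam * c / P * (max (x / 2 + y / 2) 0) powr P \<le> lam * c / P * ((max x 0) powr P / 2 + (max y 0) powr P / 2)"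
          using lam c P_gt_2 by (intro mult_left_mono pos_powr_midpoint) auto
        then show ?thesis unfolding F_def by (simp add: algebra_simps)
      qed
      show "R0\<^sup>2 < R\<^sup>2" using R by (intro power_strict_mono) auto
    qed (use Fc F_le kc k_sub k_growth \<Gamma>c \<Gamma>d \<Gamma>g C hm hP barrier in auto)
    show "\<exists>u. weak_solution \<Omega> (\<lambda>x t. (\<alpha> x + lam * \<beta> x) -
        (lam * c * (max t 0) powr (P - 1) - (a * (\<bar>t\<bar> powr (s - 1) * t) + lam * b * (\<bar>t\<bar> powr (q - 1) * t)))) u"
      using weak_solution_exists unfolding h_def \<Gamma>_def .
  qed
qed

end

theorem theorem2p8:
  fixes \<Omega> :: "(real^'n) set"
    and \<alpha> \<beta> :: "real^'n \<Rightarrow> real"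
    and a b c s q :: real
    and f :: "real \<Rightarrow> real"
  assumes "CARD('n) \<ge> 3"
    and "open \<Omega>" and "bounded \<Omega>" and "smooth_boundary \<Omega>"
    and "\<alpha> \<in> Lp_on \<Omega> (2 * real CARD('n) / (real CARD('n) + 2))"
    and "\<beta> \<in> Lp_on \<Omega> (2 * real CARD('n) / (real CARD('n) + 2))"
    and "b > 0" and "c > 0"
    and "0 < s" and "s < 1"
    and "1 < q" and "q < (real CARD('n) + 2) / (real CARD('n) - 2)"
    and "\<And>\<xi>. f \<xi> = (if \<xi> \<ge> 0 then \<xi> powr ((real CARD('n) + 2) / (real CARD('n) - 2)) else 0)"
  shows "\<exists>lamstar > 0. \<forall>lam \<in> {0<..<lamstar}. \<exists>u.
           weak_solution \<Omega>
             (\<lambda>x t. a * (\<bar>t\<bar> powr (s - 1) * t) + \<alpha> x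
                     + lam * (b * (\<bar>t\<bar> powr (q - 1) * t) - c * f t + \<beta> x)) u"
proof -
  interpret bounded_domain \<Omega> by unfold_locales (use assms in auto)
  have n: "real CARD('n) \<ge> 3" using assms(1) by simp
  have P1: "P - 1 = (real CARD('n) + 2) / (real CARD('n) - 2)"
    using n unfolding P_def by (simp add: field_simps)
  have P'1: "P' = 2 * real CARD('n) / (real CARD('n) + 2)"
    unfolding P'_def P1 unfolding P_def using n by simp
  have f: "f t = (max t 0) powr (P - 1)" for t
    unfolding P1 assms(13) by (auto simp: max_def)
  have \<alpha>: "\<alpha> \<in> borel_measurable M" "integrable M (\<lambda>x. \<bar>\<alpha> x\<bar> powr P')"
    and \<beta>: "\<beta> \<in> borel_measurable M" "integrable M (\<lambda>x. \<bar>\<beta> x\<bar> powr P')"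
    using assms(5,6) unfolding Lp_on_def P'1 by auto
  have q: "q < P - 1" using assms(12) unfolding P1 .
  have eq: "(\<lambda>x t. a * (\<bar>t\<bar> powr (s - 1) * t) + \<alpha> x + lam * (b * (\<bar>t\<bar> powr (q - 1) * t) - c * f t + \<beta> x)) =
     (\<lambda>x t. (\<alpha> x + lam * \<beta> x) -
        (lam * c * (max t 0) powr (P - 1) - (a * (\<bar>t\<bar> powr (s - 1) * t) + lam * b * (\<bar>t\<bar> powr (q - 1) * t))))" for lam
    unfolding f by (intro ext) (simp add: algebra_simps)
  show ?thesis
    unfolding eq by (rule critical_problem_solvable[OF \<alpha> \<beta> assms(7-11) q])
qed

end
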